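(* Let $W\subset\mathbb{R}^2$ be a convex compact polygon with non-empty interior and let $\Lambda$ be a non-zero, locally finite, translation-invariant measure on the space of lines in $\mathbb{R}^2$ which is not concentrated on one direction. For every fixed $t\in[0,\infty)$, Mecke's continuous-time model $Y^M_d(\nu(t),W)$ and the STIT tessellation $Y^S(t,W)$ have identical distributions (as random closed sets).
   Context: Let $\mathcal H$ be the space of lines in $\mathbb{R}^2$ with the $\sigma$-algebra induced by the Borel $\sigma$-algebra of a parameter space. For $A\subset\mathbb{R}^2$, $[A]=\{g\in\mathcal H: g\cap A\ne\emptyset\}$; one has $0<\Lambda([W])<\infty$. $\mathcal E(\lambda)$ denotes the exponential distribution with parameter (rate) $\lambda$. $\partial$ denotes the boundary and the bar the closure. STIT process: it starts at time $0$ with the single cell $W$. Every cell $C$, from its birth on, has a lifetime distributed as $\mathcal E(\Lambda([C]))$, the lifetimes being (conditionally on the cells) independent of each other. At the end of its lifetime the cell $C$ is divided into two cells by the segment inside $C$ of a random line with law $\Lambda([C])^{-1}\Lambda(\cdot\cap[C])$; the two new cells then evolve independently by the same rule. If $C_1,\dots,C_m$ are the cells at time $t$, then $Y^S(t,W)=\overline{\bigcup_{j=1}^m\partial C_j\setminus\partial W}$. Mecke process in discrete time: let $\gamma_1,\gamma_2,\dots$ be i.i.d. lines with law $\Lambda([W])^{-1}\Lambda(\cdot\cap[W])$ and, independently of them, let $\alpha_1,\alpha_2,\dots$ be independent with $\alpha_j$ uniform on $\{1,\dots,j\}$. For a line $\gamma$ not containing the origin (almost surely the case), $\gamma^+$ is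 the open half-plane bounded by $\gamma$ containing the origin and $\gamma^-$ the other open half-plane. Put $\tilde C_{0,1}=W$, $\tilde C_{1,1}=W\cap\gamma_1^+$, $\tilde C_{1,2}=W\cap\gamma_1^-$, and for $n\ge2$: $\tilde C_{n,j}=\tilde C_{n-1,j}$ if $j\in\{1,\dots,n\}$, $j\neq\alpha_n$; $\tilde C_{n,\alpha_n}=\tilde C_{n-1,\alpha_n}\cap\gamma_n^-$; $\tilde C_{n,n+1}=\tilde C_{n-1,\alpha_n}\cap\gamma_n^+$. The $\tilde C_{n,j}$ are called quasi-cells (some may be empty). Put $Y^M_d(n,W)=\overline{\bigcup_{j=1}^{n+1}\partial\tilde C_{n,j}\setminus\partial W}$ for $n=0,1,2,\dots$. Mecke's continuous-time model at time $t$: $\nu(t)$ is a random variable independent of all $\gamma_j,\alpha_j$ with $\mathbb P(\nu(t)=k)=e^{-\Lambda([W])t}(1-e^{-\Lambda([W])t})^k$, $k=0,1,\dots$, and the model at time $t$ is $Y^M_d(\nu(t),W)$, i.e. the discrete-time process evaluated after $\nu(t)$ decisions. *)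

theory Defs
  imports "HOL-Probability.Probability"
begin

section \<open>The space of lines\<close>

definition line_of :: "real \<Rightarrow> real \<Rightarrow> (real^2) set" where
  "line_of \<phi> r = {x. x \<bullet> vector [cos \<phi>, sin \<phi>] = r}"

text \<open>
  Every line of the plane is \<open>line_of \<phi> r\<close> for exactly one parameter \<open>(\<phi>, r)\<close> with
  \<open>0 \<le> \<phi> < pi\<close>. Only the space and the sigma-algebra of the following measure are used: the
  measurable sets of lines are the images of the Borel sets of parameters.
\<close>

definition line_space :: "(real^2) set measure" where
  "line_space = embed_measure (restrict_space borel ({0..<pi} \<times> UNIV)) (\<lambda>(\<phi>, r). line_of \<phi> r)"

definition hitting :: "(real^2) set \<Rightarrow> (real^2) set set" where
  "hitting A = {g \<in> space line_space. g \<inter> A \<noteq> {}}"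

definition translation_invariant :: "(real^2) set measure \<Rightarrow> bool" where
  "translation_invariant \<Lambda> \<longleftrightarrow>
     (\<forall>a. \<forall>A \<in> sets line_space. emeasure \<Lambda> ((\<lambda>g. (+) a ` g) ` A) = emeasure \<Lambda> A)"

definition locally_finite :: "(real^2) set measure \<Rightarrow> bool" where
  "locally_finite \<Lambda> \<longleftrightarrow> (\<forall>K. compact K \<longrightarrow> emeasure \<Lambda> (hitting K) < \<infinity>)"

definition concentrated_on_one_direction :: "(real^2) set measure \<Rightarrow> bool" where
  "concentrated_on_one_direction \<Lambda> \<longleftrightarrow> (\<exists>\<phi>. AE g in \<Lambda>. \<exists>r. g = line_of \<phi> r)"

text \<open>
  For a line \<open>g\<close> not containing the origin, \<open>half_plane True g\<close> is the open half-plane bounded by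
  \<open>g\<close> that contains the origin (the points that \<open>g\<close> does not separate from it), and
  \<open>half_plane False g\<close> is the other one. Lines through the origin form a null set in all models
  below; for these, \<open>half_plane True g\<close> is empty.
\<close>

definition half_plane :: "bool \<Rightarrow> (real^2) set \<Rightarrow> (real^2) set" where
  "half_plane b g = {x. x \<notin> g \<and> (closed_segment 0 x \<inter> g = {} \<longleftrightarrow> b)}"


section \<open>Random closed sets\<close>

text \<open>
  The Borel sigma-algebra of the Fell topology on the closed sets of the plane, which is
  generated by the events of hitting a compact set.
\<close>

definition closed_set_space :: "(real^2) set measure" where
  "closed_set_space = sigma {F. closed F} {{F. closed F \<and> F \<inter> K \<noteq> {}} | K. compact K}"


section \<open>STIT tessellations\<close>

text \<open>
  The cells that ever occur are indexed by the nodes of the infinite binary tree. A node is the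
  list of the choices made on the way to it, the last choice first, so that \<open>v\<close> is the mother of
  \<open>True # v\<close> and \<open>False # v\<close>. For a realization, \<open>\<tau> v\<close> is the lifetime of the cell \<open>v\<close>, and \<open>g v\<close>
  is the line that divides it. Cells are taken to be closed.
\<close>

fun stit_cell :: "(real^2) set \<Rightarrow> (bool list \<Rightarrow> (real^2) set) \<Rightarrow> bool list \<Rightarrow> (real^2) set" where
  "stit_cell W g [] = W"
| "stit_cell W g (b # v) = closure (stit_cell W g v \<inter> half_plane b (g v))"

fun stit_birth :: "(bool list \<Rightarrow> real) \<Rightarrow> bool list \<Rightarrow> real" where
  "stit_birth \<tau> [] = 0"
| "stit_birth \<tau> (b # v) = stit_birth \<tau> v + \<tau> v"

definition stit_set ::
    "(real^2) set \<Rightarrow> (bool list \<Rightarrow> real) \<Rightarrow> (bool list \<Rightarrow> (real^2) set) \<Rightarrow> real \<Rightarrow> (real^2) set" where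
  "stit_set W \<tau> g t =
     closure ((\<Union>v \<in> {v. stit_birth \<tau> v \<le> t \<and> t < stit_birth \<tau> v + \<tau> v}.
                 frontier (stit_cell W g v)) - frontier W)"

text \<open>What happened to the cells of the generations before \<open>n\<close>:\<close>

definition stit_history ::
    "'a measure \<Rightarrow> (bool list \<Rightarrow> 'a \<Rightarrow> real) \<Rightarrow> (bool list \<Rightarrow> 'a \<Rightarrow> (real^2) set) \<Rightarrow> nat \<Rightarrow> 'a measure" where
  "stit_history M \<tau> g n =
     vimage_algebra (space M) (\<lambda>\<omega>. \<lambda>v\<in>{v. length v < n}. (\<tau> v \<omega>, g v \<omega>))
       (\<Pi>\<^sub>M v\<in>{v. length v < n}. borel \<Otimes>\<^sub>M line_space)"

text \<open>
  The generations before \<open>n\<close> determine the cells of generation \<open>n\<close>. Conditionally on these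
  generations, the lifetimes and dividing lines of all cells \<open>C\<close> of generation \<open>n\<close> are independent,
  the lifetime being exponential with rate \<open>\<Lambda> (hitting C)\<close> and the line having the law
  \<open>\<Lambda>\<close> restricted to \<open>hitting C\<close> and normalized.
\<close>

definition stit_model ::
    "(real^2) set measure \<Rightarrow> (real^2) set \<Rightarrow> 'a measure
      \<Rightarrow> (bool list \<Rightarrow> 'a \<Rightarrow> real) \<Rightarrow> (bool list \<Rightarrow> 'a \<Rightarrow> (real^2) set) \<Rightarrow> bool" where
  "stit_model \<Lambda> W M \<tau> g \<longleftrightarrow>
     prob_space M \<and>
     (\<forall>v. \<tau> v \<in> borel_measurable M) \<and>
     (\<forall>v. g v \<in> measurable M line_space) \<and>
     (\<forall>n B D. (\<forall>v. B v \<in> sets borel) \<and> (\<forall>v. D v \<in> sets line_space) \<longrightarrow>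
        (AE \<omega> in M.
           nn_cond_exp M (stit_history M \<tau> g n)
             (indicator {\<omega> \<in> space M. \<forall>v. length v = n \<longrightarrow> \<tau> v \<omega> \<in> B v \<and> g v \<omega> \<in> D v}) \<omega> =
           (\<Prod>v | length v = n.
              let C = stit_cell W (\<lambda>u. g u \<omega>) v in
                emeasure (density lborel (\<lambda>s. ennreal (exponential_density (measure \<Lambda> (hitting C)) s))) (B v)
                * emeasure (uniform_measure \<Lambda> (hitting C)) (D v))))"


section \<open>Mecke's model\<close>

text \<open>The quasi-cells after \<open>n\<close> decisions have the indices \<open>1, \<dots>, n + 1\<close>.\<close>

fun quasi_cell ::
    "(real^2) set \<Rightarrow> (nat \<Rightarrow> (real^2) set) \<Rightarrow> (nat \<Rightarrow> nat) \<Rightarrow> nat \<Rightarrow> nat \<Rightarrow> (real^2) set" where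
  "quasi_cell W \<gamma> \<alpha> 0 j = (if j = 1 then W else {})"
| "quasi_cell W \<gamma> \<alpha> (Suc 0) j =
     (if j = 1 then W \<inter> half_plane True (\<gamma> 1)
      else if j = 2 then W \<inter> half_plane False (\<gamma> 1)
      else {})"
| "quasi_cell W \<gamma> \<alpha> (Suc (Suc m)) j =
     (let n = Suc (Suc m) in
      if j = n + 1 then quasi_cell W \<gamma> \<alpha> (Suc m) (\<alpha> n) \<inter> half_plane True (\<gamma> n)
      else if j = \<alpha> n then quasi_cell W \<gamma> \<alpha> (Suc m) (\<alpha> n) \<inter> half_plane False (\<gamma> n)
      else quasi_cell W \<gamma> \<alpha> (Suc m) j)"

definition mecke_set ::
    "(real^2) set \<Rightarrow> (nat \<Rightarrow> (real^2) set) \<Rightarrow> (nat \<Rightarrow> nat) \<Rightarrow> nat \<Rightarrow> (real^2) set" where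
  "mecke_set W \<gamma> \<alpha> n =
     closure ((\<Union>j \<in> {1..n + 1}. frontier (quasi_cell W \<gamma> \<alpha> n j)) - frontier W)"

text \<open>The library's \<open>indep_var\<close> requires the two random variables to have values in the same type.\<close>

definition indep_rv ::
    "'b measure \<Rightarrow> 'c measure \<Rightarrow> ('b \<Rightarrow> 'c) \<Rightarrow> 'd measure \<Rightarrow> ('b \<Rightarrow> 'd) \<Rightarrow> bool" where
  "indep_rv N A X B Y \<longleftrightarrow>
     X \<in> measurable N A \<and> Y \<in> measurable N B \<and>
     prob_space.indep_set N {X -` S \<inter> space N | S. S \<in> sets A} {Y -` S \<inter> space N | S. S \<in> sets B}"

definition mecke_model ::
    "(real^2) set measure \<Rightarrow> (real^2) set \<Rightarrow> 'b measure
      \<Rightarrow> (nat \<Rightarrow> 'b \<Rightarrow> (real^2) set) \<Rightarrow> (nat \<Rightarrow> 'b \<Rightarrow> nat) \<Rightarrow> bool" where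
  "mecke_model \<Lambda> W N \<gamma> \<alpha> \<longleftrightarrow>
     prob_space N \<and>
     prob_space.indep_vars N (\<lambda>_. line_space) \<gamma> {1..} \<and>
     (\<forall>j\<ge>1. distr N line_space (\<gamma> j) = uniform_measure \<Lambda> (hitting W)) \<and>
     prob_space.indep_vars N (\<lambda>_. count_space UNIV) \<alpha> {1..} \<and>
     (\<forall>j\<ge>1. distr N (count_space UNIV) (\<alpha> j) = measure_pmf (pmf_of_set {1..j})) \<and>
     indep_rv N
       (\<Pi>\<^sub>M j\<in>{1..}. line_space) (\<lambda>\<omega>. \<lambda>j\<in>{1..}. \<gamma> j \<omega>)
       (\<Pi>\<^sub>M j\<in>{1..}. count_space UNIV) (\<lambda>\<omega>. \<lambda>j\<in>{1..}. \<alpha> j \<omega>)"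

definition mecke_time ::
    "(real^2) set measure \<Rightarrow> (real^2) set \<Rightarrow> 'b measure
      \<Rightarrow> (nat \<Rightarrow> 'b \<Rightarrow> (real^2) set) \<Rightarrow> (nat \<Rightarrow> 'b \<Rightarrow> nat) \<Rightarrow> real \<Rightarrow> ('b \<Rightarrow> nat) \<Rightarrow> bool" where
  "mecke_time \<Lambda> W N \<gamma> \<alpha> t \<nu> \<longleftrightarrow>
     indep_rv N
       (count_space UNIV) \<nu>
       ((\<Pi>\<^sub>M j\<in>{1..}. line_space) \<Otimes>\<^sub>M (\<Pi>\<^sub>M j\<in>{1..}. count_space UNIV))
       (\<lambda>\<omega>. (\<lambda>j\<in>{1..}. \<gamma> j \<omega>, \<lambda>j\<in>{1..}. \<alpha> j \<omega>)) \<and>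
     (\<forall>k. measure N {\<omega> \<in> space N. \<nu> \<omega> = k} =
        exp (- measure \<Lambda> (hitting W) * t) * (1 - exp (- measure \<Lambda> (hitting W) * t)) ^ k)"

end

theory Submission
  imports Defs
begin

text \<open>
  Whether a tessellation misses a compact set is, up to a monotone limit, the event that no cell
  boundary meets some open set \<open>U\<close> off the boundary of \<open>W\<close>. This event is multiplicative over the
  cells, so both models reduce to the expectation \<open>u(t, C)\<close> of a product of \<open>f(C\<^sub>j)\<close> over the
  descendants \<open>C\<^sub>j\<close> of a cell \<open>C\<close> at time \<open>t\<close>.

  In the Mecke model every quasi-cell may be thought of as carrying a clock of the same rate
  \<open>\<Lambda>([W])\<close>, a line that misses the quasi-cell splitting off an empty one. In the STIT model a cell
  has a clock of rate \<open>\<Lambda>([C])\<close> and is always divided. Since \<open>f\<close> is \<open>1\<close> on the empty cell, discarding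
  the ineffective decisions turns the equation \<open>u' = - \<Lambda>([W]) u + \<integral>\<^bsub>[W]\<^esub> u(C\<^sup>+) u(C\<^sup>-) d\<Lambda>\<close> of the first
  model into the equation \<open>u' = - \<Lambda>([C]) u + \<integral>\<^bsub>[C]\<^esub> u(C\<^sup>+) u(C\<^sup>-) d\<Lambda>\<close> of the second, which has only one
  bounded solution. The first equation is solved by the geometric mixture
  \<open>e\<^bsup>-\<lambda>t\<^esup> \<Sum>\<^sub>n (1 - e\<^bsup>-\<lambda>t\<^esup>)\<^sup>n v\<^sub>n(C)\<close> of the expectations \<open>v\<^sub>n\<close> after \<open>n\<close> decisions, because the power
  series \<open>A(q) = \<Sum>\<^sub>n v\<^sub>n q\<^sup>n\<close> satisfies \<open>A'(q, C) = E A(q, C\<^sup>+) A(q, C\<^sup>-)\<close>.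
\<close>

section \<open>Branching functionals of cell splitting\<close>

text \<open>The Mecke side is explicit and supplies a solution of the equation. The STIT side is
  known only through conditional laws, one generation at a time, and nothing guarantees in advance
  that only finitely many generations are born by time \<open>t\<close>. The tree is therefore cut
  after \<open>k\<close> generations, branches that reach the cut counting 0. The cut values are
  Picard iterates of the STIT equation; two factors per division make the error at most (2 * rate *
  t)^k / k!, which yields uniqueness. The same limit for \<open>f\<close> = 1 shows that the process
  does not explode. To evaluate the cut tree, the conditional laws are assembled into one density
  with respect to a product measure. The identity for A' reflects Polya's urn: of the decisions
  after the first one, the number that falls into a given half is uniformly distributed. Translation
  invariance makes graphs over the angle null sets of lines. Hence lines through the origin and
  supporting lines of convex cells can be neglected, which lets one family of open cells serve the
  closed STIT cells and the quasi-cells alike.\<close>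

lemma of_nat_Suc_divide_self_ennreal: "of_nat (Suc n) / of_nat (Suc n) = (1 :: ennreal)"
  by (rule ennreal_divide_self) (auto simp del: of_nat_Suc simp: of_nat_less_top)

lemma of_nat_Suc_mult_divide_ennreal: "of_nat (Suc n) * (x / of_nat (Suc n)) = (x :: ennreal)"
  using of_nat_less_top[of "Suc n"]
  by (subst ennreal_times_divide, subst mult.commute, intro mult_divide_eq_ennreal)
     (auto simp del: of_nat_Suc)

text \<open>An interface holding the facts that both models use. \<open>AE_no_hit\<close> speaks of
  an unordered pair because either half may be the empty one, and only almost everywhere because a
  line through the origin can cut a cell although its \<open>half_plane True\<close> is
  empty.\<close>

locale cell_splitting =
  fixes S :: "'c measure" and \<mu> :: "'l measure" and split :: "bool \<Rightarrow> 'c \<Rightarrow> 'l \<Rightarrow> 'c"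
    and hit :: "'c \<Rightarrow> 'l \<Rightarrow> bool" and e :: 'c and rate :: real
  assumes prob_\<mu>: "prob_space \<mu>"
    and measurable_split: "\<And>b. (\<lambda>p. split b (fst p) (snd p)) \<in> S \<Otimes>\<^sub>M \<mu> \<rightarrow>\<^sub>M S"
    and measurable_hit: "Measurable.pred (S \<Otimes>\<^sub>M \<mu>) (\<lambda>p. hit (fst p) (snd p))"
    and e_space: "e \<in> space S"
    and split_e: "\<And>b g. g \<in> space \<mu> \<Longrightarrow> split b e g = e"
    and hit_nonempty: "\<And>b C g. C \<in> space S \<Longrightarrow> g \<in> space \<mu> \<Longrightarrow> hit C g \<Longrightarrow> split b C g \<noteq> e"
    and AE_no_hit: "\<And>C. C \<in> space S \<Longrightarrow>
      AE g in \<mu>. \<not> hit C g \<longrightarrow> {split True C g, split False C g} = {C, e}"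
    and hit_pos: "\<And>C. C \<in> space S \<Longrightarrow> C \<noteq> e \<Longrightarrow> 0 < emeasure \<mu> {g \<in> space \<mu>. hit C g}"
    and rate_pos: "0 < rate"
begin

sublocale \<mu>: prob_space \<mu> by (rule prob_\<mu>)

text \<open>For a convex open cell this is \<open>\<Lambda>\<close> of the lines hitting its closure
  (\<open>measure_hitting_closure\<close>). As a multiple of a \<open>\<mu>\<close>-probability it
  makes sense on all of \<open>S\<close> and is measurable as a parameter integral.\<close>

definition hit_rate :: "'c \<Rightarrow> real" where
  "hit_rate C = rate * measure \<mu> {g \<in> space \<mu>. hit C g}"

lemma measurable_split'[measurable (raw)]:
  assumes "X \<in> N \<rightarrow>\<^sub>M S" "Y \<in> N \<rightarrow>\<^sub>M \<mu>"
  shows "(\<lambda>x. split b (X x) (Y x)) \<in> N \<rightarrow>\<^sub>M S"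
  using measurable_compose[OF measurable_Pair[OF assms] measurable_split[of b]] by simp

lemma measurable_hit'[measurable (raw)]:
  assumes "X \<in> N \<rightarrow>\<^sub>M S" "Y \<in> N \<rightarrow>\<^sub>M \<mu>"
  shows "Measurable.pred N (\<lambda>x. hit (X x) (Y x))"
  using measurable_compose[OF measurable_Pair[OF assms] measurable_hit] by simp

lemma split_space[simp, intro]: "C \<in> space S \<Longrightarrow> g \<in> space \<mu> \<Longrightarrow> split b C g \<in> space S"
  using measurable_space[OF measurable_split, of "(C, g)" b] by (simp add: space_pair_measure)

lemma hit_set[measurable]: "C \<in> space S \<Longrightarrow> {g \<in> space \<mu>. hit C g} \<in> sets \<mu>"
  by measurable

lemma measurable_hit_rate[measurable]: "hit_rate \<in> borel_measurable S"
proof -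
  have "(\<lambda>C. \<integral>\<^sup>+ g. indicator {g \<in> space \<mu>. hit C g} g \<partial>\<mu>) \<in> borel_measurable S"
    unfolding indicator_def by measurable
  moreover have "hit_rate C = rate * enn2real (\<integral>\<^sup>+ g. indicator {g \<in> space \<mu>. hit C g} g \<partial>\<mu>)"
    if "C \<in> space S" for C
    using that by (simp add: hit_rate_def measure_def)
  ultimately show ?thesis
    by (subst measurable_cong) measurable
qed

lemma hit_rate_nonneg: "0 \<le> hit_rate C"
  using rate_pos by (simp add: hit_rate_def)

lemma hit_rate_pos: "C \<in> space S \<Longrightarrow> C \<noteq> e \<Longrightarrow> 0 < hit_rate C"
  using hit_pos[of C] rate_pos by (simp add: hit_rate_def \<mu>.emeasure_eq_measure zero_less_mult_iff)

end

section \<open>Generating functions of the urn recursion\<close>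

locale cell_functional = cell_splitting +
  fixes f :: "'a \<Rightarrow> ennreal"
  assumes measurable_f[measurable]: "f \<in> borel_measurable S"
    and f_le_1: "\<And>C. C \<in> space S \<Longrightarrow> f C \<le> 1"
    and f_e: "f e = 1"
begin

text \<open>Recursion over the first decision for the expected product of \<open>f\<close> after
  \<open>n\<close> decisions. By Polya's urn, the number \<open>i\<close> of the remaining
  \<open>n\<close> decisions that act in the first half is uniform on 0, ..., n, whence the division
  by \<open>Suc n\<close>. That the actual urn has this expectation is proved in
  \<open>nn_integral_urn_cells\<close>.\<close>

fun urn_value :: "nat \<Rightarrow> 'a \<Rightarrow> ennreal" where
  "urn_value 0 C = f C"
| "urn_value (Suc n) C =
    (\<Sum>i\<le>n. \<integral>\<^sup>+ g. urn_value i (split True C g) * urn_value (n - i) (split False C g) \<partial>\<mu>) / of_nat (Suc n)"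

lemma measurable_urn_value[measurable]: "urn_value n \<in> borel_measurable S"
proof (induction n rule: less_induct)
  case (less n)
  show ?case
  proof (cases n)
    case 0
    then show ?thesis by (simp cong: measurable_cong)
  next
    case (Suc m)
    have [measurable]: "urn_value i \<in> borel_measurable S" if "i \<le> m" for i
      using less Suc that by simp
    show ?thesis
      unfolding Suc urn_value.simps by measurable
  qed
qed

lemma urn_value_le_1: "C \<in> space S \<Longrightarrow> urn_value n C \<le> 1"
proof (induction n arbitrary: C rule: less_induct)
  case (less n)
  show ?case
  proof (cases n)
    case 0
    then show ?thesis using less f_le_1 by simp
  next
    case (Suc m)
    have "(\<integral>\<^sup>+ g. urn_value i (split True C g) * urn_value (m - i) (split False C g) \<partial>\<mu>) \<le> (\<integral>\<^sup>+ g. 1 \<partial>\<mu>)"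
      if "i \<le> m" for i
      using less Suc that by (intro nn_integral_mono) (metis diff_le_self le_imp_less_Suc mult_le_one split_space zero_le dual_order.strict_trans2 mult.right_neutral mult_mono)
    then have "(\<Sum>i\<le>m. \<integral>\<^sup>+ g. urn_value i (split True C g) * urn_value (m - i) (split False C g) \<partial>\<mu>) \<le> (\<Sum>i\<le>m. 1)"
      by (intro sum_mono) (simp add: \<mu>.emeasure_space_1)
    also have "\<dots> = of_nat (Suc m)" by simp
    finally have "urn_value n C \<le> of_nat (Suc m) / of_nat (Suc m)"
      unfolding Suc urn_value.simps by (rule divide_right_mono_ennreal)
    then show ?thesis
      by (simp only: of_nat_Suc_divide_self_ennreal)
  qed
qed

lemma urn_value_e: "urn_value n e = 1"
proof (induction n rule: less_induct)
  case (less n)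
  show ?case
  proof (cases n)
    case 0
    then show ?thesis using f_e by simp
  next
    case (Suc m)
    have "(\<integral>\<^sup>+ g. urn_value i (split True e g) * urn_value (m - i) (split False e g) \<partial>\<mu>) = (\<integral>\<^sup>+ g. 1 \<partial>\<mu>)"
      if "i \<le> m" for i
      using less Suc that by (intro nn_integral_cong) (auto simp: split_e)
    then have "(\<Sum>i\<le>m. \<integral>\<^sup>+ g. urn_value i (split True e g) * urn_value (m - i) (split False e g) \<partial>\<mu>) = (\<Sum>i\<le>m. 1)"
      by (intro sum.cong) (simp_all add: \<mu>.emeasure_space_1)
    also have "\<dots> = of_nat (Suc m)" by simp
    finally show ?thesis
      unfolding Suc urn_value.simps by (simp only: of_nat_Suc_divide_self_ennreal)
  qed
qed

definition urn_series :: "real \<Rightarrow> 'a \<Rightarrow> ennreal" where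
  "urn_series q C = (\<Sum>n. ennreal (q ^ n) * urn_value n C)"

text \<open>In a Yule process whose particles split at rate \<open>rate\<close>, the number of
  splits up to time \<open>s\<close> has exactly these geometric weights.\<close>

definition yule_value :: "real \<Rightarrow> 'a \<Rightarrow> ennreal" where
  "yule_value s C = ennreal (exp (- rate * s)) * urn_series (1 - exp (- rate * s)) C"

lemma measurable_urn_series[measurable (raw)]:
  assumes [measurable]: "q \<in> borel_measurable N" "X \<in> N \<rightarrow>\<^sub>M S"
  shows "(\<lambda>x. urn_series (q x) (X x)) \<in> borel_measurable N"
  unfolding urn_series_def by measurable

lemma measurable_yule_value[measurable (raw)]:
  assumes [measurable]: "s \<in> borel_measurable N" "X \<in> N \<rightarrow>\<^sub>M S"
  shows "(\<lambda>x. yule_value (s x) (X x)) \<in> borel_measurable N"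
  unfolding yule_value_def by measurable

lemma urn_series_e:
  assumes "0 \<le> q" "q < 1"
  shows "urn_series q e = ennreal (1 / (1 - q))"
proof -
  have "(\<Sum>n. ennreal (q ^ n)) = ennreal (\<Sum>n. q ^ n)"
    using assms by (intro suminf_ennreal2 summable_geometric) auto
  then show ?thesis
    using assms suminf_geometric[of q] by (simp add: urn_series_def urn_value_e)
qed

lemma yule_value_e: "0 \<le> s \<Longrightarrow> yule_value s e = 1"
  using rate_pos by (simp add: yule_value_def urn_series_e flip: ennreal_mult')


lemma urn_value_real:
  assumes "C \<in> space S"
  shows "ennreal (enn2real (urn_value n C)) = urn_value n C"
  using urn_value_le_1[OF assms, of n] by (intro ennreal_enn2real) (auto simp: less_top[symmetric] top_unique)

lemma urn_value_real_le_1: "C \<in> space S \<Longrightarrow> enn2real (urn_value n C) \<le> 1"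
  using urn_value_le_1[of C n] by (intro enn2real_leI) simp_all

lemma summable_urn_series:
  assumes "C \<in> space S" "\<bar>q\<bar> < 1"
  shows "summable (\<lambda>n. norm (enn2real (urn_value n C) * q ^ n))"
proof (rule summable_comparison_test')
  show "summable (\<lambda>n. \<bar>q\<bar> ^ n)" using assms by (intro summable_geometric) simp
  show "norm (norm (enn2real (urn_value n C) * q ^ n)) \<le> \<bar>q\<bar> ^ n" for n
    using urn_value_real_le_1[OF assms(1), of n]
    by (simp add: abs_mult power_abs mult_left_le_one_le)
qed

lemma urn_series_real:
  assumes "C \<in> space S" "0 \<le> q" "q < 1"
  shows "urn_series q C = ennreal (\<Sum>n. enn2real (urn_value n C) * q ^ n)"
proof -
  have "urn_series q C = (\<Sum>n. ennreal (enn2real (urn_value n C) * q ^ n))"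
    unfolding urn_series_def using assms
    by (intro suminf_cong) (simp add: ennreal_mult' urn_value_real mult.commute)
  also have "\<dots> = ennreal (\<Sum>n. enn2real (urn_value n C) * q ^ n)"
    using assms summable_norm_cancel[OF summable_urn_series[of C q]] by (intro suminf_ennreal2) auto
  finally show ?thesis .
qed

lemma urn_series_mult:
  assumes "C \<in> space S" "D \<in> space S" "0 \<le> q" "q < 1"
  shows "urn_series q C * urn_series q D =
    (\<Sum>n. ennreal (q ^ n) * (\<Sum>i\<le>n. urn_value i C * urn_value (n - i) D))"
proof -
  let ?a = "\<lambda>C n. enn2real (urn_value n C) * q ^ n"
  have s: "summable (\<lambda>n. norm (?a C n))" "summable (\<lambda>n. norm (?a D n))"
    using assms by (intro summable_urn_series; simp)+
  then have s': "summable (?a C)" "summable (?a D)"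
    by (blast intro: summable_norm_cancel)+
  have "urn_series q C * urn_series q D = ennreal ((\<Sum>n. ?a C n) * (\<Sum>n. ?a D n))"
    using assms suminf_nonneg[OF s'(1)] by (simp add: urn_series_real ennreal_mult')
  also have "(\<Sum>n. ?a C n) * (\<Sum>n. ?a D n) = (\<Sum>n. \<Sum>i\<le>n. ?a C i * ?a D (n - i))"
    using s by (rule Cauchy_product)
  also have "ennreal \<dots> = (\<Sum>n. ennreal (\<Sum>i\<le>n. ?a C i * ?a D (n - i)))"
    using assms summable_Cauchy_product[OF s]
    by (intro suminf_ennreal2[symmetric]) (auto intro!: sum_nonneg)
  also have "\<dots> = (\<Sum>n. ennreal (q ^ n) * (\<Sum>i\<le>n. urn_value i C * urn_value (n - i) D))"
  proof (intro suminf_cong)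
    fix n
    have "(\<Sum>i\<le>n. ?a C i * ?a D (n - i)) =
      q ^ n * (\<Sum>i\<le>n. enn2real (urn_value i C) * enn2real (urn_value (n - i) D))"
      unfolding sum_distrib_left
      by (intro sum.cong) (simp_all add: mult_ac flip: power_add)
    then show "ennreal (\<Sum>i\<le>n. ?a C i * ?a D (n - i)) =
      ennreal (q ^ n) * (\<Sum>i\<le>n. urn_value i C * urn_value (n - i) D)"
      using assms by (simp add: ennreal_mult' urn_value_real flip: sum_ennreal)
  qed
  finally show ?thesis .
qed

text \<open>The recursion divides a convolution by \<open>Suc n\<close>. Multiplying back shows that
  the product of the two daughter series has, in expectation, the coefficients of the termwise
  derivative of the series of \<open>C\<close>.\<close>

lemma urn_series_split:
  assumes "C \<in> space S" "0 \<le> q" "q < 1"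
  shows "(\<integral>\<^sup>+ g. urn_series q (split True C g) * urn_series q (split False C g) \<partial>\<mu>) =
    (\<Sum>n. ennreal (q ^ n) * (of_nat (Suc n) * urn_value (Suc n) C))"
proof -
  note [measurable] = assms(1)
  have "(\<integral>\<^sup>+ g. urn_series q (split True C g) * urn_series q (split False C g) \<partial>\<mu>) =
    (\<integral>\<^sup>+ g. (\<Sum>n. ennreal (q ^ n) * (\<Sum>i\<le>n. urn_value i (split True C g) * urn_value (n - i) (split False C g))) \<partial>\<mu>)"
    using assms by (intro nn_integral_cong urn_series_mult) auto
  also have "\<dots> = (\<Sum>n. ennreal (q ^ n) *
    (\<Sum>i\<le>n. \<integral>\<^sup>+ g. urn_value i (split True C g) * urn_value (n - i) (split False C g) \<partial>\<mu>))"
    by (simp add: nn_integral_suminf nn_integral_cmult nn_integral_sum)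
  also have "\<dots> = (\<Sum>n. ennreal (q ^ n) * (of_nat (Suc n) * urn_value (Suc n) C))"
    by (intro suminf_cong)
       (simp only: urn_value.simps of_nat_Suc_mult_divide_ennreal)
  finally show ?thesis .
qed

lemma DERIV_urn_series:
  assumes "C \<in> space S" "0 \<le> q" "q < 1"
  shows "((\<lambda>q. \<Sum>n. enn2real (urn_value n C) * q ^ n) has_real_derivative
    enn2real (\<integral>\<^sup>+ g. urn_series q (split True C g) * urn_series q (split False C g) \<partial>\<mu>)) (at q)"
proof -
  let ?a = "\<lambda>n. enn2real (urn_value n C)"
  \<comment> \<open>Termwise differentiation at \<open>q\<close> needs convergence at a point
    strictly beyond \<open>q\<close>; the radius of convergence is at least 1.\<close>
  obtain K where K: "q < K" "K < 1" using dense[OF assms(3)] by blast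
  have sK: "summable (\<lambda>n. ?a n * K ^ n)"
    using K assms summable_norm_cancel[OF summable_urn_series[of C K]] by simp
  have "(\<Sum>n. ennreal (q ^ n) * (of_nat (Suc n) * urn_value (Suc n) C)) = (\<Sum>n. ennreal (diffs ?a n * q ^ n))"
    using assms by (intro suminf_cong)
      (simp add: diffs_def ennreal_mult' urn_value_real ennreal_of_nat_eq_real_of_nat mult_ac del: of_nat_Suc urn_value.simps)
  also have "\<dots> = ennreal (\<Sum>n. diffs ?a n * q ^ n)"
  proof (rule suminf_ennreal2)
    show "summable (\<lambda>n. diffs ?a n * q ^ n)"
      using assms K by (intro termdiff_converges[where K=K] summable_norm_cancel[OF summable_urn_series]) auto
  qed (use assms in \<open>auto simp: diffs_def simp del: urn_value.simps\<close>)
  finally have "(\<Sum>n. diffs ?a n * q ^ n) = enn2real (\<Sum>n. ennreal (q ^ n) * (of_nat (Suc n) * urn_value (Suc n) C))"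
    using suminf_nonneg[of "\<lambda>n. diffs ?a n * q ^ n"] assms K
      termdiff_converges[where K=K and c="?a" and x=q] summable_norm_cancel[OF summable_urn_series]
    by (simp add: diffs_def del: urn_value.simps)
  then show ?thesis
    using termdiffs_strong[OF sK, of q] K assms by (simp add: urn_series_split)
qed


section \<open>Differential and renewal equation of the geometric mixture\<close>

definition yule_real :: "real \<Rightarrow> 'a \<Rightarrow> real" where
  "yule_real s C = exp (- rate * s) * (\<Sum>n. enn2real (urn_value n C) * (1 - exp (- rate * s)) ^ n)"

lemma yule_value_real:
  assumes "C \<in> space S" "0 \<le> s"
  shows "yule_value s C = ennreal (yule_real s C)"
  using assms rate_pos by (simp add: yule_value_def yule_real_def urn_series_real ennreal_mult')

lemma yule_real_nonneg: "C \<in> space S \<Longrightarrow> 0 \<le> s \<Longrightarrow> 0 \<le> yule_real s C"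
  using rate_pos summable_norm_cancel[OF summable_urn_series[of C "1 - exp (- rate * s)"]]
  by (auto simp: yule_real_def intro!: mult_nonneg_nonneg suminf_nonneg)

lemma yule_value_le_1:
  assumes "C \<in> space S" "0 \<le> s"
  shows "yule_value s C \<le> 1"
proof -
  \<comment> \<open>The empty cell has all coefficients equal to 1, the largest possible value, and
    its mixture is exactly 1.\<close>
  have "urn_series q C \<le> urn_series q e" for q
    unfolding urn_series_def using assms
    by (intro suminf_le mult_left_mono) (simp_all add: urn_value_e urn_value_le_1)
  then have "yule_value s C \<le> yule_value s e"
    unfolding yule_value_def by (intro mult_left_mono) auto
  then show ?thesis using assms by (simp add: yule_value_e)
qed

lemma yule_value_0: "C \<in> space S \<Longrightarrow> yule_value 0 C = f C"
  using powser_zero[of "\<lambda>n. enn2real (urn_value n C)"] urn_value_real[of C 0]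
  by (simp add: yule_value_real yule_real_def)

text \<open>The gain term of the STIT equation, up to the factor \<open>rate\<close> that turns
  \<open>\<mu>\<close> back into \<open>\<Lambda>\<close>.\<close>

definition split_yule :: "real \<Rightarrow> 'a \<Rightarrow> ennreal" where
  "split_yule s C = (\<integral>\<^sup>+ g. indicator {g. hit C g} g *
    (yule_value s (split True C g) * yule_value s (split False C g)) \<partial>\<mu>)"

lemma measurable_split_yule[measurable (raw)]:
  assumes [measurable]: "s \<in> borel_measurable N" "X \<in> N \<rightarrow>\<^sub>M S"
  shows "(\<lambda>x. split_yule (s x) (X x)) \<in> borel_measurable N"
  unfolding split_yule_def by measurable

lemma split_yule_le_1:
  assumes "C \<in> space S" "0 \<le> s"
  shows "split_yule s C \<le> 1"
proof -
  have "split_yule s C \<le> (\<integral>\<^sup>+ g. 1 \<partial>\<mu>)"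
    unfolding split_yule_def using assms
    by (intro nn_integral_mono mult_le_one) (auto simp: yule_value_le_1 indicator_def)
  then show ?thesis by (simp add: \<mu>.emeasure_space_1)
qed

text \<open>A line that misses \<open>C\<close> leaves \<open>C\<close> itself and an empty cell of
  value 1, so the ineffective decisions contribute a plain multiple of
  \<open>yule_value s C\<close>, which can later be moved into the loss term.\<close>

lemma nn_integral_yule_split:
  assumes "C \<in> space S" "0 \<le> s"
  shows "(\<integral>\<^sup>+ g. yule_value s (split True C g) * yule_value s (split False C g) \<partial>\<mu>) =
    split_yule s C + emeasure \<mu> {g \<in> space \<mu>. \<not> hit C g} * yule_value s C"
proof -
  note [measurable] = assms(1)
  have "(\<integral>\<^sup>+ g. yule_value s (split True C g) * yule_value s (split False C g) \<partial>\<mu>) =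
    (\<integral>\<^sup>+ g. indicator {g. hit C g} g * (yule_value s (split True C g) * yule_value s (split False C g)) +
      indicator {g \<in> space \<mu>. \<not> hit C g} g * yule_value s C \<partial>\<mu>)"
    using AE_no_hit[OF assms(1)] AE_space[of \<mu>]
  proof (intro nn_integral_cong_AE, eventually_elim)
    case (elim g)
    have "yule_value s (split True C g) * yule_value s (split False C g) = yule_value s C * yule_value s e"
      if "\<not> hit C g"
      using elim that by (auto simp: doubleton_eq_iff mult.commute)
    then show ?case
      using assms elim by (auto simp: yule_value_e indicator_def)
  qed
  then show ?thesis
    by (simp add: nn_integral_add split_yule_def nn_integral_multc)
qed

text \<open>The prefactor and the chain rule each contribute one factor
  \<open>exp (- rate * s)\<close>, which is just enough to turn the product of two series into a
  product of two mixtures. The ineffective decisions change the loss rate from \<open>rate\<close>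
  to \<open>rate\<close> times the probability of a hit, that is, to
  \<open>hit_rate C\<close>.\<close>

lemma DERIV_yule_real:
  assumes "C \<in> space S" "0 \<le> s"
  shows "((\<lambda>s. yule_real s C) has_real_derivative
    rate * enn2real (split_yule s C) - hit_rate C * yule_real s C) (at s)"
proof -
  let ?q = "1 - exp (- rate * s)" and ?E = "exp (- rate * s)"
  let ?I = "\<integral>\<^sup>+ g. urn_series ?q (split True C g) * urn_series ?q (split False C g) \<partial>\<mu>"
  let ?m = "measure \<mu> {g \<in> space \<mu>. \<not> hit C g}"
  note [measurable] = assms(1)
  have q: "0 \<le> ?q" "?q < 1" using assms rate_pos by auto
  have D: "((\<lambda>s. yule_real s C) has_real_derivative
      (- rate * ?E) * (\<Sum>n. enn2real (urn_value n C) * ?q ^ n) + ?E * (enn2real ?I * (rate * ?E))) (at s)"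
  proof -
    have "((\<lambda>s. 1 - exp (- rate * s)) has_real_derivative rate * ?E) (at s)"
      by (auto intro!: derivative_eq_intros)
    from DERIV_chain[OF DERIV_urn_series[OF assms(1) q] this]
    have "((\<lambda>s. \<Sum>n. enn2real (urn_value n C) * (1 - exp (- rate * s)) ^ n)
        has_real_derivative enn2real ?I * (rate * ?E)) (at s)"
      by (simp add: o_def)
    moreover have "((\<lambda>s. exp (- rate * s)) has_real_derivative - rate * ?E) (at s)"
      by (auto intro!: derivative_eq_intros)
    ultimately show ?thesis
      unfolding yule_real_def by (intro DERIV_cong[OF DERIV_mult]) (auto simp: algebra_simps)
  qed
  have "ennreal ?E * ennreal ?E * ?I = split_yule s C + ennreal ?m * yule_value s C"
    using nn_integral_yule_split[OF assms]
    by (simp add: yule_value_def nn_integral_cmult[symmetric] mult_ac \<mu>.emeasure_eq_measure)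
  then have I: "enn2real (ennreal ?E * ennreal ?E * ?I) = enn2real (split_yule s C) + ?m * yule_real s C"
    using split_yule_le_1[OF assms] assms
    by (simp add: enn2real_plus yule_value_real yule_real_nonneg enn2real_mult ennreal_mult_less_top order_le_less_trans)
  have m: "?m = 1 - measure \<mu> {g \<in> space \<mu>. hit C g}"
    by (rule \<mu>.prob_neg) measurable
  have "rate * (?m * yule_real s C) = rate * yule_real s C - hit_rate C * yule_real s C"
    unfolding m by (simp add: hit_rate_def algebra_simps)
  moreover have "(- rate * ?E) * (\<Sum>n. enn2real (urn_value n C) * ?q ^ n) = - rate * yule_real s C"
    by (simp add: yule_real_def)
  moreover have "?E * (enn2real ?I * (rate * ?E)) = rate * enn2real (split_yule s C) + rate * (?m * yule_real s C)"
    using I by (simp add: enn2real_mult algebra_simps)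
  ultimately show ?thesis
    by (intro DERIV_cong[OF D]) linarith
qed

text \<open>Variation of constants brings the equation into a form that can be iterated;
  \<open>r\<close> plays the part of the lifetime of \<open>C\<close>.\<close>

lemma yule_value_renewal:
  assumes "C \<in> space S" "0 \<le> t"
  shows "yule_value t C = ennreal (exp (- hit_rate C * t)) * f C +
    (\<integral>\<^sup>+ r. indicator {0..t} r * (ennreal (rate * exp (- hit_rate C * r)) * split_yule (t - r) C) \<partial>lborel)"
proof -
  let ?\<rho> = "hit_rate C"
  let ?h = "\<lambda>r. rate * exp (- ?\<rho> * r) * enn2real (split_yule (t - r) C)"
  note [measurable] = assms(1)
  \<comment> \<open>Integrating factor, with time running backwards from \<open>t\<close>: the loss
    term cancels and only the gain term is left.\<close>
  have D: "((\<lambda>r. - (exp (- ?\<rho> * r) * yule_real (t - r) C)) has_real_derivative ?h r) (at r)"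
    if "0 \<le> r" "r \<le> t" for r
  proof -
    have "((\<lambda>r. yule_real (t - r) C) has_real_derivative
        (rate * enn2real (split_yule (t - r) C) - ?\<rho> * yule_real (t - r) C) * (- 1)) (at r)"
      using that by (intro DERIV_chain2[OF DERIV_yule_real[OF assms(1)]]) (auto intro!: derivative_eq_intros)
    then show ?thesis
      by (auto intro!: derivative_eq_intros simp: algebra_simps)
  qed
  have nonneg: "0 \<le> ?h r" for r using rate_pos by simp
  have "(\<integral>\<^sup>+ r. ennreal (?h r) * indicator {0..t} r \<partial>lborel) =
    ennreal (- (exp (- ?\<rho> * t) * yule_real (t - t) C) - - (exp (- ?\<rho> * 0) * yule_real (t - 0) C))"
    by (rule nn_integral_FTC_Icc[OF _ D nonneg assms(2)]) auto
  also have "(\<integral>\<^sup>+ r. ennreal (?h r) * indicator {0..t} r \<partial>lborel) =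
    (\<integral>\<^sup>+ r. indicator {0..t} r * (ennreal (rate * exp (- ?\<rho> * r)) * split_yule (t - r) C) \<partial>lborel)"
  proof (intro nn_integral_cong)
    fix r
    have "ennreal (enn2real (split_yule (t - r) C)) = split_yule (t - r) C" if "r \<le> t"
      using split_yule_le_1[of C "t - r"] assms that
      by (intro ennreal_enn2real) (auto simp: less_top[symmetric] top_unique)
    then show "ennreal (?h r) * indicator {0..t} r =
      indicator {0..t} r * (ennreal (rate * exp (- ?\<rho> * r)) * split_yule (t - r) C)"
      using rate_pos by (auto simp: indicator_def ennreal_mult')
  qed
  finally have I: "(\<integral>\<^sup>+ r. indicator {0..t} r * (ennreal (rate * exp (- ?\<rho> * r)) * split_yule (t - r) C) \<partial>lborel) =
    ennreal (yule_real t C - exp (- ?\<rho> * t) * yule_real 0 C)" by simp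
  have "0 \<le> yule_real t C - exp (- ?\<rho> * t) * yule_real 0 C"
    using DERIV_nonneg_imp_nondecreasing[of 0 t "\<lambda>r. - (exp (- ?\<rho> * r) * yule_real (t - r) C)"] D nonneg assms(2)
    by fastforce
  then show ?thesis
    unfolding I using assms yule_real_nonneg[of C]
    by (simp add: yule_value_0[symmetric] yule_value_real flip: ennreal_mult' ennreal_plus)
qed



text \<open>
  The expectation for the tree cut off after \<open>k\<close> generations: a cell with remaining time \<open>s < 0\<close> is not
  yet born, and the value is \<open>0\<close> if the last generation is reached.
\<close>

fun generation_value :: "nat \<Rightarrow> real \<Rightarrow> 'a \<Rightarrow> ennreal" where
  "generation_value 0 s C = (if s < 0 then 1 else 0)"
| "generation_value (Suc k) s C = (if s < 0 then 1 else
    ennreal (exp (- hit_rate C * s)) * f C +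
    (\<integral>\<^sup>+ r. indicator {0..s} r * (ennreal (rate * exp (- hit_rate C * r)) *
      (\<integral>\<^sup>+ g. indicator {g. hit C g} g *
        (generation_value k (s - r) (split True C g) * generation_value k (s - r) (split False C g)) \<partial>\<mu>)) \<partial>lborel))"

lemma measurable_generation_value_pair:
  "(\<lambda>p. generation_value k (fst p) (snd p)) \<in> borel_measurable (borel \<Otimes>\<^sub>M S)"
proof (induction k)
  case 0
  show ?case unfolding generation_value.simps by measurable
next
  case (Suc k)
  have [measurable (raw)]: "(\<lambda>x. generation_value k (s x) (X x)) \<in> borel_measurable N"
    if "s \<in> borel_measurable N" "X \<in> N \<rightarrow>\<^sub>M S" for s X and N :: "(((real \<times> 'a) \<times> real) \<times> 'b) measure"
    using measurable_compose[OF measurable_Pair[OF that] Suc] by simp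
  show ?case
    unfolding generation_value.simps indicator_def atLeastAtMost_iff mem_Collect_eq by measurable
qed

lemma measurable_generation_value[measurable (raw)]:
  assumes "s \<in> borel_measurable N" "X \<in> N \<rightarrow>\<^sub>M S"
  shows "(\<lambda>x. generation_value k (s x) (X x)) \<in> borel_measurable N"
  using measurable_compose[OF measurable_Pair[OF assms] measurable_generation_value_pair] by simp

section \<open>Truncation error of the tree\<close>

lemma generation_value_le_yule_value:
  "C \<in> space S \<Longrightarrow> 0 \<le> s \<Longrightarrow> generation_value k s C \<le> yule_value s C"
proof (induction k arbitrary: s C)
  case 0
  then show ?case by simp
next
  case (Suc k)
  have "(\<integral>\<^sup>+ r. indicator {0..s} r * (ennreal (rate * exp (- hit_rate C * r)) *
      (\<integral>\<^sup>+ g. indicator {g. hit C g} g *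
        (generation_value k (s - r) (split True C g) * generation_value k (s - r) (split False C g)) \<partial>\<mu>)) \<partial>lborel)
    \<le> (\<integral>\<^sup>+ r. indicator {0..s} r * (ennreal (rate * exp (- hit_rate C * r)) * split_yule (s - r) C) \<partial>lborel)"
    unfolding split_yule_def
  proof (intro nn_integral_mono)
    fix r :: real
    show "indicator {0..s} r * (ennreal (rate * exp (- hit_rate C * r)) *
        (\<integral>\<^sup>+ g. indicator {g. hit C g} g *
          (generation_value k (s - r) (split True C g) * generation_value k (s - r) (split False C g)) \<partial>\<mu>))
      \<le> indicator {0..s} r * (ennreal (rate * exp (- hit_rate C * r)) *
        (\<integral>\<^sup>+ g. indicator {g. hit C g} g *
          (yule_value (s - r) (split True C g) * yule_value (s - r) (split False C g)) \<partial>\<mu>))"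
    proof (cases "r \<in> {0..s}")
      case True
      then show ?thesis
        using Suc by (intro mult_left_mono nn_integral_mono mult_mono) auto
    qed simp
  qed
  then show ?case
    using Suc.prems by (simp add: yule_value_renewal add_left_mono del: mult_minus_left)
qed

text \<open>One Picard step turns the \<open>k\<close>-th error bound into the next one; it is
  applied with \<open>c = 2 * rate\<close>.\<close>

lemma nn_integral_power_fact:
  assumes "0 \<le> s" "0 \<le> c"
  shows "(\<integral>\<^sup>+ r. indicator {0..s} r * ennreal (c * ((c * (s - r)) ^ k / fact k)) \<partial>lborel) =
    ennreal ((c * s) ^ Suc k / fact (Suc k))"
proof -
  have "(\<integral>\<^sup>+ r. ennreal (c * ((c * (s - r)) ^ k / fact k)) * indicator {0..s} r \<partial>lborel) =
    ennreal (- ((c * (s - s)) ^ Suc k / fact (Suc k)) - - ((c * (s - 0)) ^ Suc k / fact (Suc k)))"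
  proof (rule nn_integral_FTC_Icc)
    show "((\<lambda>r. - ((c * (s - r)) ^ Suc k / fact (Suc k))) has_real_derivative
      c * ((c * (s - r)) ^ k / fact k)) (at r)" for r
    proof -
      have "((\<lambda>r. c * (s - r)) has_real_derivative - c) (at r)"
        by (auto intro!: derivative_eq_intros)
      from DERIV_minus[OF DERIV_cdivide[OF DERIV_power[OF this, of "Suc k"], of "fact (Suc k)"]]
      show ?thesis by (rule DERIV_cong) (simp add: field_simps del: of_nat_Suc)
    qed
  qed (use assms in auto)
  then show ?thesis by (simp add: mult.commute)
qed

text \<open>The usual estimate for Picard iteration. The kernel
  \<open>rate * exp (- hit_rate C * r)\<close> is at most \<open>rate\<close>, and the product of
  two values is Lipschitz with constant 2 in the sense that the errors of both factors add up, so
  each generation costs one integration with factor \<open>2 * rate\<close>.\<close>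

lemma yule_value_le_generation_value:
  "C \<in> space S \<Longrightarrow> 0 \<le> s \<Longrightarrow>
    yule_value s C \<le> generation_value k s C + ennreal ((2 * rate * s) ^ k / fact k)"
proof (induction k arbitrary: s C)
  case 0
  then show ?case using yule_value_le_1 by simp
next
  case (Suc k)
  note [measurable] = Suc.prems(1)
  let ?g = "\<lambda>r. \<integral>\<^sup>+ g. indicator {g. hit C g} g *
        (generation_value k (s - r) (split True C g) * generation_value k (s - r) (split False C g)) \<partial>\<mu>"
  let ?err = "\<lambda>r. ennreal ((2 * rate * (s - r)) ^ k / fact k)"
  have split: "split_yule (s - r) C \<le> ?g r + 2 * ?err r" if r: "0 \<le> r" "r \<le> s" for r
  proof -
    have "split_yule (s - r) C \<le> (\<integral>\<^sup>+ g. indicator {g. hit C g} g *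
        (generation_value k (s - r) (split True C g) * generation_value k (s - r) (split False C g)) + 2 * ?err r \<partial>\<mu>)"
      unfolding split_yule_def
    proof (intro nn_integral_mono)
      fix g assume g: "g \<in> space \<mu>"
      let ?Y = "\<lambda>b. yule_value (s - r) (split b C g)" and ?G = "\<lambda>b. generation_value k (s - r) (split b C g)"
      have le: "?Y b \<le> ?G b + ?err r" "?Y b \<le> 1" "?G b \<le> 1" for b
        using Suc g r yule_value_le_1[of "split b C g" "s - r"] generation_value_le_yule_value[of "split b C g" "s - r" k]
        by (auto intro: order_trans)
      \<comment> \<open>The factors are replaced one at a time; since all of them are at most 1,
        each replacement costs at most one error term.\<close>
      have "?Y True * ?Y False \<le> ?G True * ?Y False + ?err r * ?Y False"
        using mult_right_mono[OF le(1)[of True], of "?Y False"] by (simp add: distrib_right)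
      also have "\<dots> \<le> ?G True * (?G False + ?err r) + ?err r * 1"
        by (intro add_mono mult_left_mono le) auto
      also have "\<dots> \<le> ?G True * ?G False + 1 * ?err r + ?err r * 1"
        unfolding distrib_left by (intro add_mono mult_right_mono le) auto
      also have "\<dots> = ?G True * ?G False + 2 * ?err r"
        by (simp only: mult_2 mult_1 mult_1_right add.assoc)
      finally show "indicator {g. hit C g} g * (?Y True * ?Y False) \<le>
        indicator {g. hit C g} g * (?G True * ?G False) + 2 * ?err r"
        by (simp add: indicator_def)
    qed
    also have "\<dots> = ?g r + 2 * ?err r"
      by (simp add: nn_integral_add \<mu>.emeasure_space_1)
    finally show ?thesis .
  qed
  have "(\<integral>\<^sup>+ r. indicator {0..s} r * (ennreal (rate * exp (- hit_rate C * r)) * split_yule (s - r) C) \<partial>lborel)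
    \<le> (\<integral>\<^sup>+ r. indicator {0..s} r * (ennreal (rate * exp (- hit_rate C * r)) * ?g r) +
      indicator {0..s} r * ennreal (2 * rate * ((2 * rate * (s - r)) ^ k / fact k)) \<partial>lborel)"
  proof (intro nn_integral_mono)
    fix r
    have "ennreal (rate * exp (- hit_rate C * r)) * split_yule (s - r) C \<le>
      ennreal (rate * exp (- hit_rate C * r)) * ?g r + ennreal (2 * rate * ((2 * rate * (s - r)) ^ k / fact k))"
      if r: "0 \<le> r" "r \<le> s"
    proof -
      have "ennreal (rate * exp (- hit_rate C * r)) * split_yule (s - r) C \<le>
        ennreal (rate * exp (- hit_rate C * r)) * ?g r + ennreal (rate * exp (- hit_rate C * r)) * (2 * ?err r)"
        unfolding distrib_left[symmetric] using split[OF r] by (intro mult_left_mono) auto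
      also have "\<dots> \<le> ennreal (rate * exp (- hit_rate C * r)) * ?g r + ennreal rate * (2 * ?err r)"
        using r rate_pos hit_rate_nonneg[of C]
        by (intro add_left_mono mult_right_mono ennreal_leI) (auto simp: mult_left_le)
      also have "ennreal rate * (2 * ?err r) = ennreal (2 * rate * ((2 * rate * (s - r)) ^ k / fact k))"
        using r rate_pos by (simp add: mult_ac flip: ennreal_mult' ennreal_numeral)
      finally show ?thesis .
    qed
    then show "indicator {0..s} r * (ennreal (rate * exp (- hit_rate C * r)) * split_yule (s - r) C)
      \<le> indicator {0..s} r * (ennreal (rate * exp (- hit_rate C * r)) * ?g r) +
        indicator {0..s} r * ennreal (2 * rate * ((2 * rate * (s - r)) ^ k / fact k))"
      by (simp add: indicator_def)
  qed
  also have "\<dots> = (\<integral>\<^sup>+ r. indicator {0..s} r * (ennreal (rate * exp (- hit_rate C * r)) * ?g r) \<partial>lborel) +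
      ennreal ((2 * rate * s) ^ Suc k / fact (Suc k))"
    using Suc.prems rate_pos nn_integral_power_fact[of s "2 * rate" k]
    by (subst nn_integral_add) (simp_all add: indicator_def)
  finally show ?case
    using Suc.prems
    by (simp add: yule_value_renewal add_left_mono add.assoc del: mult_minus_left power_Suc fact_Suc)
qed

lemma generation_value_tendsto:
  assumes "C \<in> space S" "0 \<le> s"
  shows "(\<lambda>k. generation_value k s C) \<longlonglongrightarrow> yule_value s C"
proof (rule tendsto_sandwich[where h="\<lambda>_. yule_value s C"])
  have "(\<lambda>k. ennreal ((2 * rate * s) ^ k / fact k)) \<longlonglongrightarrow> ennreal 0"
    by (intro tendsto_ennrealI summable_LIMSEQ_zero) (use summable_exp[of "2 * rate * s"] in \<open>simp add: divide_inverse mult.commute\<close>)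
  from tendsto_diff_ennreal_general[OF tendsto_const this, of "yule_value s C"]
  show "(\<lambda>k. yule_value s C - ennreal ((2 * rate * s) ^ k / fact k)) \<longlonglongrightarrow> yule_value s C"
    using yule_value_le_1[OF assms] by auto
  show "\<forall>\<^sub>F k in sequentially. yule_value s C - ennreal ((2 * rate * s) ^ k / fact k) \<le> generation_value k s C"
    using yule_value_le_generation_value[OF assms]
    by (intro always_eventually allI) (simp add: ennreal_minus_le_iff add.commute)
qed (use assms in \<open>auto intro!: always_eventually generation_value_le_yule_value\<close>)

end

section \<open>Discrete time: the urn of quasi-cells\<close>

text \<open>Leibniz rule over a semiring, since the coefficients will be
  \<open>ennreal\<close>.\<close>

lemma fps_deriv_prod:
  fixes F :: "'i \<Rightarrow> 'a :: comm_semiring_1 fps"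
  assumes "finite I"
  shows "fps_deriv (\<Prod>i\<in>I. F i) = (\<Sum>a\<in>I. fps_deriv (F a) * (\<Prod>i\<in>I - {a}. F i))"
  using assms
proof (induction I)
  case empty
  show ?case by (simp add: fps_ext)
next
  case (insert j I)
  have "(\<Sum>a\<in>insert j I. fps_deriv (F a) * (\<Prod>i\<in>insert j I - {a}. F i)) =
    fps_deriv (F j) * (\<Prod>i\<in>I. F i) + (\<Sum>a\<in>I. fps_deriv (F a) * (\<Prod>i\<in>insert j I - {a}. F i))"
    using insert by (simp add: insert_Diff_if)
  also have "(\<Sum>a\<in>I. fps_deriv (F a) * (\<Prod>i\<in>insert j I - {a}. F i)) =
    (\<Sum>a\<in>I. F j * (fps_deriv (F a) * (\<Prod>i\<in>I - {a}. F i)))"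
  proof (intro sum.cong refl)
    fix a assume "a \<in> I"
    then have "insert j I - {a} = insert j (I - {a})" using insert by auto
    then show "fps_deriv (F a) * (\<Prod>i\<in>insert j I - {a}. F i) = F j * (fps_deriv (F a) * (\<Prod>i\<in>I - {a}. F i))"
      using insert by (simp add: mult_ac)
  qed
  finally show ?case
    using insert by (simp add: sum_distrib_left add.commute)
qed

lemma fps_nth_0_prod: "fps_nth (\<Prod>i\<in>I. F i) 0 = (\<Prod>i\<in>I. fps_nth (F i) 0)"
  by (induction I rule: infinite_finite_induct) auto

context cell_splitting begin

text \<open>Follows the numbering of \<open>quasi_cell\<close>, to which it is shown equal in
  \<open>urn_cell_eq\<close>: later decisions give the new index to the half \<open>True\<close>,
  whereas the first decision numbers the halves the other way round and thus has its own
  clause.\<close>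

fun urn_cell :: "'c \<Rightarrow> (nat \<Rightarrow> 'l) \<Rightarrow> (nat \<Rightarrow> nat) \<Rightarrow> nat \<Rightarrow> nat \<Rightarrow> 'c" where
  "urn_cell C x a 0 j = (if j = 1 then C else e)"
| "urn_cell C x a (Suc 0) j =
    (if j = 1 then split True C (x 1) else if j = 2 then split False C (x 1) else e)"
| "urn_cell C x a (Suc (Suc m)) j =
    (if j = Suc (Suc (Suc m)) then split True (urn_cell C x a (Suc m) (a (Suc (Suc m)))) (x (Suc (Suc m)))
     else if j = a (Suc (Suc m)) then split False (urn_cell C x a (Suc m) (a (Suc (Suc m)))) (x (Suc (Suc m)))
     else urn_cell C x a (Suc m) j)"

lemma urn_cell_cong:
  "(\<And>i. i \<in> {1..n} \<Longrightarrow> x i = y i \<and> a i = b i) \<Longrightarrow> urn_cell C x a n j = urn_cell C y b n j"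
  by (induction C x a n j rule: urn_cell.induct) auto

lemma measurable_urn_cell:
  assumes "C \<in> space S"
    and "\<And>i. i \<in> {1..n} \<Longrightarrow> (\<lambda>w. x w i) \<in> N \<rightarrow>\<^sub>M \<mu>"
    and "\<And>i. i \<in> {1..n} \<Longrightarrow> (\<lambda>w. a w i) \<in> N \<rightarrow>\<^sub>M count_space UNIV"
  shows "(\<lambda>w. urn_cell C (x w) (a w) n j) \<in> N \<rightarrow>\<^sub>M S"
  using assms
proof (induction n arbitrary: j)
  case 0
  then show ?case using e_space by simp
next
  case (Suc n)
  note [measurable] = Suc.prems(1) e_space
  have [measurable]: "(\<lambda>w. x w (Suc n)) \<in> N \<rightarrow>\<^sub>M \<mu>" "(\<lambda>w. a w (Suc n)) \<in> N \<rightarrow>\<^sub>M count_space UNIV"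
    using Suc.prems by auto
  show ?case
  proof (cases n)
    case 0
    then have [measurable]: "(\<lambda>w. x w 1) \<in> N \<rightarrow>\<^sub>M \<mu>" using Suc.prems by auto
    show ?thesis unfolding 0 urn_cell.simps by measurable
  next
    case (Suc m)
    have [measurable]: "(\<lambda>w. urn_cell C (x w) (a w) n j) \<in> N \<rightarrow>\<^sub>M S" for j
      using Suc.IH Suc.prems by auto
    have [measurable]: "(\<lambda>w. urn_cell C (x w) (a w) n (a w (Suc n))) \<in> N \<rightarrow>\<^sub>M S"
      by (rule measurable_compose_countable[where f="\<lambda>j w. urn_cell C (x w) (a w) n j"]) measurable
    show ?thesis
      using \<open>(\<lambda>w. a w (Suc n)) \<in> _\<close>
      unfolding Suc urn_cell.simps unfolding Suc[symmetric] by measurable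
  qed
qed

text \<open>The product is symmetric in the two halves, so the exceptional numbering of the first
  decision disappears and all decisions take the same form.\<close>

lemma prod_urn_cell_Suc:
  fixes F :: "'c \<Rightarrow> 'd :: comm_monoid_mult"
  assumes "a (Suc n) \<in> {1..Suc n}"
  shows "(\<Prod>j\<in>{1..Suc (Suc n)}. F (urn_cell C x a (Suc n) j)) =
    F (split True (urn_cell C x a n (a (Suc n))) (x (Suc n))) *
    F (split False (urn_cell C x a n (a (Suc n))) (x (Suc n))) *
    (\<Prod>j\<in>{1..Suc n} - {a (Suc n)}. F (urn_cell C x a n j))"
proof (cases n)
  case 0
  have "{1..Suc (Suc 0)} = {1, 2 :: nat}" by auto
  then show ?thesis using 0 assms by simp
next
  case (Suc m)
  let ?a = "a (Suc n)"
  have "(\<Prod>j\<in>{1..Suc (Suc n)}. F (urn_cell C x a (Suc n) j)) =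
      (\<Prod>j\<in>{1..Suc n}. F (urn_cell C x a (Suc n) j)) * F (urn_cell C x a (Suc n) (Suc (Suc n)))"
    by simp
  also have "(\<Prod>j\<in>{1..Suc n}. F (urn_cell C x a (Suc n) j)) =
      F (urn_cell C x a (Suc n) ?a) * (\<Prod>j\<in>{1..Suc n} - {?a}. F (urn_cell C x a (Suc n) j))"
    using assms by (intro prod.remove) auto
  finally have "(\<Prod>j\<in>{1..Suc (Suc n)}. F (urn_cell C x a (Suc n) j)) = \<dots> * F (urn_cell C x a (Suc n) (Suc (Suc n)))" .
  moreover have "(\<Prod>j\<in>{1..Suc n} - {?a}. F (urn_cell C x a (Suc n) j)) =
      (\<Prod>j\<in>{1..Suc n} - {?a}. F (urn_cell C x a n j))"
    using Suc by (intro prod.cong) auto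
  ultimately show ?thesis
    using Suc assms by (simp add: mult_ac)
qed

end

context cell_functional begin

definition urn_fps :: "'a \<Rightarrow> ennreal fps" where
  "urn_fps C = Abs_fps (\<lambda>n. urn_value n C)"

lemma urn_fps_nth[simp]: "fps_nth (urn_fps C) n = urn_value n C"
  by (simp add: urn_fps_def)

lemma measurable_prod_urn_fps[measurable]:
  assumes "finite I" "\<And>i. i \<in> I \<Longrightarrow> c i \<in> N \<rightarrow>\<^sub>M S"
  shows "(\<lambda>x. fps_nth (\<Prod>i\<in>I. urn_fps (c i x)) k) \<in> borel_measurable N"
  using assms
proof (induction I arbitrary: k)
  case empty
  then show ?case by simp
next
  case (insert i I)
  have [measurable]: "c i \<in> N \<rightarrow>\<^sub>M S" "\<And>k. (\<lambda>x. fps_nth (\<Prod>i\<in>I. urn_fps (c i x)) k) \<in> borel_measurable N"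
    using insert by auto
  show ?case
    using insert(1,2) by (simp add: fps_mult_nth)
qed

lemma urn_fps_deriv_nth:
  "fps_nth (fps_deriv (urn_fps C)) n =
    (\<Sum>i\<le>n. \<integral>\<^sup>+ g. urn_value i (split True C g) * urn_value (n - i) (split False C g) \<partial>\<mu>)"
  unfolding fps_deriv_nth urn_fps_def fps_nth_Abs_fps Suc_eq_plus1[symmetric] urn_value.simps
  by (rule of_nat_Suc_mult_divide_ennreal)

lemma nn_integral_split_fps:
  assumes C: "C \<in> space S"
  shows "(\<integral>\<^sup>+ g. fps_nth (urn_fps (split True C g) * urn_fps (split False C g) * P) k \<partial>\<mu>) =
    fps_nth (fps_deriv (urn_fps C) * P) k"
proof -
  note [measurable] = C
  have "(\<integral>\<^sup>+ g. fps_nth (urn_fps (split True C g) * urn_fps (split False C g) * P) k \<partial>\<mu>) =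
    (\<integral>\<^sup>+ g. (\<Sum>i=0..k. (\<Sum>j\<le>i. urn_value j (split True C g) * urn_value (i - j) (split False C g)) * fps_nth P (k - i)) \<partial>\<mu>)"
    by (simp add: fps_mult_nth urn_fps_def atLeast0AtMost)
  also have "\<dots> = (\<Sum>i=0..k. fps_nth (fps_deriv (urn_fps C)) i * fps_nth P (k - i))"
    by (simp add: nn_integral_sum nn_integral_multc urn_fps_deriv_nth del: fps_deriv_nth)
  finally show ?thesis
    by (simp only: fps_mult_nth)
qed

text \<open>Summing over the cell to be split, and averaging over the line, is the Leibniz rule for
  the product of the series. The factor \<open>Suc k\<close> is the one that differentiation puts in
  front of the coefficient of index \<open>Suc k\<close>.\<close>

lemma sum_nn_integral_split_fps:
  assumes "finite I" "\<And>i. i \<in> I \<Longrightarrow> c i \<in> space S"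
  shows "(\<Sum>a\<in>I. \<integral>\<^sup>+ g. fps_nth (urn_fps (split True (c a) g) * urn_fps (split False (c a) g) *
      (\<Prod>i\<in>I - {a}. urn_fps (c i))) k \<partial>\<mu>) =
    of_nat (Suc k) * fps_nth (\<Prod>i\<in>I. urn_fps (c i)) (Suc k)"
proof -
  have "(\<Sum>a\<in>I. \<integral>\<^sup>+ g. fps_nth (urn_fps (split True (c a) g) * urn_fps (split False (c a) g) *
      (\<Prod>i\<in>I - {a}. urn_fps (c i))) k \<partial>\<mu>) =
    (\<Sum>a\<in>I. fps_nth (fps_deriv (urn_fps (c a)) * (\<Prod>i\<in>I - {a}. urn_fps (c i))) k)"
    using assms by (intro sum.cong nn_integral_split_fps) auto
  also have "\<dots> = fps_nth (fps_deriv (\<Prod>i\<in>I. urn_fps (c i))) k"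
    using assms by (simp only: fps_deriv_prod fps_sum_nth)
  finally show ?thesis by simp
qed

text \<open>
  The expected product over the cells after \<open>k\<close> further decisions, starting from cells
  \<open>c\<^sub>0, \<dots>, c\<^sub>n\<close>, is \<open>urn_weight n k\<close> times the \<open>k\<close>-th coefficient of the product of the series of
  the \<open>c\<^sub>i\<close>; for a single cell the weight is \<open>1\<close>.
\<close>

definition urn_weight :: "nat \<Rightarrow> nat \<Rightarrow> ennreal" where
  "urn_weight n k = ennreal (fact k * fact n / fact (n + k))"

text \<open>The weight is the reciprocal of the binomial coefficient of \<open>n + k\<close> over
  \<open>k\<close>: in Polya's urn all ways of distributing \<open>k\<close> decisions over
  \<open>n + 1\<close> cells are equally likely. One decision trades the factor \<open>Suc k\<close>
  of the derivative against the \<open>Suc n\<close> possible choices.\<close>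

lemma urn_weight_Suc: "urn_weight (Suc n) k * of_nat (Suc k) / of_nat (Suc n) = urn_weight n (Suc k)"
proof -
  have "fact k * fact (Suc n) / fact (Suc n + k) * real (Suc k) / real (Suc n) = fact (Suc k) * fact n / fact (n + Suc k)"
    by (simp add: field_simps del: of_nat_Suc)
  then show ?thesis
    unfolding urn_weight_def ennreal_of_nat_eq_real_of_nat
    by (subst ennreal_mult'[symmetric], simp, subst divide_ennreal) (auto simp del: of_nat_Suc fact_Suc)
qed

abbreviation (input) uniform :: "nat \<Rightarrow> nat measure" where
  "uniform j \<equiv> measure_pmf (pmf_of_set {1..j})"

text \<open>The first \<open>n\<close> decisions are real and the other \<open>k\<close> are encoded
  in a coefficient. Integrating out the last real decision makes it a formal one, so
  \<open>n + k\<close> is invariant; at \<open>n = 0\<close> a single cell remains, whose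
  \<open>k\<close>-th coefficient is the claim. Hence \<open>k\<close> must be arbitrary in the
  induction, although only \<open>k = 0\<close> is used afterwards.\<close>

lemma nn_integral_urn_fps:
  assumes C: "C \<in> space S"
  shows "(\<integral>\<^sup>+ a. \<integral>\<^sup>+ x. urn_weight n k * fps_nth (\<Prod>j\<in>{1..Suc n}. urn_fps (urn_cell C x a n j)) k
      \<partial>(\<Pi>\<^sub>M i\<in>{1..n}. \<mu>) \<partial>(\<Pi>\<^sub>M i\<in>{1..n}. uniform i)) = urn_value (n + k) C"
proof (induction n arbitrary: k)
  case 0
  then show ?case
    by (simp add: PiM_empty nn_integral_count_space_finite urn_weight_def urn_fps_def)
next
  case (Suc n)
  let ?P = "\<lambda>m :: nat. \<Pi>\<^sub>M i\<in>{1..m}. \<mu>" and ?U = "\<lambda>m :: nat. \<Pi>\<^sub>M i\<in>{1..m}. uniform i"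
  let ?C = "\<lambda>x a. urn_cell C x a n" and ?s = "\<lambda>b D g. urn_fps (split b D g)"
  interpret P: product_sigma_finite "\<lambda>_ :: nat. \<mu>" by standard
  interpret U: product_sigma_finite uniform
    by standard
  interpret PI: finite_product_sigma_finite "\<lambda>_ :: nat. \<mu>" "{1..Suc n}" by standard simp
  let ?F = "\<lambda>n k x a. fps_nth (\<Prod>j\<in>{1..Suc n}. urn_fps (urn_cell C x a n j)) k"
  have ins: "{1..Suc n} = insert (Suc n) {1..n}" by auto
  have cell: "(\<lambda>x. urn_cell C x a m j) \<in> (?P m) \<rightarrow>\<^sub>M S" for a m j
    by (intro measurable_urn_cell[OF C]) simp_all
  have F[measurable]: "(\<lambda>x. ?F m k x a) \<in> borel_measurable (?P m)" for a m k
    using cell by measurable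
  have "(\<lambda>p. urn_cell C (snd p) (fst p) (Suc n) j) \<in> (?U (Suc n)) \<Otimes>\<^sub>M (?P (Suc n)) \<rightarrow>\<^sub>M S" for j
  proof (intro measurable_urn_cell[OF C])
    fix i assume i: "i \<in> {1..Suc n}"
    show "(\<lambda>p. snd p i) \<in> (?U (Suc n)) \<Otimes>\<^sub>M (?P (Suc n)) \<rightarrow>\<^sub>M \<mu>"
      using measurable_compose[OF measurable_snd measurable_component_singleton[OF i]] .
    show "(\<lambda>p. fst p i) \<in> (?U (Suc n)) \<Otimes>\<^sub>M (?P (Suc n)) \<rightarrow>\<^sub>M count_space UNIV"
      using measurable_compose[OF measurable_fst measurable_component_singleton[OF i, of uniform]] by simp
  qed
  then have [measurable]: "(\<lambda>(a, x). urn_weight (Suc n) k * ?F (Suc n) k x a) \<in> borel_measurable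
      ((?U (Suc n)) \<Otimes>\<^sub>M (?P (Suc n)))" for k
    unfolding split_beta' by measurable
  have step: "(\<integral>\<^sup>+ b. \<integral>\<^sup>+ x. urn_weight (Suc n) k * ?F (Suc n) k x (a(Suc n := b)) \<partial>(?P (Suc n)) \<partial>uniform (Suc n)) =
    (\<integral>\<^sup>+ x. urn_weight n (Suc k) * ?F n (Suc k) x a \<partial>(?P n))" for a
  proof -
    let ?I = "\<lambda>x b. \<integral>\<^sup>+ g. fps_nth (?s True (?C x a b) g * ?s False (?C x a b) g *
      (\<Prod>j\<in>{1..Suc n} - {b}. urn_fps (?C x a j))) k \<partial>\<mu>"
    have "(\<integral>\<^sup>+ x. urn_weight (Suc n) k * ?F (Suc n) k x (a(Suc n := b)) \<partial>(?P (Suc n))) =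
      (\<integral>\<^sup>+ x. urn_weight (Suc n) k * ?I x b \<partial>(?P n))" if b: "b \<in> {1..Suc n}" for b
    proof -
      \<comment> \<open>The cells after \<open>n\<close> decisions do not see coordinate
        \<open>Suc n\<close>, so this coordinate can be integrated out on its own.\<close>
      have eq: "urn_cell C (x(Suc n := g)) (a(Suc n := b)) n j = ?C x a j" for x g j
        by (rule urn_cell_cong) auto
      have m: "(\<lambda>x. urn_weight (Suc n) k * ?F (Suc n) k x (a(Suc n := b))) \<in> borel_measurable (?P (Suc n))"
        using F by measurable
      have "(\<integral>\<^sup>+ x. urn_weight (Suc n) k * ?F (Suc n) k x (a(Suc n := b)) \<partial>(?P (Suc n))) =
        (\<integral>\<^sup>+ x. \<integral>\<^sup>+ g. urn_weight (Suc n) k * ?F (Suc n) k (x(Suc n := g)) (a(Suc n := b)) \<partial>\<mu> \<partial>(?P n))"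
        unfolding ins by (rule P.product_nn_integral_insert[OF finite_atLeastAtMost _ m[unfolded ins]]) simp
      also have "\<dots> = (\<integral>\<^sup>+ x. urn_weight (Suc n) k * ?I x b \<partial>(?P n))"
      proof (intro nn_integral_cong)
        fix x assume x: "x \<in> space (?P n)"
        have [measurable]: "?C x a j \<in> space S" for j
          using measurable_space[OF cell x] .
        have "(\<integral>\<^sup>+ g. urn_weight (Suc n) k * ?F (Suc n) k (x(Suc n := g)) (a(Suc n := b)) \<partial>\<mu>) =
          (\<integral>\<^sup>+ g. urn_weight (Suc n) k * fps_nth (?s True (?C x a b) g *
            ?s False (?C x a b) g * (\<Prod>j\<in>{1..Suc n} - {b}. urn_fps (?C x a j))) k \<partial>\<mu>)"
          using b by (subst prod_urn_cell_Suc) (simp_all add: eq)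
        also have "\<dots> = urn_weight (Suc n) k * ?I x b"
          by (rule nn_integral_cmult) (simp add: fps_mult_nth)
        finally show "(\<integral>\<^sup>+ g. urn_weight (Suc n) k * ?F (Suc n) k (x(Suc n := g)) (a(Suc n := b)) \<partial>\<mu>) =
          urn_weight (Suc n) k * ?I x b" .
      qed
      finally show ?thesis .
    qed
    then have "(\<integral>\<^sup>+ b. \<integral>\<^sup>+ x. urn_weight (Suc n) k * ?F (Suc n) k x (a(Suc n := b)) \<partial>(?P (Suc n)) \<partial>uniform (Suc n)) =
      (\<Sum>b\<in>{1..Suc n}. \<integral>\<^sup>+ x. urn_weight (Suc n) k * ?I x b \<partial>(?P n)) / of_nat (Suc n)"
      by (subst nn_integral_pmf_of_set) (simp_all del: of_nat_Suc)
    also have "(\<Sum>b\<in>{1..Suc n}. \<integral>\<^sup>+ x. urn_weight (Suc n) k * ?I x b \<partial>(?P n)) =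
      (\<integral>\<^sup>+ x. (\<Sum>b\<in>{1..Suc n}. urn_weight (Suc n) k * ?I x b) \<partial>(?P n))"
    proof (rule nn_integral_sum[symmetric])
      fix b
      have "(\<lambda>x. urn_weight (Suc n) k * fps_nth (fps_deriv (urn_fps (?C x a b)) *
          (\<Prod>j\<in>{1..Suc n} - {b}. urn_fps (?C x a j))) k) \<in> borel_measurable (?P n)"
        using cell unfolding fps_mult_nth fps_deriv_nth urn_fps_nth by measurable
      then show "(\<lambda>x. urn_weight (Suc n) k * ?I x b) \<in> borel_measurable (?P n)"
        using measurable_space[OF cell] by (subst measurable_cong) (simp_all only: nn_integral_split_fps)
    qed
    also have "\<dots> = (\<integral>\<^sup>+ x. urn_weight (Suc n) k * of_nat (Suc k) * ?F n (Suc k) x a \<partial>(?P n))"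
      using measurable_space[OF cell]
      by (intro nn_integral_cong, subst sum_distrib_left[symmetric], subst sum_nn_integral_split_fps)
         (simp_all only: finite_atLeastAtMost mult.assoc)
    also have "\<dots> / of_nat (Suc n) = (\<integral>\<^sup>+ x. urn_weight (Suc n) k * of_nat (Suc k) * ?F n (Suc k) x a / of_nat (Suc n) \<partial>(?P n))"
      by (rule nn_integral_divide[symmetric]) measurable
    also have "\<dots> = (\<integral>\<^sup>+ x. urn_weight n (Suc k) * ?F n (Suc k) x a \<partial>(?P n))"
      by (simp only: urn_weight_Suc[symmetric] ennreal_times_divide[symmetric] divide_ennreal_def mult_ac)
    finally show ?thesis .
  qed
  have nin: "Suc n \<notin> {1..n}" by simp
  have m: "(\<lambda>a. \<integral>\<^sup>+ x. urn_weight (Suc n) k * ?F (Suc n) k x a \<partial>(?P (Suc n))) \<in>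
      borel_measurable (?U (Suc n))"
    by (rule PI.borel_measurable_nn_integral) fact
  have "(\<integral>\<^sup>+ a. \<integral>\<^sup>+ x. urn_weight (Suc n) k * ?F (Suc n) k x a \<partial>(?P (Suc n)) \<partial>(?U (Suc n))) =
    (\<integral>\<^sup>+ a. \<integral>\<^sup>+ b. \<integral>\<^sup>+ x. urn_weight (Suc n) k * ?F (Suc n) k x (a(Suc n := b)) \<partial>(?P (Suc n)) \<partial>uniform (Suc n) \<partial>(?U n))"
    using U.product_nn_integral_insert[OF finite_atLeastAtMost nin m[unfolded ins]]
    unfolding ins[symmetric] .
  also have "\<dots> = urn_value (n + Suc k) C"
    unfolding step by (rule Suc.IH)
  finally show ?case by simp
qed

text \<open>For \<open>k = 0\<close> the weight is 1, and the zeroth coefficient of a product is the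
  product of the zeroth coefficients, which are the values of \<open>f\<close>.\<close>

theorem nn_integral_urn_cells:
  assumes C: "C \<in> space S"
  shows "(\<integral>\<^sup>+ a. \<integral>\<^sup>+ x. (\<Prod>j\<in>{1..Suc n}. f (urn_cell C x a n j))
      \<partial>(\<Pi>\<^sub>M i\<in>{1..n}. \<mu>) \<partial>(\<Pi>\<^sub>M i\<in>{1..n}. uniform i)) = urn_value n C"
  using nn_integral_urn_fps[OF assms, of n 0]
  by (simp add: urn_weight_def fps_nth_0_prod)

end

section \<open>Continuous time: the tree of generations\<close>

lemma nn_integral_exponential_tail:
  assumes "0 < c"
  shows "(\<integral>\<^sup>+ r. ennreal (c * exp (- c * r)) * indicator {s..} r \<partial>lborel) = ennreal (exp (- c * s))"
proof -
  have "(\<integral>\<^sup>+ r. ennreal (c * exp (- c * r)) * indicator {s..} r \<partial>lborel) = ennreal (0 - (- exp (- c * s)))"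
  proof (rule nn_integral_FTC_atLeast)
    show "((\<lambda>r. - exp (- c * r)) has_real_derivative c * exp (- c * r)) (at r)" for r
      by (auto intro!: derivative_eq_intros)
    have "((\<lambda>r. exp (- c * r)) \<longlongrightarrow> 0) at_top"
      using assms by (intro filterlim_compose[OF exp_at_bot] filterlim_tendsto_neg_mult_at_bot[OF tendsto_const])
        (auto simp: filterlim_ident)
    then show "((\<lambda>r. - exp (- c * r)) \<longlongrightarrow> 0) at_top"
      by (metis tendsto_minus minus_zero)
  qed (use assms in auto)
  then show ?thesis by simp
qed

lemma finite_length_less: "finite {v :: bool list. length v < n}"
  by (rule finite_subset[OF _ finite_lists_length_le[of "UNIV :: bool set" n]]) auto

lemma finite_length_eq: "finite {v :: bool list. length v = n}"
  using finite_lists_length_eq[of "UNIV :: bool set" n] by simp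

lemma length_less_Suc: "{v :: bool list. length v < Suc n} = {v. length v < n} \<union> {v. length v = n}"
  by auto

lemma prod_length_Suc:
  "(\<Prod>v | length v = Suc n. h v) = (\<Prod>v | length v = n. h (True # v) * h (False # v))"
    for h :: "bool list \<Rightarrow> 'd :: comm_monoid_mult"
proof -
  have "{v :: bool list. length v = Suc n} = (#) True ` {v. length v = n} \<union> (#) False ` {v. length v = n}"
    by (auto simp: length_Suc_conv image_iff)
  moreover have "(#) True ` {v. length v = n} \<inter> (#) False ` {v. length v = n} = {}" by auto
  ultimately show ?thesis
    by (simp add: prod.union_disjoint prod.reindex finite_length_eq prod.distrib)
qed

lemma prod_length_less_Suc:
  "(\<Prod>v | length v < Suc n. h v) = (\<Prod>v | length v < n. h v) * (\<Prod>v | length v = n. h v)"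
    for h :: "bool list \<Rightarrow> 'd :: comm_monoid_mult"
  unfolding length_less_Suc by (rule prod.union_disjoint) (auto simp: finite_length_less finite_length_eq)

context cell_splitting begin

text \<open>
  The joint density of the lifetime and the dividing line of a cell \<open>D\<close> with respect to \<open>lborel \<Otimes>\<^sub>M \<mu>\<close>: the
  normalization of the law of the line cancels against the rate \<open>hit_rate D\<close> of the lifetime.
\<close>

definition split_density :: "'c \<Rightarrow> real \<times> 'l \<Rightarrow> ennreal" where
  "split_density D p =
    ennreal (rate * exp (- hit_rate D * fst p)) * indicator {0..} (fst p) * indicator {g. hit D g} (snd p)"

lemma measurable_split_density[measurable (raw)]:
  assumes [measurable]: "X \<in> N \<rightarrow>\<^sub>M S" "p \<in> N \<rightarrow>\<^sub>M borel \<Otimes>\<^sub>M \<mu>"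
  shows "(\<lambda>w. split_density (X w) (p w)) \<in> borel_measurable N"
  unfolding split_density_def indicator_def atLeast_iff mem_Collect_eq by measurable

primrec tree_cell :: "'c \<Rightarrow> (bool list \<Rightarrow> 'l) \<Rightarrow> bool list \<Rightarrow> 'c" where
  "tree_cell C g [] = C"
| "tree_cell C g (b # v) = split b (tree_cell C g v) (g v)"

lemma tree_cell_cong:
  "(\<And>u. length u < length v \<Longrightarrow> g u = h u) \<Longrightarrow> tree_cell C g v = tree_cell C h v"
  by (induction v) auto

lemma measurable_tree_cell:
  assumes "C \<in> space S" "\<And>u. length u < length v \<Longrightarrow> (\<lambda>w. g w u) \<in> N \<rightarrow>\<^sub>M \<mu>"
  shows "(\<lambda>w. tree_cell C (g w) v) \<in> N \<rightarrow>\<^sub>M S"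
  using assms(2)
proof (induction v)
  case Nil
  then show ?case using assms by simp
next
  case (Cons b v)
  then have [measurable]: "(\<lambda>w. tree_cell C (g w) v) \<in> N \<rightarrow>\<^sub>M S" "(\<lambda>w. g w v) \<in> N \<rightarrow>\<^sub>M \<mu>"
    by auto
  show ?case by simp
qed

lemma tree_cell_space:
  "C \<in> space S \<Longrightarrow> (\<And>u. length u < length v \<Longrightarrow> g u \<in> space \<mu>) \<Longrightarrow> tree_cell C g v \<in> space S"
  by (induction v) auto

end

lemma stit_birth_cong:
  "(\<And>u. length u < length v \<Longrightarrow> \<sigma> u = \<tau> u) \<Longrightarrow> stit_birth \<sigma> v = stit_birth \<tau> v"
  by (induction v) auto

lemma measurable_stit_birth:
  "(\<And>u. length u < length v \<Longrightarrow> (\<lambda>w. \<tau> w u) \<in> borel_measurable N) \<Longrightarrow>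
    (\<lambda>w. stit_birth (\<tau> w) v) \<in> borel_measurable N"
  by (induction v) auto

context cell_functional begin

lemma generation_value_neg: "s < 0 \<Longrightarrow> generation_value k s C = 1"
  by (cases k) auto

text \<open>Integrates out one node. If \<open>s < 0\<close>, the node is unborn, the daughters have
  value 1, and the density has total mass 1. If the lifetime exceeds \<open>s\<close>, the node is
  alive and contributes \<open>f D\<close> with probability \<open>exp (- hit_rate D * s)\<close>;
  otherwise its daughters take over. Since \<open>D\<close> is not \<open>e\<close>, its rate is
  positive, as the exponential integrals require.\<close>

lemma nn_integral_split_density:
  assumes D: "D \<in> space S" "D \<noteq> e"
  shows "(\<integral>\<^sup>+ p. split_density D p * (if 0 \<le> s \<and> s < fst p then f D else 1) *
      (generation_value k (s - fst p) (split True D (snd p)) * generation_value k (s - fst p) (split False D (snd p)))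
      \<partial>(lborel \<Otimes>\<^sub>M \<mu>)) = generation_value (Suc k) s D"
proof -
  note [measurable] = D(1)
  let ?G = "\<lambda>r g. generation_value k (s - r) (split True D g) * generation_value k (s - r) (split False D g)"
  let ?\<rho> = "hit_rate D"
  have \<rho>: "0 < ?\<rho>" using D by (rule hit_rate_pos)
  have hit: "ennreal (rate * c) * emeasure \<mu> {g \<in> space \<mu>. hit D g} = ennreal (?\<rho> * c)" if "0 \<le> c" for c
    using that rate_pos by (simp add: hit_rate_def \<mu>.emeasure_eq_measure mult_ac flip: ennreal_mult')
  have hit': "(\<integral>\<^sup>+ g. indicator {g. hit D g} g \<partial>\<mu>) = emeasure \<mu> {g \<in> space \<mu>. hit D g}"
  proof -
    have "(\<integral>\<^sup>+ g. indicator {g. hit D g} g \<partial>\<mu>) = (\<integral>\<^sup>+ g. indicator {g \<in> space \<mu>. hit D g} g \<partial>\<mu>)"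
      by (intro nn_integral_cong) (simp add: indicator_def)
    then show ?thesis by simp
  qed
  have "(\<integral>\<^sup>+ p. split_density D p * (if 0 \<le> s \<and> s < fst p then f D else 1) * ?G (fst p) (snd p) \<partial>(lborel \<Otimes>\<^sub>M \<mu>)) =
    (\<integral>\<^sup>+ r. \<integral>\<^sup>+ g. split_density D (r, g) * (if 0 \<le> s \<and> s < r then f D else 1) * ?G r g \<partial>\<mu> \<partial>lborel)"
    by (subst \<mu>.nn_integral_fst[symmetric]) simp_all
  also have "\<dots> = generation_value (Suc k) s D"
  proof (cases "s < 0")
    case True
    have "(\<integral>\<^sup>+ g. split_density D (r, g) * (if 0 \<le> s \<and> s < r then f D else 1) * ?G r g \<partial>\<mu>) =
      ennreal (?\<rho> * exp (- ?\<rho> * r)) * indicator {0..} r" for r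
      using True hit[of "exp (- ?\<rho> * r)"]
      by (cases "0 \<le> r") (simp_all add: split_density_def generation_value_neg nn_integral_cmult hit')
    then show ?thesis
      using True nn_integral_exponential_tail[OF \<rho>, of 0] by simp
  next
    case False
    \<comment> \<open>Only almost everywhere, because both indicators on the right include the
      endpoint \<open>r = s\<close>.\<close>
    have "AE r in lborel. (\<integral>\<^sup>+ g. split_density D (r, g) * (if 0 \<le> s \<and> s < r then f D else 1) * ?G r g \<partial>\<mu>) =
      ennreal (?\<rho> * exp (- ?\<rho> * r)) * indicator {s..} r * f D +
      indicator {0..s} r * (ennreal (rate * exp (- ?\<rho> * r)) * (\<integral>\<^sup>+ g. indicator {g. hit D g} g * ?G r g \<partial>\<mu>))"
      using AE_lborel_singleton[of s]
    proof eventually_elim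
      case (elim r)
      consider "r < 0" | "0 \<le> r" "r < s" | "s < r" using elim by linarith
      then show ?case
      proof cases
        case 3
        have "(\<integral>\<^sup>+ g. split_density D (r, g) * (if 0 \<le> s \<and> s < r then f D else 1) * ?G r g \<partial>\<mu>) =
          (\<integral>\<^sup>+ g. ennreal (rate * exp (- ?\<rho> * r)) * f D * indicator {g. hit D g} g \<partial>\<mu>)"
          using 3 False by (intro nn_integral_cong) (simp add: split_density_def generation_value_neg mult_ac)
        also have "\<dots> = ennreal (rate * exp (- ?\<rho> * r)) * emeasure \<mu> {g \<in> space \<mu>. hit D g} * f D"
          by (simp add: nn_integral_cmult nn_integral_multc hit' mult_ac)
        finally show ?thesis
          using 3 False by (simp add: hit)
      qed (use False in \<open>auto simp: split_density_def nn_integral_cmult mult.assoc\<close>)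
    qed
    then have "(\<integral>\<^sup>+ r. \<integral>\<^sup>+ g. split_density D (r, g) * (if 0 \<le> s \<and> s < r then f D else 1) * ?G r g \<partial>\<mu> \<partial>lborel) =
      (\<integral>\<^sup>+ r. ennreal (?\<rho> * exp (- ?\<rho> * r)) * indicator {s..} r * f D +
      indicator {0..s} r * (ennreal (rate * exp (- ?\<rho> * r)) * (\<integral>\<^sup>+ g. indicator {g. hit D g} g * ?G r g \<partial>\<mu>)) \<partial>lborel)"
      by (rule nn_integral_cong_AE)
    also have "\<dots> = generation_value (Suc k) s D"
      using False nn_integral_exponential_tail[OF \<rho>, of s]
      by (subst nn_integral_add) (simp_all add: nn_integral_multc)
    finally show ?thesis .
  qed
  finally show ?thesis .
qed

definition alive_value :: "'a \<Rightarrow> real \<Rightarrow> (bool list \<Rightarrow> real) \<Rightarrow> (bool list \<Rightarrow> 'b) \<Rightarrow> bool list \<Rightarrow> ennreal" where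
  "alive_value C t \<tau> g v =
    (if stit_birth \<tau> v \<le> t \<and> t < stit_birth \<tau> v + \<tau> v then f (tree_cell C g v) else 1)"


text \<open>
  Peeling off the last generation replaces \<open>generation_value k\<close> by \<open>generation_value (Suc k)\<close>.
\<close>

lemma nn_integral_tree:
  assumes C: "C \<in> space S" "C \<noteq> e"
  shows "(\<integral>\<^sup>+ x. (\<Prod>v | length v < n. split_density (tree_cell C (\<lambda>u. snd (x u)) v) (x v)) *
      ((\<Prod>v | length v < n. alive_value C t (\<lambda>u. fst (x u)) (\<lambda>u. snd (x u)) v) *
       (\<Prod>v | length v = n. generation_value k (t - stit_birth (\<lambda>u. fst (x u)) v) (tree_cell C (\<lambda>u. snd (x u)) v)))
      \<partial>(\<Pi>\<^sub>M v\<in>{v. length v < n}. lborel \<Otimes>\<^sub>M \<mu>)) = generation_value (n + k) t C"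
proof (induction n arbitrary: k)
  case 0
  then show ?case by (simp add: PiM_empty nn_integral_count_space_finite)
next
  case (Suc n)
  let ?R = "lborel \<Otimes>\<^sub>M \<mu>"
  let ?I = "{v :: bool list. length v < n}" and ?J = "{v :: bool list. length v = n}"
  let ?cell = "\<lambda>x. tree_cell C (\<lambda>u. snd (x u))" and ?birth = "\<lambda>x. stit_birth (\<lambda>u. fst (x u))"
  let ?alive = "\<lambda>x. alive_value C t (\<lambda>u. fst (x u)) (\<lambda>u. snd (x u))"
  let ?d = "\<lambda>n x. \<Prod>v | length v < n. split_density (?cell x v) (x v)"
  let ?a = "\<lambda>n x. \<Prod>v | length v < n. ?alive x v"
  let ?g = "\<lambda>n k x. \<Prod>v | length v = n. generation_value k (t - ?birth x v) (?cell x v)"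
  interpret R: pair_sigma_finite lborel \<mu> by standard
  interpret P: product_sigma_finite "\<lambda>_ :: bool list. ?R" by standard
  have comp[measurable]: "(\<lambda>x. x v) \<in> (\<Pi>\<^sub>M v\<in>{v. length v < m}. ?R) \<rightarrow>\<^sub>M ?R" if "length v < m" for v :: "bool list" and m
    using that by (intro measurable_component_singleton) simp
  have cell[measurable]: "(\<lambda>x. ?cell x v) \<in> (\<Pi>\<^sub>M v\<in>{v. length v < m}. ?R) \<rightarrow>\<^sub>M S" if "length v \<le> m" for v m
    using that by (intro measurable_tree_cell C measurable_compose[OF comp]) simp_all
  have birth[measurable]: "(\<lambda>x. ?birth x v) \<in> borel_measurable (\<Pi>\<^sub>M v\<in>{v. length v < m}. ?R)" if "length v \<le> m" for v m
    using that by (intro measurable_stit_birth measurable_compose[OF comp]) simp_all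
  have meas: "(\<lambda>x. ?d m x * (?a m x * ?g m k x)) \<in> borel_measurable (\<Pi>\<^sub>M v\<in>{v. length v < m}. ?R)" for m k
    unfolding alive_value_def
    by (intro borel_measurable_times_ennreal borel_measurable_prod_ennreal) measurable
  have "integral\<^sup>N (\<Pi>\<^sub>M v\<in>{v. length v < Suc n}. ?R) (\<lambda>x. ?d (Suc n) x * (?a (Suc n) x * ?g (Suc n) k x)) =
    (\<integral>\<^sup>+ x. \<integral>\<^sup>+ y. ?d (Suc n) (merge ?I ?J (x, y)) * (?a (Suc n) (merge ?I ?J (x, y)) * ?g (Suc n) k (merge ?I ?J (x, y)))
      \<partial>(\<Pi>\<^sub>M v\<in>?J. ?R) \<partial>(\<Pi>\<^sub>M v\<in>?I. ?R))"
    using meas[of "Suc n" k] unfolding length_less_Suc[of n]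
    by (intro P.product_nn_integral_fold finite_length_less finite_length_eq) auto
  also have "\<dots> = (\<integral>\<^sup>+ x. ?d n x * (?a n x * ?g n (Suc k) x) \<partial>(\<Pi>\<^sub>M v\<in>?I. ?R))"
  proof (intro nn_integral_cong)
    fix x :: "bool list \<Rightarrow> real \<times> 'b" assume x: "x \<in> space (\<Pi>\<^sub>M v\<in>?I. ?R)"
    let ?z = "\<lambda>y. merge ?I ?J (x, y)"
    have xs: "snd (x v) \<in> space \<mu>" if "length v < n" for v
      using x that by (auto simp: space_PiM space_pair_measure dest!: PiE_mem)
    have cs: "?cell x v \<in> space S" if "length v \<le> n" for v
      using xs that by (intro tree_cell_space C) auto
    \<comment> \<open>With the earlier generations fixed, the integrand factorizes over the nodes of
      generation \<open>n\<close>, each taken together with its two daughters.\<close>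
    define \<psi> where "\<psi> v p = split_density (?cell x v) p *
      (if 0 \<le> t - ?birth x v \<and> t - ?birth x v < fst p then f (?cell x v) else 1) *
      (generation_value k (t - ?birth x v - fst p) (split True (?cell x v) (snd p)) *
       generation_value k (t - ?birth x v - fst p) (split False (?cell x v) (snd p)))" for v p
    have \<psi>[measurable]: "\<psi> v \<in> borel_measurable ?R" if "length v = n" for v
    proof -
      have [measurable]: "?cell x v \<in> space S" using cs that by simp
      show ?thesis unfolding \<psi>_def by measurable
    qed
    have z: "?cell (?z y) v = ?cell x v" "?birth (?z y) v = ?birth x v" if "length v \<le> n" for v y
      using that by (auto simp: merge_def intro!: tree_cell_cong stit_birth_cong)
    have z_lt: "?z y v = x v" if "length v < n" for v y using that by (simp add: merge_def)
    have z_eq: "?z y v = y v" if "length v = n" for v y using that by (simp add: merge_def)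
    have "?d (Suc n) (?z y) * (?a (Suc n) (?z y) * ?g (Suc n) k (?z y)) =
      ?d n x * ?a n x * (\<Prod>v\<in>?J. \<psi> v (y v))" for y
    proof -
      have "?d (Suc n) (?z y) = ?d n x * (\<Prod>v\<in>?J. split_density (?cell x v) (y v))"
        unfolding prod_length_less_Suc by (intro arg_cong2[of _ _ _ _ times] prod.cong) (simp_all add: z z_lt z_eq)
      moreover have "?a (Suc n) (?z y) = ?a n x *
          (\<Prod>v\<in>?J. if 0 \<le> t - ?birth x v \<and> t - ?birth x v < fst (y v) then f (?cell x v) else 1)"
        unfolding prod_length_less_Suc
        by (intro arg_cong2[of _ _ _ _ times] prod.cong) (auto simp add: z z_lt z_eq alive_value_def)
      moreover have "?g (Suc n) k (?z y) =
          (\<Prod>v\<in>?J. generation_value k (t - ?birth x v - fst (y v)) (split True (?cell x v) (snd (y v))) *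
            generation_value k (t - ?birth x v - fst (y v)) (split False (?cell x v) (snd (y v))))"
        unfolding prod_length_Suc by (intro prod.cong) (simp_all add: z z_eq diff_diff_eq)
      ultimately show ?thesis
        unfolding \<psi>_def prod.distrib by (simp add: mult_ac)
    qed
    then have "(\<integral>\<^sup>+ y. ?d (Suc n) (?z y) * (?a (Suc n) (?z y) * ?g (Suc n) k (?z y)) \<partial>(\<Pi>\<^sub>M v\<in>?J. ?R)) =
      (\<integral>\<^sup>+ y. ?d n x * ?a n x * (\<Prod>v\<in>?J. \<psi> v (y v)) \<partial>(\<Pi>\<^sub>M v\<in>?J. ?R))"
      by simp
    also have "\<dots> = ?d n x * ?a n x * (\<integral>\<^sup>+ y. (\<Prod>v\<in>?J. \<psi> v (y v)) \<partial>(\<Pi>\<^sub>M v\<in>?J. ?R))"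
    proof (intro nn_integral_cmult borel_measurable_prod_ennreal)
      fix v assume v: "v \<in> ?J"
      show "(\<lambda>y. \<psi> v (y v)) \<in> borel_measurable (\<Pi>\<^sub>M v\<in>?J. ?R)"
        using v measurable_compose[OF measurable_component_singleton[OF v, of "\<lambda>_. ?R"] \<psi>[of v]] by simp
    qed
    also have "\<dots> = ?d n x * ?a n x * (\<Prod>v\<in>?J. \<integral>\<^sup>+ p. \<psi> v p \<partial>?R)"
      by (subst P.product_nn_integral_prod) (simp_all add: finite_length_eq)
    also have "\<dots> = ?d n x * (?a n x * ?g n (Suc k) x)"
    proof (cases "?d n x = 0")
      case False
      \<comment> \<open>Where the density does not vanish, every line hits the cell it divides, so
        \<open>hit_nonempty\<close> keeps all cells up to generation \<open>n\<close> different from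
        \<open>e\<close>. Where it vanishes, both sides are 0.\<close>
      have "?cell x v \<noteq> e" if "length v \<le> n" for v
        using that
      proof (induction v)
        case (Cons b v)
        then have "split_density (?cell x v) (x v) \<noteq> 0"
          using False finite_length_less[of n] by (auto simp: prod_zero_iff)
        then have "hit (?cell x v) (snd (x v))"
          by (auto simp: split_density_def indicator_def split: if_splits)
        then show ?case
          using Cons.prems cs[of v] xs[of v] hit_nonempty by simp
      qed (use C in simp)
      then have "(\<integral>\<^sup>+ p. \<psi> v p \<partial>?R) = generation_value (Suc k) (t - ?birth x v) (?cell x v)" if "length v = n" for v
        unfolding \<psi>_def using that cs by (intro nn_integral_split_density) auto
      then show ?thesis by (simp add: mult.assoc del: generation_value.simps)
    qed (simp only: mult_zero_left)
    finally show "(\<integral>\<^sup>+ y. ?d (Suc n) (?z y) * (?a (Suc n) (?z y) * ?g (Suc n) k (?z y)) \<partial>(\<Pi>\<^sub>M v\<in>?J. ?R)) =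
      ?d n x * (?a n x * ?g n (Suc k) x)" .
  qed
  also have "\<dots> = generation_value (Suc n + k) t C"
    using Suc.IH[of "Suc k"] by simp
  finally show ?case .
qed

end

section \<open>Lines and half-planes\<close>

abbreviation normal_vec :: "real \<Rightarrow> real^2" where
  "normal_vec \<phi> \<equiv> vector [cos \<phi>, sin \<phi>]"

lemma inner_normal_vec: "x \<bullet> normal_vec \<phi> = x $ 1 * cos \<phi> + x $ 2 * sin \<phi>"
  by (simp add: inner_vec_def sum_2 vector_2)

lemma inner_normal_vec_self: "normal_vec \<phi> \<bullet> normal_vec \<phi> = 1"
  by (simp add: inner_normal_vec vector_2 flip: power2_eq_square)

lemma norm_normal_vec: "norm (normal_vec \<phi>) = 1"
  by (simp add: norm_eq_sqrt_inner inner_normal_vec_self)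

lemma mem_line_of: "x \<in> line_of \<phi> r \<longleftrightarrow> x \<bullet> normal_vec \<phi> = r"
  by (simp add: line_of_def)

text \<open>Two points of the first line show that its direction is orthogonal to the second normal.
  So the sine of the difference of the angles is 0, and the angles differ by less than pi.\<close>

lemma line_of_inj:
  assumes "line_of \<phi> r = line_of \<psi> s" "\<phi> \<in> {0..<pi}" "\<psi> \<in> {0..<pi}"
  shows "\<phi> = \<psi> \<and> r = s"
proof -
  have "r *\<^sub>R normal_vec \<phi> + c *\<^sub>R vector [- sin \<phi>, cos \<phi>] \<in> line_of \<phi> r" for c
    unfolding mem_line_of inner_add_left inner_scaleR_left inner_normal_vec_self
    by (simp add: inner_normal_vec vector_2)
  then have *: "(r *\<^sub>R normal_vec \<phi> + c *\<^sub>R vector [- sin \<phi>, cos \<phi>]) \<bullet> normal_vec \<psi> = s" for c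
    using assms(1) by (simp add: mem_line_of)
  have "vector [- sin \<phi>, cos \<phi>] \<bullet> normal_vec \<psi> = 0"
    using *[of 0] *[of 1] by (simp add: inner_add_left)
  then have sin: "sin (\<psi> - \<phi>) = 0"
    by (simp add: inner_normal_vec vector_2 sin_diff algebra_simps)
  have "\<psi> - \<phi> = 0"
  proof (rule linorder_cases[of "\<psi> - \<phi>" 0])
    assume "\<psi> - \<phi> < 0"
    moreover have "sin (\<phi> - \<psi>) = 0"
      using sin sin_minus[of "\<psi> - \<phi>"] by simp
    ultimately show ?thesis using sin_gt_zero[of "\<phi> - \<psi>"] assms(2,3) by simp
  next
    assume "0 < \<psi> - \<phi>"
    then show ?thesis using sin_gt_zero[of "\<psi> - \<phi>"] assms(2,3) sin by simp
  qed
  then show ?thesis using *[of 0] inner_normal_vec_self[of \<phi>] by simp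
qed

lemma space_line_space: "space line_space = (\<lambda>(\<phi>, r). line_of \<phi> r) ` ({0..<pi} \<times> UNIV)"
  by (simp add: line_space_def space_embed_measure space_restrict_space)

lemma line_space_cases:
  assumes "g \<in> space line_space"
  obtains \<phi> r where "\<phi> \<in> {0..<pi}" "g = line_of \<phi> r"
  using assms by (auto simp: space_line_space)

lemma line_of_space: "\<phi> \<in> {0..<pi} \<Longrightarrow> line_of \<phi> r \<in> space line_space"
  by (auto simp: space_line_space)

lemma pred_line_space:
  assumes "Measurable.pred (borel \<Otimes>\<^sub>M borel) (\<lambda>p :: real \<times> real. P (line_of (fst p) (snd p)))"
  shows "Measurable.pred line_space P"
  unfolding line_space_def
  by (rule measurable_embed_measure1)
     (use assms in \<open>simp add: split_beta' measurable_restrict_space1 borel_prod\<close>)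

text \<open>Along the segment from the origin to \<open>x\<close>, the inner product with the normal
  runs through all values between 0 and its value at \<open>x\<close>. For \<open>r = 0\<close> the
  right-hand side is empty, so the other \<open>half_plane\<close> then consists of both sides of
  the line.\<close>

lemma half_plane_True_line_of:
  "half_plane True (line_of \<phi> r) = {x. 0 < r \<and> x \<bullet> normal_vec \<phi> < r \<or> r < 0 \<and> r < x \<bullet> normal_vec \<phi>}"
proof -
  have "x \<in> half_plane True (line_of \<phi> r) \<longleftrightarrow> 0 < r \<and> x \<bullet> normal_vec \<phi> < r \<or> r < 0 \<and> r < x \<bullet> normal_vec \<phi>" for x
  proof -
    let ?y = "x \<bullet> normal_vec \<phi>"
    have seg: "closed_segment 0 x \<inter> line_of \<phi> r = {} \<longleftrightarrow> (\<forall>s. 0 \<le> s \<longrightarrow> s \<le> 1 \<longrightarrow> s * ?y \<noteq> r)"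
    proof -
      have "closed_segment 0 x \<inter> line_of \<phi> r = {} \<longleftrightarrow> (\<forall>s\<in>{0..1}. s *\<^sub>R x \<notin> line_of \<phi> r)"
        unfolding closed_segment_image_interval by auto
      then show ?thesis by (auto simp: mem_line_of)
    qed
    have "x \<in> half_plane True (line_of \<phi> r) \<longleftrightarrow> ?y \<noteq> r \<and> closed_segment 0 x \<inter> line_of \<phi> r = {}"
      by (simp add: half_plane_def mem_line_of)
    also have "\<dots> \<longleftrightarrow> (\<forall>s. 0 \<le> s \<longrightarrow> s \<le> 1 \<longrightarrow> s * ?y \<noteq> r)"
      unfolding seg by (metis mult_1 order_refl zero_le_one)
    also have "\<dots> \<longleftrightarrow> 0 < r \<and> ?y < r \<or> r < 0 \<and> r < ?y"
    proof
      assume *: "\<forall>s. 0 \<le> s \<longrightarrow> s \<le> 1 \<longrightarrow> s * ?y \<noteq> r"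
      have "r \<noteq> 0" "?y \<noteq> r" using *[rule_format, of 0] *[rule_format, of 1] by auto
      moreover have False if "0 < r" "r < ?y"
        using *[rule_format, of "r / ?y"] that by auto
      moreover have False if "r < 0" "?y < r"
        using *[rule_format, of "r / ?y"] that by (auto simp: divide_le_eq zero_le_divide_iff)
      ultimately show "0 < r \<and> ?y < r \<or> r < 0 \<and> r < ?y" by (auto simp: neq_iff)
    next
      assume *: "0 < r \<and> ?y < r \<or> r < 0 \<and> r < ?y"
      show "\<forall>s. 0 \<le> s \<longrightarrow> s \<le> 1 \<longrightarrow> s * ?y \<noteq> r"
      proof (intro allI impI)
        fix s :: real assume s: "0 \<le> s" "s \<le> 1"
        have "s * ?y \<le> max 0 ?y"
          using s mult_left_le_one_le[of ?y s] mult_nonneg_nonpos[of s ?y] by (cases "0 \<le> ?y") auto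
        moreover have "min 0 ?y \<le> s * ?y"
          using s mult_left_le_one_le[of "- ?y" s] mult_nonneg_nonneg[of s ?y] by (cases "0 \<le> ?y") auto
        ultimately show "s * ?y \<noteq> r" using * by auto
      qed
    qed
    finally show ?thesis .
  qed
  then show ?thesis by blast
qed

lemma half_plane_False_line_of:
  "half_plane False (line_of \<phi> r) = {x. 0 \<le> r \<and> r < x \<bullet> normal_vec \<phi> \<or> r \<le> 0 \<and> x \<bullet> normal_vec \<phi> < r}"
proof -
  have "half_plane False (line_of \<phi> r) = - line_of \<phi> r - half_plane True (line_of \<phi> r)"
    by (auto simp: half_plane_def)
  then show ?thesis
    unfolding half_plane_True_line_of by (simp add: set_eq_iff mem_line_of) linarith
qed

lemma pred_half_plane[measurable]: "Measurable.pred line_space (\<lambda>g. x \<in> half_plane b g)"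
proof (rule pred_line_space)
  show "Measurable.pred (borel \<Otimes>\<^sub>M borel) (\<lambda>p. x \<in> half_plane b (line_of (fst p) (snd p)))"
    by (cases b) (simp_all add: half_plane_True_line_of half_plane_False_line_of inner_normal_vec)
qed

lemma open_half_plane:
  assumes "g \<in> space line_space"
  shows "open (half_plane b g)"
proof -
  obtain \<phi> r where g: "g = line_of \<phi> r" using assms by (rule line_space_cases)
  have "open {x. x \<bullet> normal_vec \<phi> < r}" "open {x. r < x \<bullet> normal_vec \<phi>}"
    using open_halfspace_lt[of "normal_vec \<phi>" r] open_halfspace_gt[of r "normal_vec \<phi>"]
    by (simp_all add: inner_commute)
  then show ?thesis
    by (cases b) (auto simp: g half_plane_True_line_of half_plane_False_line_of Collect_disj_eq Collect_conj_eq)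
qed

text \<open>A line through the origin must be excluded: its \<open>half_plane False\<close> is the
  whole complement of the line.\<close>

lemma convex_half_plane:
  assumes "g \<in> space line_space" "0 \<notin> g"
  shows "convex (half_plane b g)"
proof -
  obtain \<phi> r where g: "g = line_of \<phi> r" using assms(1) by (rule line_space_cases)
  have "r \<noteq> 0" using assms(2) by (simp add: g mem_line_of)
  have "convex {x. x \<bullet> normal_vec \<phi> < r}" "convex {x. r < x \<bullet> normal_vec \<phi>}"
    using convex_halfspace_lt[of "normal_vec \<phi>" r] convex_halfspace_gt[of r "normal_vec \<phi>"]
    by (simp_all add: inner_commute)
  then show ?thesis
    using \<open>r \<noteq> 0\<close>
    by (cases b; cases "0 < r") (simp_all add: g half_plane_True_line_of half_plane_False_line_of)
qed

lemma half_plane_disjoint: "half_plane True g \<inter> half_plane False g = {}"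
  by (auto simp: half_plane_def)

lemma half_plane_Un: "half_plane True g \<union> half_plane False g = - g"
  by (auto simp: half_plane_def)

lemma half_plane_Int_open:
  assumes "g \<in> space line_space" "0 \<notin> g" "open C" "g \<inter> C \<noteq> {}"
  shows "C \<inter> half_plane b g \<noteq> {}"
proof -
  obtain \<phi> r where g: "g = line_of \<phi> r" using assms(1) by (rule line_space_cases)
  have "r \<noteq> 0" using assms(2) by (simp add: g mem_line_of)
  obtain x where x: "x \<in> C" "x \<bullet> normal_vec \<phi> = r" using assms(4) unfolding g disjoint_iff mem_line_of by blast
  obtain d where d: "0 < d" "cball x d \<subseteq> C" using assms(3) x open_contains_cball by blast
  have in_C: "x + c *\<^sub>R normal_vec \<phi> \<in> C" if "\<bar>c\<bar> \<le> d" for c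
    using d that by (intro subsetD[OF d(2)]) (simp add: dist_norm norm_normal_vec)
  have val: "(x + c *\<^sub>R normal_vec \<phi>) \<bullet> normal_vec \<phi> = r + c" for c
    by (simp add: inner_add_left x inner_normal_vec_self)
  have "x + d *\<^sub>R normal_vec \<phi> \<in> C" "x + (- d) *\<^sub>R normal_vec \<phi> \<in> C"
    using in_C[of d] in_C[of "- d"] d by auto
  moreover have "x + d *\<^sub>R normal_vec \<phi> \<in> half_plane b g \<or> x + (- d) *\<^sub>R normal_vec \<phi> \<in> half_plane b g"
    using \<open>r \<noteq> 0\<close> d(1) unfolding g
    by (cases b; cases "0 < r") (simp_all add: half_plane_True_line_of half_plane_False_line_of val del: scaleR_minus_left)
  ultimately show ?thesis by blast
qed

text \<open>Compactness of \<open>K\<close> turns near hits at every scale into a hit. With a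
  countable \<open>T\<close> the right-hand side is a countable condition on the parameters, which
  makes hitting events measurable.\<close>

lemma hitting_iff_dense:
  assumes "compact K" "K \<subseteq> closure T" "T \<subseteq> K"
  shows "line_of \<phi> r \<inter> K \<noteq> {} \<longleftrightarrow> (\<forall>n. \<exists>x\<in>T. \<bar>x \<bullet> normal_vec \<phi> - r\<bar> < 1 / real (Suc n))"
proof
  assume "line_of \<phi> r \<inter> K \<noteq> {}"
  then obtain x where x: "x \<in> K" "x \<bullet> normal_vec \<phi> = r" unfolding disjoint_iff mem_line_of by blast
  show "\<forall>n. \<exists>x\<in>T. \<bar>x \<bullet> normal_vec \<phi> - r\<bar> < 1 / real (Suc n)"
  proof
    fix n
    obtain y where y: "y \<in> T" "dist y x < 1 / real (Suc n)"
      using assms(2) x closure_approachable[of x T] by (metis divide_pos_pos of_nat_0_less_iff subsetD zero_less_Suc zero_less_one)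
    have "\<bar>y \<bullet> normal_vec \<phi> - r\<bar> \<le> norm (y - x) * norm (normal_vec \<phi>)"
      using Cauchy_Schwarz_ineq2[of "y - x" "normal_vec \<phi>"] x by (simp add: inner_diff_left)
    then show "\<exists>x\<in>T. \<bar>x \<bullet> normal_vec \<phi> - r\<bar> < 1 / real (Suc n)"
      using y by (intro bexI[of _ y]) (auto simp: norm_normal_vec dist_norm)
  qed
next
  assume "\<forall>n. \<exists>x\<in>T. \<bar>x \<bullet> normal_vec \<phi> - r\<bar> < 1 / real (Suc n)"
  then obtain X where X: "\<And>n. X n \<in> T" "\<And>n. \<bar>X n \<bullet> normal_vec \<phi> - r\<bar> < 1 / real (Suc n)" by metis
  have "\<forall>n. X n \<in> K" using X assms(3) by auto
  then obtain l s where l: "l \<in> K" "strict_mono s" "(X \<circ> s) \<longlonglongrightarrow> l"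
    using assms(1) unfolding compact_def by metis
  have "(\<lambda>n. X n \<bullet> normal_vec \<phi>) \<longlonglongrightarrow> r"
    using X(2) by (intro LIMSEQ_norm_0[THEN LIM_zero_cancel]) (auto simp: inverse_eq_divide less_imp_le)
  from LIMSEQ_subseq_LIMSEQ[OF this l(2)]
  have "(\<lambda>n. (X \<circ> s) n \<bullet> normal_vec \<phi>) \<longlonglongrightarrow> r" by (simp add: o_def)
  moreover have "(\<lambda>n. (X \<circ> s) n \<bullet> normal_vec \<phi>) \<longlonglongrightarrow> l \<bullet> normal_vec \<phi>"
    using l(3) by (intro tendsto_intros)
  ultimately have "l \<bullet> normal_vec \<phi> = r" by (rule LIMSEQ_unique[rotated])
  then show "line_of \<phi> r \<inter> K \<noteq> {}" using l(1) by (auto simp: mem_line_of)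
qed

lemma sets_hitting_compact[measurable]:
  assumes "compact K"
  shows "hitting K \<in> sets line_space"
proof -
  obtain T where T: "countable T" "T \<subseteq> K" "K \<subseteq> closure T" using separable by blast
  note [measurable] = T(1)
  have "Measurable.pred line_space (\<lambda>g. g \<inter> K \<noteq> {})"
    by (rule pred_line_space) (simp only: hitting_iff_dense[OF assms T(3,2)] inner_normal_vec, measurable)
  then show ?thesis by (simp add: hitting_def pred_def)
qed

lemma line_of_Int_ball: "line_of \<phi> r \<inter> ball x d \<noteq> {} \<longleftrightarrow> \<bar>x \<bullet> normal_vec \<phi> - r\<bar> < d"
proof
  assume "line_of \<phi> r \<inter> ball x d \<noteq> {}"
  then obtain y where y: "y \<bullet> normal_vec \<phi> = r" "dist x y < d"
    unfolding disjoint_iff mem_line_of mem_ball by blast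
  have "\<bar>x \<bullet> normal_vec \<phi> - r\<bar> \<le> norm (x - y) * norm (normal_vec \<phi>)"
    using Cauchy_Schwarz_ineq2[of "x - y" "normal_vec \<phi>"] y by (simp add: inner_diff_left)
  then show "\<bar>x \<bullet> normal_vec \<phi> - r\<bar> < d" using y by (simp add: norm_normal_vec dist_norm)
next
  assume *: "\<bar>x \<bullet> normal_vec \<phi> - r\<bar> < d"
  let ?y = "x + (r - x \<bullet> normal_vec \<phi>) *\<^sub>R normal_vec \<phi>"
  have "?y \<in> line_of \<phi> r" by (simp add: mem_line_of inner_add_left inner_normal_vec_self)
  moreover have "?y \<in> ball x d" using * by (simp add: dist_norm norm_normal_vec)
  ultimately show "line_of \<phi> r \<inter> ball x d \<noteq> {}" by blast
qed

lemma sets_hitting_ball[measurable]: "hitting (ball x d) \<in> sets line_space"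
proof -
  have "Measurable.pred line_space (\<lambda>g. g \<inter> ball x d \<noteq> {})"
    by (rule pred_line_space) (simp only: line_of_Int_ball inner_normal_vec, measurable)
  then show ?thesis by (simp add: hitting_def pred_def)
qed

section \<open>Null sets of lines under a translation-invariant measure\<close>

lemma translate_line_of: "(+) a ` line_of \<phi> r = line_of \<phi> (r + a \<bullet> normal_vec \<phi>)"
proof safe
  fix x assume "x \<in> line_of \<phi> (r + a \<bullet> normal_vec \<phi>)"
  then have "x - a \<in> line_of \<phi> r" by (simp add: mem_line_of inner_diff_left)
  then show "x \<in> (+) a ` line_of \<phi> r" by (intro image_eqI[of _ _ "x - a"]) auto
qed (simp add: mem_line_of inner_add_left)

lemma translate_hitting: "(\<lambda>g. (+) a ` g) ` hitting A = hitting ((+) a ` A)"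
proof (intro set_eqI iffI)
  fix h assume "h \<in> (\<lambda>g. (+) a ` g) ` hitting A"
  then obtain g where g: "h = (+) a ` g" "g \<in> space line_space" "g \<inter> A \<noteq> {}" by (auto simp: hitting_def)
  obtain \<phi> r where "\<phi> \<in> {0..<pi}" "g = line_of \<phi> r" using g(2) by (rule line_space_cases)
  then have "h \<in> space line_space" by (simp add: g translate_line_of line_of_space)
  then show "h \<in> hitting ((+) a ` A)" using g by (auto simp: hitting_def)
next
  fix h assume h: "h \<in> hitting ((+) a ` A)"
  then have "h \<in> space line_space" by (simp add: hitting_def)
  then obtain \<phi> r where \<phi>: "\<phi> \<in> {0..<pi}" "h = line_of \<phi> r" by (rule line_space_cases)
  let ?g = "line_of \<phi> (r - a \<bullet> normal_vec \<phi>)"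
  have eq: "h = (+) a ` ?g" by (simp add: \<phi> translate_line_of)
  moreover have "?g \<in> hitting A"
    using h \<phi>(1) by (auto simp: hitting_def eq line_of_space)
  ultimately show "h \<in> (\<lambda>g. (+) a ` g) ` hitting A" by blast
qed

lemma graph_in_sets:
  assumes [measurable]: "h \<in> borel_measurable borel" "Measurable.pred borel P"
  shows "{line_of \<phi> (h \<phi>) | \<phi>. \<phi> \<in> {0..<pi} \<and> P \<phi>} \<in> sets line_space"
proof -
  have "{p \<in> space (borel \<Otimes>\<^sub>M borel). snd p = h (fst p) \<and> P (fst p)} \<in> sets (borel \<Otimes>\<^sub>M borel)"
    by measurable
  then have "{p :: real \<times> real. snd p = h (fst p) \<and> P (fst p)} \<in> sets borel"
    unfolding borel_prod by simp
  then have "{p :: real \<times> real. snd p = h (fst p) \<and> P (fst p)} \<inter> ({0..<pi} \<times> UNIV) \<in>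
      sets (restrict_space borel ({0..<pi} \<times> UNIV))"
    by (auto simp: sets_restrict_space)
  from in_sets_embed_measure[OF this, of "\<lambda>(\<phi>, r). line_of \<phi> r"]
  show ?thesis
    unfolding line_space_def[symmetric]
    by (rule back_subst[of "\<lambda>A. A \<in> sets line_space"]) force
qed

text \<open>
  Translations by \<open>a / n\<close> shift the graph of \<open>h\<close> by \<open>(a \<bullet> normal_vec \<phi>) / n\<close>. Wherever
  \<open>a\<close> is not parallel to the lines, this gives infinitely many disjoint sets of equal measure, all of
  which hit a common compact set.
\<close>

lemma emeasure_graph_direction:
  assumes \<Lambda>: "sets \<Lambda> = sets line_space" "locally_finite \<Lambda>" "translation_invariant \<Lambda>"
    and h: "h \<in> borel_measurable borel" "\<And>\<phi>. \<phi> \<in> {0..<pi} \<Longrightarrow> \<bar>h \<phi>\<bar> \<le> B"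
  shows "emeasure \<Lambda> {line_of \<phi> (h \<phi>) | \<phi>. \<phi> \<in> {0..<pi} \<and> a \<bullet> normal_vec \<phi> \<noteq> 0} = 0"
proof -
  let ?P = "\<lambda>\<phi>. a \<bullet> normal_vec \<phi> \<noteq> 0"
  define A where "A = {line_of \<phi> (h \<phi>) | \<phi>. \<phi> \<in> {0..<pi} \<and> ?P \<phi>}"
  define T where "T n = {line_of \<phi> (h \<phi> + (a \<bullet> normal_vec \<phi>) / real (Suc n)) | \<phi>. \<phi> \<in> {0..<pi} \<and> ?P \<phi>}" for n
  have A: "A \<in> sets line_space"
    unfolding A_def inner_normal_vec by (rule graph_in_sets[OF h(1)]) measurable
  have T: "T n \<in> sets line_space" for n
    unfolding T_def inner_normal_vec by (rule graph_in_sets) (use h(1) in measurable)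
  have "(\<lambda>g. (+) ((1 / real (Suc n)) *\<^sub>R a) ` g) ` A = T n" for n
  proof -
    have "(\<lambda>g. (+) b ` g) ` A = {(+) b ` line_of \<phi> (h \<phi>) | \<phi>. \<phi> \<in> {0..<pi} \<and> ?P \<phi>}" for b
      unfolding A_def by blast
    then show ?thesis by (simp add: T_def translate_line_of del: of_nat_Suc)
  qed
  then have eq: "emeasure \<Lambda> (T n) = emeasure \<Lambda> A" for n
    using \<Lambda>(3) A unfolding translation_invariant_def by metis
  have disj: "disjoint_family T"
  unfolding disjoint_family_on_def
  proof (intro ballI impI)
    fix m n :: nat assume "m \<noteq> n"
    show "T m \<inter> T n = {}"
    proof (rule ccontr)
      assume "T m \<inter> T n \<noteq> {}"
      then obtain \<phi> \<psi> where *: "\<phi> \<in> {0..<pi}" "\<psi> \<in> {0..<pi}" "?P \<phi>"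
        "line_of \<phi> (h \<phi> + (a \<bullet> normal_vec \<phi>) / real (Suc m)) = line_of \<psi> (h \<psi> + (a \<bullet> normal_vec \<psi>) / real (Suc n))"
        unfolding T_def by blast
      from line_of_inj[OF *(4,1,2)] *(3) \<open>m \<noteq> n\<close> show False by (auto simp: field_simps)
    qed
  qed
  have "(\<Union>n. T n) \<subseteq> hitting (cball 0 (B + norm a))"
  proof safe
    fix g n assume "g \<in> T n"
    then obtain \<phi> where \<phi>: "\<phi> \<in> {0..<pi}" "g = line_of \<phi> (h \<phi> + (a \<bullet> normal_vec \<phi>) / real (Suc n))"
      unfolding T_def by blast
    let ?r = "h \<phi> + (a \<bullet> normal_vec \<phi>) / real (Suc n)"
    have "\<bar>a \<bullet> normal_vec \<phi>\<bar> \<le> norm a"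
      using Cauchy_Schwarz_ineq2[of a "normal_vec \<phi>"] by (simp add: norm_normal_vec)
    moreover have "\<bar>(a \<bullet> normal_vec \<phi>) / real (Suc n)\<bar> \<le> \<bar>a \<bullet> normal_vec \<phi>\<bar>"
      by (simp add: abs_divide divide_le_eq mult_left_le mult_le_cancel_left1)
    ultimately have "\<bar>?r\<bar> \<le> B + norm a" using h(2)[OF \<phi>(1)] by linarith
    moreover have "?r *\<^sub>R normal_vec \<phi> \<in> g"
      unfolding \<phi>(2) mem_line_of inner_scaleR_left inner_normal_vec_self by simp
    ultimately show "g \<in> hitting (cball 0 (B + norm a))"
      using \<phi> line_of_space[OF \<phi>(1)] by (auto simp: hitting_def norm_normal_vec disjoint_iff intro!: exI[of _ "?r *\<^sub>R normal_vec \<phi>"])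
  qed
  then have "emeasure \<Lambda> (\<Union>n. T n) < \<infinity>"
    using \<Lambda>(2) sets_hitting_compact[OF compact_cball] unfolding locally_finite_def
    by (metis \<Lambda>(1) compact_cball emeasure_mono order_le_less_trans)
  moreover have "(\<Sum>n. emeasure \<Lambda> (T n)) = emeasure \<Lambda> (\<Union>n. T n)"
    using T disj \<Lambda>(1) by (intro suminf_emeasure) auto
  ultimately have "(\<Sum>n :: nat. emeasure \<Lambda> A) < \<infinity>" by (simp add: eq)
  then have "emeasure \<Lambda> A = 0"
  proof (rule contrapos_pp)
    assume "emeasure \<Lambda> A \<noteq> 0"
    then have "top = emeasure \<Lambda> A * (SUP n. of_nat n)"
      by (simp add: ennreal_SUP_of_nat_eq_top ennreal_mult_top)
    also have "\<dots> = (SUP n. emeasure \<Lambda> A * of_nat n)"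
      by (rule SUP_mult_left_ennreal)
    also have "\<dots> \<le> (\<Sum>n :: nat. emeasure \<Lambda> A)"
      using sum_le_suminf[of "\<lambda>_ :: nat. emeasure \<Lambda> A" "{..<n}" for n]
      by (intro SUP_least) (simp add: mult.commute)
    finally show "\<not> (\<Sum>n :: nat. emeasure \<Lambda> A) < \<infinity>" by (simp add: top_unique)
  qed
  then show ?thesis by (simp add: A_def)
qed

text \<open>Shifting along a single \<open>a\<close> says nothing about the angles whose normal is
  orthogonal to \<open>a\<close>. No normal is orthogonal to both coordinate vectors, so two shifts
  suffice.\<close>

lemma graph_null:
  assumes \<Lambda>: "sets \<Lambda> = sets line_space" "locally_finite \<Lambda>" "translation_invariant \<Lambda>"
    and h: "h \<in> borel_measurable borel" "\<And>\<phi>. \<phi> \<in> {0..<pi} \<Longrightarrow> \<bar>h \<phi>\<bar> \<le> B"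
  shows "{line_of \<phi> (h \<phi>) | \<phi>. \<phi> \<in> {0..<pi}} \<in> null_sets \<Lambda>"
proof -
  let ?N = "\<lambda>a. {line_of \<phi> (h \<phi>) | \<phi>. \<phi> \<in> {0..<pi} \<and> a \<bullet> normal_vec \<phi> \<noteq> 0}"
  have "?N a \<in> null_sets \<Lambda>" for a
  proof (rule null_setsI[OF emeasure_graph_direction[OF \<Lambda> h]])
    show "?N a \<in> sets \<Lambda>"
      unfolding \<Lambda>(1) inner_normal_vec by (rule graph_in_sets[OF h(1)]) measurable
  qed auto
  then have "?N (vector [1, 0]) \<union> ?N (vector [0, 1]) \<in> null_sets \<Lambda>" by auto
  moreover have "{line_of \<phi> (h \<phi>) | \<phi>. \<phi> \<in> {0..<pi}} = ?N (vector [1, 0]) \<union> ?N (vector [0, 1])"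
  proof -
    have "vector [1, 0] \<bullet> normal_vec \<phi> \<noteq> 0 \<or> vector [0, 1] \<bullet> normal_vec \<phi> \<noteq> 0" for \<phi>
      using sin_zero_abs_cos_one[of \<phi>] by (auto simp: inner_normal_vec vector_2)
    then show ?thesis by blast
  qed
  ultimately show ?thesis by simp
qed

lemma AE_not_through_origin:
  assumes "sets \<Lambda> = sets line_space" "locally_finite \<Lambda>" "translation_invariant \<Lambda>"
  shows "AE g in \<Lambda>. 0 \<notin> g"
proof (rule AE_I')
  show "{line_of \<phi> 0 | \<phi>. \<phi> \<in> {0..<pi}} \<in> null_sets \<Lambda>"
    using graph_null[OF assms, of "\<lambda>_. 0" 0] by simp
  have "space \<Lambda> = space line_space" using assms(1) by (rule sets_eq_imp_space_eq)
  then show "{g \<in> space \<Lambda>. \<not> 0 \<notin> g} \<subseteq> {line_of \<phi> 0 | \<phi>. \<phi> \<in> {0..<pi}}"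
    by (auto elim!: line_space_cases simp: mem_line_of)
qed

text \<open>A line that meets the closure of a convex set but not the set itself is a supporting
  line. For every angle there are at most two, with offsets given by the support function in both
  directions of the normal, hence they lie on two graphs over the angle.\<close>

lemma AE_hit_closure:
  assumes \<Lambda>: "sets \<Lambda> = sets line_space" "locally_finite \<Lambda>" "translation_invariant \<Lambda>"
    and C: "convex C" "bounded C"
  shows "AE g in \<Lambda>. g \<inter> closure C \<noteq> {} \<longrightarrow> g \<inter> C \<noteq> {}"
proof (cases "C = {}")
  case False
  obtain T where T: "countable T" "T \<subseteq> C" "C \<subseteq> closure T" using separable by blast
  have "T \<noteq> {}" using T False by auto
  obtain B where B: "\<And>x. x \<in> C \<Longrightarrow> norm x \<le> B" using C(2) by (auto simp: bounded_iff)
  have le: "\<bar>x \<bullet> normal_vec \<phi>\<bar> \<le> B" if "x \<in> T" for x \<phi>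
    using Cauchy_Schwarz_ineq2[of x "normal_vec \<phi>"] B[of x] T(2) that by (auto simp: norm_normal_vec)
  have bdd: "bdd_above ((\<lambda>x. c * (x \<bullet> normal_vec \<phi>)) ` T)" if "\<bar>c\<bar> = 1" for c \<phi>
    using le that by (intro bdd_aboveI2[of _ _ B]) (metis abs_le_D1 abs_mult mult_1)
  \<comment> \<open>Support function of \<open>C\<close>, with \<open>c\<close> = 1 or -1 choosing
    the direction of the normal. The supremum is taken over the countable dense \<open>T\<close> to
    obtain measurability in the angle.\<close>
  define h where "h c \<phi> = (SUP x\<in>T. c * (x \<bullet> normal_vec \<phi>))" for c \<phi> :: real
  have h_meas: "h c \<in> borel_measurable borel" if "\<bar>c\<bar> = 1" for c
    unfolding h_def using T(1) bdd[OF that]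
    by (intro borel_measurable_cSUP) (auto simp: inner_normal_vec)
  have h_le: "\<bar>h c \<phi>\<bar> \<le> B" if "\<bar>c\<bar> = 1" for c \<phi>
    unfolding h_def using le \<open>T \<noteq> {}\<close> that
    by (intro cSup_abs_le) (auto simp: abs_mult)
  have null: "{line_of \<phi> (c * h c \<phi>) | \<phi>. \<phi> \<in> {0..<pi}} \<in> null_sets \<Lambda>" if "\<bar>c\<bar> = 1" for c
    using h_meas[OF that] h_le[OF that] that by (intro graph_null[OF \<Lambda>, of _ B]) (auto simp: abs_mult)
  show ?thesis
  proof (rule AE_I')
    show "{line_of \<phi> (1 * h 1 \<phi>) | \<phi>. \<phi> \<in> {0..<pi}} \<union> {line_of \<phi> (- 1 * h (- 1) \<phi>) | \<phi>. \<phi> \<in> {0..<pi}} \<in> null_sets \<Lambda>"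
      using null[of 1] null[of "- 1"] by (intro null_sets.Un) auto
    show "{g \<in> space \<Lambda>. \<not> (g \<inter> closure C \<noteq> {} \<longrightarrow> g \<inter> C \<noteq> {})} \<subseteq>
      {line_of \<phi> (1 * h 1 \<phi>) | \<phi>. \<phi> \<in> {0..<pi}} \<union> {line_of \<phi> (- 1 * h (- 1) \<phi>) | \<phi>. \<phi> \<in> {0..<pi}}"
    proof
      fix g assume "g \<in> {g \<in> space \<Lambda>. \<not> (g \<inter> closure C \<noteq> {} \<longrightarrow> g \<inter> C \<noteq> {})}"
      then have g: "g \<in> space line_space" "g \<inter> closure C \<noteq> {}" "g \<inter> C = {}"
        using sets_eq_imp_space_eq[OF \<Lambda>(1)] by auto
      obtain \<phi> r where \<phi>: "\<phi> \<in> {0..<pi}" "g = line_of \<phi> r" using g(1) by (rule line_space_cases)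
      obtain y where y: "y \<in> closure C" "y \<bullet> normal_vec \<phi> = r"
        using g(2) unfolding \<phi> disjoint_iff mem_line_of by blast
      have ne: "x \<bullet> normal_vec \<phi> \<noteq> r" if "x \<in> C" for x
        using g(3) that unfolding \<phi> disjoint_iff mem_line_of by blast
      have "connected ((\<lambda>x. x \<bullet> normal_vec \<phi>) ` C)"
        using C(1) by (intro connected_continuous_image continuous_intros convex_connected)
      then have "(\<forall>x\<in>C. x \<bullet> normal_vec \<phi> < r) \<or> (\<forall>x\<in>C. r < x \<bullet> normal_vec \<phi>)"
        unfolding connected_iff_interval using ne by (smt (verit, best) image_iff)
      \<comment> \<open>By connectedness \<open>C\<close> lies strictly on one side of the line;
        \<open>c\<close> is the sign that makes it the lower side.\<close>
      then obtain c where c: "\<bar>c\<bar> = 1" "\<And>x. x \<in> C \<Longrightarrow> c * (x \<bullet> normal_vec \<phi>) < c * r" "c = 1 \<or> c = - 1"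
        by (metis abs_minus_cancel abs_one minus_less_iff minus_minus mult_1 mult_minus_left)
      have "h c \<phi> \<le> c * r"
        unfolding h_def using T(2) c(2) \<open>T \<noteq> {}\<close> by (intro cSUP_least) (auto intro: less_imp_le)
      moreover have "c * r \<le> h c \<phi>"
      proof -
        have "T \<subseteq> {x. c * (x \<bullet> normal_vec \<phi>) \<le> h c \<phi>}"
          unfolding h_def using bdd[OF c(1)] by (auto intro: cSUP_upper)
        moreover have "closed {x. c * (x \<bullet> normal_vec \<phi>) \<le> h c \<phi>}"
          by (intro closed_Collect_le continuous_intros)
        ultimately have "closure T \<subseteq> {x. c * (x \<bullet> normal_vec \<phi>) \<le> h c \<phi>}" by (rule closure_minimal)
        moreover have "closure C \<subseteq> closure T" using T(3) by (simp add: closure_minimal)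
        ultimately show ?thesis using y by auto
      qed
      ultimately have "r = c * h c \<phi>" using c(3) by auto
      then show "g \<in> {line_of \<phi> (1 * h 1 \<phi>) | \<phi>. \<phi> \<in> {0..<pi}} \<union> {line_of \<phi> (- 1 * h (- 1) \<phi>) | \<phi>. \<phi> \<in> {0..<pi}}"
        using c(3) \<phi> by auto
    qed
  qed
qed simp

text \<open>If the lines hitting one ball were a null set, so would be those hitting any translate
  of it, and countably many translates already catch every line.\<close>

lemma emeasure_hitting_ball_pos:
  assumes \<Lambda>: "sets \<Lambda> = sets line_space" "translation_invariant \<Lambda>" "emeasure \<Lambda> (space \<Lambda>) \<noteq> 0"
    and d: "0 < d"
  shows "0 < emeasure \<Lambda> (hitting (ball x d))"
proof (rule ccontr)
  assume "\<not> 0 < emeasure \<Lambda> (hitting (ball x d))"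
  then have 0: "emeasure \<Lambda> (hitting (ball x d)) = 0" by simp
  have "emeasure \<Lambda> (hitting (ball y d)) = 0" for y
  proof -
    have "hitting (ball y d) = (\<lambda>g. (+) (y - x) ` g) ` hitting (ball x d)"
      unfolding translate_hitting by (simp add: image_add_ball)
    then show ?thesis
      using \<Lambda>(2) sets_hitting_ball 0 unfolding translation_invariant_def by metis
  qed
  then have "hitting (ball y d) \<in> null_sets \<Lambda>" for y using \<Lambda>(1) by (auto intro: null_setsI)
  moreover obtain D :: "(real^2) set" where D: "countable D" "\<And>X. open X \<Longrightarrow> X \<noteq> {} \<Longrightarrow> \<exists>d\<in>D. d \<in> X"
    using countable_dense_setE by blast
  ultimately have "(\<Union>y\<in>D. hitting (ball y d)) \<in> null_sets \<Lambda>" by (intro null_sets_UN') auto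
  moreover have "(\<Union>y\<in>D. hitting (ball y d)) = space \<Lambda>"
  proof (intro set_eqI iffI)
    fix g assume "g \<in> space \<Lambda>"
    then have g: "g \<in> space line_space" using sets_eq_imp_space_eq[OF \<Lambda>(1)] by simp
    obtain \<phi> r where \<phi>: "\<phi> \<in> {0..<pi}" "g = line_of \<phi> r" using g by (rule line_space_cases)
    let ?z = "r *\<^sub>R normal_vec \<phi>"
    have z: "?z \<in> g" by (simp add: \<phi> mem_line_of inner_normal_vec_self)
    obtain y where "y \<in> D" "y \<in> ball ?z d" using D(2)[of "ball ?z d"] d by auto
    then show "g \<in> (\<Union>y\<in>D. hitting (ball y d))"
      using z g by (auto simp: hitting_def dist_commute disjoint_iff)
  qed (use sets_eq_imp_space_eq[OF \<Lambda>(1)] in \<open>auto simp: hitting_def\<close>)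
  ultimately show False using \<Lambda>(3) by auto
qed

section \<open>The space of open cells\<close>

text \<open>
  Cells are represented by open sets, so that all events about a cell are determined by the points
  of a countable dense set. The cells of a STIT process are the closures of these open cells, and a
  quasi-cell agrees with its open cell away from the boundary of \<open>W\<close>.
\<close>

definition cell_space :: "(real^2) set \<Rightarrow> (real^2) set measure" where
  "cell_space W = sigma {C. open C \<and> C \<subseteq> interior W} {{C. open C \<and> C \<subseteq> interior W \<and> x \<in> C} | x. True}"

definition cell_split :: "bool \<Rightarrow> (real^2) set \<Rightarrow> (real^2) set \<Rightarrow> (real^2) set" where
  "cell_split b C g = C \<inter> half_plane b g"

text \<open>Stated through both halves instead of the line itself: then an actual hit always leaves
  two nonempty halves, and measurability reduces to nonemptiness of open sets. For convex open cells
  it differs from meeting the line only for lines through the origin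
  (\<open>cell_hit_iff\<close>).\<close>

definition cell_hit :: "(real^2) set \<Rightarrow> (real^2) set \<Rightarrow> bool" where
  "cell_hit C g \<longleftrightarrow> C \<inter> half_plane True g \<noteq> {} \<and> C \<inter> half_plane False g \<noteq> {}"

lemma space_cell_space: "space (cell_space W) = {C. open C \<and> C \<subseteq> interior W}"
  unfolding cell_space_def by (rule space_measure_of) auto

lemma pred_mem_cell[measurable]: "Measurable.pred (cell_space W) (\<lambda>C. x \<in> C)"
proof -
  have "{C. open C \<and> C \<subseteq> interior W \<and> x \<in> C} \<in> sets (cell_space W)"
    unfolding cell_space_def by (subst sets_measure_of) auto
  then show ?thesis by (simp add: pred_def space_cell_space conj_assoc)
qed

lemma measurable_cell_space:
  assumes "\<And>w. w \<in> space N \<Longrightarrow> open (X w) \<and> X w \<subseteq> interior W"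
    and "\<And>x. Measurable.pred N (\<lambda>w. x \<in> X w)"
  shows "X \<in> N \<rightarrow>\<^sub>M cell_space W"
  unfolding cell_space_def
proof (rule measurable_measure_of)
  fix A assume "A \<in> {{C. open C \<and> C \<subseteq> interior W \<and> x \<in> C} | x. True}"
  then obtain x where A: "A = {C. open C \<and> C \<subseteq> interior W \<and> x \<in> C}" by blast
  have "X -` A \<inter> space N = {w \<in> space N. x \<in> X w}" using assms(1) by (auto simp: A)
  then show "X -` A \<inter> space N \<in> sets N" using assms(2)[of x] by (simp add: pred_def)
qed (use assms(1) in auto)

lemma countable_dense_plane:
  obtains D :: "(real^2) set" where "countable D" "\<And>X. open X \<Longrightarrow> X \<noteq> {} \<Longrightarrow> \<exists>d\<in>D. d \<in> X"
  using countable_dense_setE by blast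

lemma pred_nonempty:
  fixes X :: "'a \<Rightarrow> (real^2) set"
  assumes "\<And>w. w \<in> space N \<Longrightarrow> open (X w)" "\<And>x. Measurable.pred N (\<lambda>w. x \<in> X w)"
  shows "Measurable.pred N (\<lambda>w. X w \<noteq> {})"
proof -
  obtain D :: "(real^2) set" where D: "countable D" "\<And>X. open X \<Longrightarrow> X \<noteq> {} \<Longrightarrow> \<exists>d\<in>D. d \<in> X"
    using countable_dense_plane by blast
  note [measurable] = D(1) assms(2)
  have "Measurable.pred N (\<lambda>w. \<exists>d\<in>D. d \<in> X w)" by measurable
  moreover have "X w \<noteq> {} \<longleftrightarrow> (\<exists>d\<in>D. d \<in> X w)" if "w \<in> space N" for w
    using D(2)[OF assms(1)[OF that]] by auto
  ultimately show ?thesis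
    using measurable_cong[of N "\<lambda>w. X w \<noteq> {}" "\<lambda>w. \<exists>d\<in>D. d \<in> X w"] by blast
qed

lemma open_Int_half_plane: "open C \<Longrightarrow> g \<in> space line_space \<Longrightarrow> open (C \<inter> half_plane b g)"
  by (rule open_Int[OF _ open_half_plane])

lemma cell_split_measurable:
  "(\<lambda>p. cell_split b (fst p) (snd p)) \<in> cell_space W \<Otimes>\<^sub>M line_space \<rightarrow>\<^sub>M cell_space W"
  unfolding cell_split_def
  by (rule measurable_cell_space) (auto simp: space_pair_measure space_cell_space intro: open_Int_half_plane)

lemma cell_hit_measurable:
  "Measurable.pred (cell_space W \<Otimes>\<^sub>M line_space) (\<lambda>p. cell_hit (fst p) (snd p))"
proof -
  have [measurable]: "Measurable.pred (cell_space W \<Otimes>\<^sub>M line_space) (\<lambda>p. fst p \<inter> half_plane b (snd p) \<noteq> {})" for b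
    by (rule pred_nonempty) (auto simp: space_pair_measure space_cell_space intro: open_Int_half_plane)
  show ?thesis unfolding cell_hit_def by measurable
qed

text \<open>A convex cell missed by the line is connected and cannot have points in both disjoint
  open halves; an open cell met by the line contains points slightly off it on either side.\<close>

lemma cell_hit_iff:
  assumes "g \<in> space line_space" "0 \<notin> g" "open C" "convex C"
  shows "cell_hit C g \<longleftrightarrow> g \<inter> C \<noteq> {}"
proof
  assume hit: "cell_hit C g"
  show "g \<inter> C \<noteq> {}"
  proof
    assume "g \<inter> C = {}"
    then have "C \<subseteq> half_plane True g \<union> half_plane False g" by (auto simp: half_plane_Un)
    with hit show False
      using convex_connected[OF assms(4)] open_half_plane[OF assms(1)] half_plane_disjoint[of g]
      unfolding cell_hit_def connected_def by blast
  qed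
qed (use half_plane_Int_open[OF assms(1-3)] in \<open>auto simp: cell_hit_def\<close>)

lemma cell_hit_mono: "cell_hit C g \<Longrightarrow> C \<subseteq> D \<Longrightarrow> cell_hit D g"
  unfolding cell_hit_def by blast

section \<open>The line measure as an instance of cell splitting\<close>

locale line_measure =
  fixes W :: "(real^2) set" and \<Lambda> :: "(real^2) set measure"
  assumes convex_W: "convex W" and compact_W: "compact W" and interior_W: "interior W \<noteq> {}"
    and sets_\<Lambda>: "sets \<Lambda> = sets line_space"
    and nonzero_\<Lambda>: "emeasure \<Lambda> (space \<Lambda>) \<noteq> 0"
    and locally_finite_\<Lambda>: "locally_finite \<Lambda>"
    and translation_invariant_\<Lambda>: "translation_invariant \<Lambda>"
begin

definition \<mu> :: "(real^2) set measure" where "\<mu> = uniform_measure \<Lambda> (hitting W)"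

definition rate :: real where "rate = measure \<Lambda> (hitting W)"

lemma space_\<Lambda>: "space \<Lambda> = space line_space"
  using sets_\<Lambda> by (rule sets_eq_imp_space_eq)

lemma sets_\<mu>[measurable_cong]: "sets \<mu> = sets line_space"
  by (simp add: \<mu>_def sets_\<Lambda>)

lemma space_\<mu>: "space \<mu> = space line_space"
  using sets_\<mu> by (rule sets_eq_imp_space_eq)

lemma hitting_W: "hitting W \<in> sets \<Lambda>"
  using sets_hitting_compact[OF compact_W] by (simp add: sets_\<Lambda>)

lemma emeasure_hitting_W: "0 < emeasure \<Lambda> (hitting W)" "emeasure \<Lambda> (hitting W) < \<infinity>"
proof -
  obtain x d where "0 < d" "ball x d \<subseteq> interior W"
    using interior_W open_interior by (metis equals0I openE)
  then have "hitting (ball x d) \<subseteq> hitting W" using interior_subset by (auto simp: hitting_def)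
  then show "0 < emeasure \<Lambda> (hitting W)"
    using emeasure_hitting_ball_pos[OF sets_\<Lambda> translation_invariant_\<Lambda> nonzero_\<Lambda> \<open>0 < d\<close>, of x] hitting_W
    by (metis emeasure_mono order_less_le_trans)
  show "emeasure \<Lambda> (hitting W) < \<infinity>"
    using locally_finite_\<Lambda> compact_W by (simp add: locally_finite_def)
qed

lemma emeasure_eq_rate: "emeasure \<Lambda> (hitting W) = ennreal rate"
  using emeasure_hitting_W(2) by (simp add: rate_def emeasure_eq_ennreal_measure)

lemma rate_pos: "0 < rate"
  using emeasure_hitting_W(1) by (simp add: emeasure_eq_rate)

lemma emeasure_\<mu>: "A \<in> sets line_space \<Longrightarrow> emeasure \<mu> A = emeasure \<Lambda> (hitting W \<inter> A) / ennreal rate"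
  using hitting_W by (simp add: \<mu>_def sets_\<Lambda> emeasure_eq_rate)

lemma AE_\<mu>I: "AE g in \<Lambda>. P g \<Longrightarrow> AE g in \<mu>. P g"
  unfolding \<mu>_def using hitting_W by (intro AE_uniform_measureI) auto

lemma AE_\<Lambda>_origin: "AE g in \<Lambda>. 0 \<notin> g"
  using sets_\<Lambda> locally_finite_\<Lambda> translation_invariant_\<Lambda> by (rule AE_not_through_origin)

text \<open>\<open>C\<close> is arbitrary here, so the connectedness argument is made for the convex
  set \<open>W\<close>, which is separated by the line as soon as \<open>C\<close> is.\<close>

lemma AE_cell_hit_hitting:
  assumes "C \<subseteq> W"
  shows "AE g in \<Lambda>. cell_hit C g \<longrightarrow> g \<in> hitting W"
  using AE_\<Lambda>_origin AE_space
proof eventually_elim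
  case (elim g)
  have g: "g \<in> space line_space" using elim space_\<Lambda> by simp
  show ?case
  proof
    assume "cell_hit C g"
    then have hit: "cell_hit W g" using assms by (rule cell_hit_mono)
    have "g \<inter> W \<noteq> {}"
    proof
      assume "g \<inter> W = {}"
      then have "W \<subseteq> half_plane True g \<union> half_plane False g" by (auto simp: half_plane_Un)
      with hit show False
        using convex_connected[OF convex_W] open_half_plane[OF g] half_plane_disjoint[of g]
        unfolding cell_hit_def connected_def by blast
    qed
    then show "g \<in> hitting W" using g by (simp add: hitting_def)
  qed
qed

lemma cell_hit_sets: "open C \<Longrightarrow> {g \<in> space line_space. cell_hit C g} \<in> sets line_space"
proof -
  assume C: "open C"
  have [measurable]: "Measurable.pred line_space (\<lambda>g. C \<inter> half_plane b g \<noteq> {})" for b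
  proof (rule pred_nonempty)
    show "open (C \<inter> half_plane b g)" if "g \<in> space line_space" for g
      using C that by (rule open_Int_half_plane)
    show "Measurable.pred line_space (\<lambda>g. x \<in> C \<inter> half_plane b g)" for x
      unfolding Int_iff by measurable
  qed
  show ?thesis unfolding cell_hit_def by measurable
qed

text \<open>The law \<open>\<mu>\<close> is conditioned on hitting \<open>W\<close>, but almost all
  lines that hit a cell hit \<open>W\<close> anyway. So the same reference law \<open>\<mu>\<close>
  can be used for every cell, with the constant factor \<open>rate\<close>.\<close>

lemma emeasure_\<mu>_cell_hit:
  assumes "open C" "C \<subseteq> W" "D \<in> sets line_space"
  shows "emeasure \<mu> ({g \<in> space line_space. cell_hit C g} \<inter> D) =
    emeasure \<Lambda> ({g \<in> space line_space. cell_hit C g} \<inter> D) / ennreal rate"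
proof -
  have "emeasure \<Lambda> (hitting W \<inter> ({g \<in> space line_space. cell_hit C g} \<inter> D)) =
      emeasure \<Lambda> ({g \<in> space line_space. cell_hit C g} \<inter> D)"
  proof (rule emeasure_eq_AE)
    show "AE g in \<Lambda>. g \<in> hitting W \<inter> ({g \<in> space line_space. cell_hit C g} \<inter> D) \<longleftrightarrow>
        g \<in> {g \<in> space line_space. cell_hit C g} \<inter> D"
      using AE_cell_hit_hitting[OF assms(2)] by eventually_elim auto
  qed (use cell_hit_sets[OF assms(1)] assms(3) hitting_W in \<open>simp_all add: sets_\<Lambda>\<close>)
  then show ?thesis using cell_hit_sets[OF assms(1)] assms(3) by (simp add: emeasure_\<mu>)
qed

lemma pair_eq: "cell_space W \<Otimes>\<^sub>M \<mu> \<rightarrow>\<^sub>M X = cell_space W \<Otimes>\<^sub>M line_space \<rightarrow>\<^sub>M X"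
  by (intro measurable_cong_sets sets_pair_measure_cong refl sets_\<mu>)

sublocale cell_splitting "cell_space W" \<mu> cell_split cell_hit "{}" rate
proof (rule cell_splitting.intro)
  show "prob_space \<mu>"
    unfolding \<mu>_def using emeasure_hitting_W by (intro prob_space_uniform_measure) auto
  show "(\<lambda>p. cell_split b (fst p) (snd p)) \<in> cell_space W \<Otimes>\<^sub>M \<mu> \<rightarrow>\<^sub>M cell_space W" for b
    unfolding pair_eq by (rule cell_split_measurable)
  show "Measurable.pred (cell_space W \<Otimes>\<^sub>M \<mu>) (\<lambda>p. cell_hit (fst p) (snd p))"
    unfolding pair_eq by (rule cell_hit_measurable)
  show "{} \<in> space (cell_space W)" by (simp add: space_cell_space)
  show "cell_split b {} g = {}" for b g by (simp add: cell_split_def)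
  show "cell_hit C g \<Longrightarrow> cell_split b C g \<noteq> {}" for C g b
    by (cases b) (simp_all add: cell_hit_def cell_split_def)
  show "0 < rate" by (rule rate_pos)
next
  fix C assume "C \<in> space (cell_space W)"
  then have C: "open C" "C \<subseteq> interior W" by (auto simp: space_cell_space)
  show "AE g in \<mu>. \<not> cell_hit C g \<longrightarrow> {cell_split True C g, cell_split False C g} = {C, {}}"
    using AE_\<mu>I[OF AE_\<Lambda>_origin] AE_space
  proof eventually_elim
    case (elim g)
    show ?case
    proof
      assume no: "\<not> cell_hit C g"
      then have "g \<inter> C = {}"
        using half_plane_Int_open[of g C] elim C(1) unfolding cell_hit_def space_\<mu> by blast
      then have sub: "C \<subseteq> half_plane True g \<union> half_plane False g"
        using half_plane_Un[of g] by blast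
      consider "C \<inter> half_plane True g = {}" | "C \<inter> half_plane False g = {}"
        using no unfolding cell_hit_def by blast
      then show "{cell_split True C g, cell_split False C g} = {C, {}}"
      proof cases
        case 1
        then have "C \<inter> half_plane False g = C" using sub by blast
        with 1 show ?thesis by (simp add: cell_split_def insert_commute)
      next
        case 2
        then have "C \<inter> half_plane True g = C" using sub by blast
        with 2 show ?thesis by (simp add: cell_split_def)
      qed
    qed
  qed
  assume "C \<noteq> {}"
  \<comment> \<open>Positivity comes from a ball inside the cell: almost every line that meets the
    ball hits the cell.\<close>
  then obtain x d where d: "0 < d" "ball x d \<subseteq> C" using C(1) by (metis equals0I openE)
  let ?H = "{g \<in> space line_space. cell_hit C g}"
  have "emeasure \<Lambda> (hitting (ball x d)) \<le> emeasure \<Lambda> ?H"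
  proof (rule emeasure_mono_AE)
    show "AE g in \<Lambda>. g \<in> hitting (ball x d) \<longrightarrow> g \<in> ?H"
      using AE_\<Lambda>_origin
    proof eventually_elim
      case (elim g)
      then show ?case
        using cell_hit_mono[OF _ d(2)] cell_hit_iff[of g "ball x d"] by (auto simp: hitting_def)
    qed
    show "?H \<in> sets \<Lambda>" using cell_hit_sets[OF C(1)] by (simp add: sets_\<Lambda>)
  qed
  moreover have "C \<subseteq> W" using C(2) interior_subset by auto
  ultimately show "0 < emeasure \<mu> {g \<in> space \<mu>. cell_hit C g}"
    using emeasure_hitting_ball_pos[OF sets_\<Lambda> translation_invariant_\<Lambda> nonzero_\<Lambda> d(1), of x]
      emeasure_\<mu>_cell_hit[OF C(1), of "space line_space"]
    by (auto simp: space_\<mu> ennreal_zero_less_divide Int_absorb2)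
qed

end

text \<open>A ball is connected, so if it meets \<open>A\<close> without being contained in
  \<open>A\<close>, it contains a frontier point. Countably many balls are enough, which makes
  avoiding an open set a measurable event.\<close>

lemma frontier_Int_open_iff:
  fixes A U :: "(real^2) set"
  assumes "countable D" "\<And>X :: (real^2) set. open X \<Longrightarrow> X \<noteq> {} \<Longrightarrow> \<exists>d\<in>D. d \<in> X" "open U"
  shows "frontier A \<inter> U \<noteq> {} \<longleftrightarrow>
    (\<exists>q\<in>D. \<exists>n. ball q (1 / real (Suc n)) \<subseteq> U \<and> A \<inter> ball q (1 / real (Suc n)) \<noteq> {} \<and> \<not> ball q (1 / real (Suc n)) \<subseteq> A)"
proof
  assume "frontier A \<inter> U \<noteq> {}"
  then obtain x where x: "x \<in> frontier A" "x \<in> U" by blast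
  obtain \<epsilon> where \<epsilon>: "0 < \<epsilon>" "ball x \<epsilon> \<subseteq> U" using x(2) assms(3) openE by blast
  obtain n where n: "1 / real (Suc n) < \<epsilon> / 2" using nat_approx_posE[of "\<epsilon> / 2"] \<epsilon>(1) by auto
  let ?r = "1 / real (Suc n)"
  have r: "0 < ?r" by simp
  obtain q where q: "q \<in> D" "q \<in> ball x ?r" using assms(2)[of "ball x ?r"] r by auto
  have "ball q ?r \<subseteq> ball x \<epsilon>"
  proof
    fix y assume "y \<in> ball q ?r"
    then show "y \<in> ball x \<epsilon>" using q(2) n dist_triangle[of x y q] by simp
  qed
  moreover have "x \<in> ball q ?r" using q(2) by (simp add: dist_commute)
  then have "A \<inter> ball q ?r \<noteq> {}" "\<not> ball q ?r \<subseteq> A"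
    using x(1) open_Int_closure_eq_empty[OF open_ball, of q ?r A] interior_maximal[OF _ open_ball, of q ?r A]
    unfolding frontier_def by blast+
  ultimately show "\<exists>q\<in>D. \<exists>n. ball q (1 / real (Suc n)) \<subseteq> U \<and> A \<inter> ball q (1 / real (Suc n)) \<noteq> {} \<and> \<not> ball q (1 / real (Suc n)) \<subseteq> A"
    using q(1) \<epsilon>(2) by blast
next
  assume "\<exists>q\<in>D. \<exists>n. ball q (1 / real (Suc n)) \<subseteq> U \<and> A \<inter> ball q (1 / real (Suc n)) \<noteq> {} \<and> \<not> ball q (1 / real (Suc n)) \<subseteq> A"
  then obtain q and n :: nat where "ball q (1 / real (Suc n)) \<subseteq> U" "ball q (1 / real (Suc n)) \<inter> A \<noteq> {}" "ball q (1 / real (Suc n)) - A \<noteq> {}"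
    by blast
  then show "frontier A \<inter> U \<noteq> {}"
    using connected_Int_frontier[OF connected_ball] by blast
qed


text \<open>The functional \<open>f\<close> of the application. The closure is taken because STIT
  cells are closures of the open cells; for convex open cells the frontier is unaffected. The empty
  cell has value 1, as required of \<open>e\<close>.\<close>

definition avoids :: "(real^2) set \<Rightarrow> (real^2) set \<Rightarrow> ennreal" where
  "avoids U C = (if frontier (closure C) \<inter> U = {} then 1 else 0)"

lemma measurable_avoids:
  assumes U: "open U"
  shows "avoids U \<in> borel_measurable (cell_space W)"
proof -
  obtain D :: "(real^2) set" where D: "countable D" "\<And>X. open X \<Longrightarrow> X \<noteq> {} \<Longrightarrow> \<exists>d\<in>D. d \<in> X"
    using countable_dense_plane by blast
  note [measurable] = D(1)
  have op: "open C" if "C \<in> space (cell_space W)" for C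
    using that by (simp add: space_cell_space)
  have meet[measurable]: "Measurable.pred (cell_space W) (\<lambda>C. C \<inter> ball q r \<noteq> {})" for q r
  proof (rule pred_nonempty)
    show "open (C \<inter> ball q r)" if "C \<in> space (cell_space W)" for C
      using op[OF that] by (rule open_Int) simp
    show "Measurable.pred (cell_space W) (\<lambda>C. x \<in> C \<inter> ball q r)" for x
      unfolding Int_iff by measurable
  qed
  have closure_iff: "x \<in> closure C \<longleftrightarrow> (\<forall>n. C \<inter> ball x (1 / real (Suc n)) \<noteq> {})" for x and C :: "(real^2) set"
  proof
    assume "x \<in> closure C"
    then show "\<forall>n. C \<inter> ball x (1 / real (Suc n)) \<noteq> {}"
      using open_Int_closure_eq_empty[OF open_ball, of x _ C] centre_in_ball[of x] by (metis IntI Int_commute empty_iff divide_pos_pos of_nat_0_less_iff zero_less_Suc zero_less_one)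
  next
    assume *: "\<forall>n. C \<inter> ball x (1 / real (Suc n)) \<noteq> {}"
    show "x \<in> closure C"
      unfolding closure_approachable
    proof (intro allI impI)
      fix \<epsilon> :: real assume "0 < \<epsilon>"
      then obtain n where n: "1 / real (Suc n) < \<epsilon>" using nat_approx_posE by blast
      obtain y where "y \<in> C" "dist x y < 1 / real (Suc n)" using * by (metis IntE ex_in_conv mem_ball)
      then show "\<exists>y\<in>C. dist y x < \<epsilon>" using n by (intro bexI[of _ y]) (auto simp: dist_commute)
    qed
  qed
  have [measurable]: "Measurable.pred (cell_space W) (\<lambda>C. \<not> ball q r \<subseteq> closure C)" for q r
  proof -
    have "Measurable.pred (cell_space W) (\<lambda>C. ball q r - closure C \<noteq> {})"
    proof (rule pred_nonempty)
      show "open (ball q r - closure C)" for C by (rule open_Diff) auto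
      show "Measurable.pred (cell_space W) (\<lambda>C. x \<in> ball q r - closure C)" for x
        unfolding Diff_iff closure_iff by measurable
    qed
    then show ?thesis by (simp only: Diff_eq_empty_iff)
  qed
  have *: "frontier (closure C) \<inter> U \<noteq> {} \<longleftrightarrow> (\<exists>q\<in>D. \<exists>n. ball q (1 / real (Suc n)) \<subseteq> U \<and>
      C \<inter> ball q (1 / real (Suc n)) \<noteq> {} \<and> \<not> ball q (1 / real (Suc n)) \<subseteq> closure C)" for C
  proof -
    have "closure C \<inter> ball q r \<noteq> {} \<longleftrightarrow> C \<inter> ball q r \<noteq> {}" for q r
      using open_Int_closure_eq_empty[OF open_ball, of q r C] by blast
    moreover have "frontier (closure C) \<inter> U \<noteq> {} \<longleftrightarrow> (\<exists>q\<in>D. \<exists>n. ball q (1 / real (Suc n)) \<subseteq> U \<and>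
      closure C \<inter> ball q (1 / real (Suc n)) \<noteq> {} \<and> \<not> ball q (1 / real (Suc n)) \<subseteq> closure C)"
      by (rule frontier_Int_open_iff[OF D(1) _ U]) (rule D(2))
    ultimately show ?thesis by simp
  qed
  have "Measurable.pred (cell_space W) (\<lambda>C. \<not> (frontier (closure C) \<inter> U \<noteq> {}))"
    unfolding * by measurable
  then have [measurable]: "Measurable.pred (cell_space W) (\<lambda>C. frontier (closure C) \<inter> U = {})"
    by (simp only: not_not)
  show ?thesis unfolding avoids_def by measurable
qed

lemma (in line_measure) cell_functional_avoids:
  "open U \<Longrightarrow> cell_functional (cell_space W) \<mu> cell_split cell_hit {} rate (avoids U)"
  by (intro cell_functional.intro cell_splitting_axioms cell_functional_axioms.intro measurable_avoids)
     (simp_all add: avoids_def)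

text \<open>For constant \<open>f\<close> the geometric weights simply add up to 1. On the STIT side
  this will express that almost surely only finitely many generations are reached.\<close>

lemma (in cell_functional) yule_value_one:
  assumes "\<And>C. C \<in> space S \<Longrightarrow> f C = 1" "C \<in> space S" "0 \<le> s"
  shows "yule_value s C = 1"
proof -
  have "urn_value n C = 1" if "C \<in> space S" for n C
    using that
  proof (induction n arbitrary: C rule: less_induct)
    case (less n)
    show ?case
    proof (cases n)
      case 0
      then show ?thesis using assms(1) less by simp
    next
      case (Suc m)
      have "(\<integral>\<^sup>+ g. urn_value i (split True C g) * urn_value (m - i) (split False C g) \<partial>\<mu>) = (\<integral>\<^sup>+ g. 1 \<partial>\<mu>)"
        if "i \<le> m" for i
        using less Suc that by (intro nn_integral_cong) auto
      then have "(\<Sum>i\<le>m. \<integral>\<^sup>+ g. urn_value i (split True C g) * urn_value (m - i) (split False C g) \<partial>\<mu>) = (\<Sum>i\<le>m. 1)"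
        by (intro sum.cong) (simp_all add: \<mu>.emeasure_space_1)
      also have "\<dots> = of_nat (Suc m)" by simp
      finally show ?thesis
        unfolding Suc urn_value.simps by (simp only: of_nat_Suc_divide_self_ennreal)
    qed
  qed
  then have "urn_series q C = urn_series q e" for q
    unfolding urn_series_def using assms(2) e_space by (intro suminf_cong) simp
  then have "yule_value s C = yule_value s e" by (simp add: yule_value_def)
  then show ?thesis using assms by (simp add: yule_value_e)
qed

text \<open>The rectangles with sides in \<open>A\<close> and \<open>B\<close> at every index form
  an intersection-stable generator. The conditional laws of \<open>stit_model\<close> are specified
  exactly on such rectangles.\<close>

lemma measure_eqI_PiM_pair:
  assumes "finite I" "finite_measure P"
    and P: "sets P = sets (\<Pi>\<^sub>M i\<in>I. A \<Otimes>\<^sub>M B)" and Q: "sets Q = sets (\<Pi>\<^sub>M i\<in>I. A \<Otimes>\<^sub>M B)"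
    and eq: "\<And>X Y. (\<And>i. X i \<in> sets A) \<Longrightarrow> (\<And>i. Y i \<in> sets B) \<Longrightarrow>
      emeasure P (\<Pi>\<^sub>E i\<in>I. X i \<times> Y i) = emeasure Q (\<Pi>\<^sub>E i\<in>I. X i \<times> Y i)"
  shows "P = Q"
proof -
  let ?E = "{a \<times> b | a b. a \<in> sets A \<and> b \<in> sets B}" and ?S = "space A \<times> space B"
  let ?G = "{{f \<in> (\<Pi>\<^sub>E i\<in>I. ?S). \<forall>i\<in>j. f i \<in> X i} | X j. j \<in> {I} \<and> X \<in> Pi j (\<lambda>_. ?E)}"
  have E: "?E \<subseteq> Pow ?S" by (auto dest: sets.sets_into_space)
  have top: "?S \<in> ?E" by blast
  have "sets (\<Pi>\<^sub>M i\<in>I. A \<Otimes>\<^sub>M B) = sets (\<Pi>\<^sub>M i\<in>I. sigma ?S ?E)"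
    by (intro sets_PiM_cong refl) (simp add: sets_pair_measure E)
  also have "\<dots> = sets (sigma (\<Pi>\<^sub>E i\<in>I. ?S) ?G)"
    using top E assms(1) by (intro sets_PiM_sigma) (auto intro!: exI[of _ "{?S}"])
  also have "\<dots> = sigma_sets (\<Pi>\<^sub>E i\<in>I. ?S) ?G"
    by (rule sets_measure_of) auto
  finally have gen: "sets (\<Pi>\<^sub>M i\<in>I. A \<Otimes>\<^sub>M B) = sigma_sets (\<Pi>\<^sub>E i\<in>I. ?S) ?G" .
  have G: "\<exists>X Y. (\<forall>i. X i \<in> sets A) \<and> (\<forall>i. Y i \<in> sets B) \<and> Z = (\<Pi>\<^sub>E i\<in>I. X i \<times> Y i)" if "Z \<in> ?G" for Z
  proof -
    from that obtain F j where "Z = {f \<in> (\<Pi>\<^sub>E i\<in>I. ?S). \<forall>i\<in>j. f i \<in> F i}" "j \<in> {I}" "F \<in> Pi j (\<lambda>_. ?E)"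
      by blast
    then have Z: "Z = {f \<in> (\<Pi>\<^sub>E i\<in>I. ?S). \<forall>i\<in>I. f i \<in> F i}" and F: "\<forall>i\<in>I. F i \<in> ?E"
      by blast+
    then have "\<forall>i. \<exists>p. i \<in> I \<longrightarrow> F i = fst p \<times> snd p \<and> fst p \<in> sets A \<and> snd p \<in> sets B" by fastforce
    then obtain p where p: "\<And>i. i \<in> I \<Longrightarrow> F i = fst (p i) \<times> snd (p i) \<and> fst (p i) \<in> sets A \<and> snd (p i) \<in> sets B"
      by metis
    let ?X = "\<lambda>i. if i \<in> I then fst (p i) else {}" and ?Y = "\<lambda>i. if i \<in> I then snd (p i) else {}"
    have "Z = (\<Pi>\<^sub>E i\<in>I. ?X i \<times> ?Y i)"
      unfolding Z
    proof (intro set_eqI iffI)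
      fix f assume "f \<in> (\<Pi>\<^sub>E i\<in>I. ?X i \<times> ?Y i)"
      then have f: "f \<in> extensional I" "\<And>i. i \<in> I \<Longrightarrow> f i \<in> F i" using p by (auto simp: PiE_iff)
      have "F i \<subseteq> ?S" if "i \<in> I" for i using F E that by blast
      then show "f \<in> {f \<in> (\<Pi>\<^sub>E i\<in>I. ?S). \<forall>i\<in>I. f i \<in> F i}" using f by (auto simp: PiE_iff)
    qed (use p in \<open>auto simp: PiE_iff\<close>)
    then show ?thesis using p by (intro exI[of _ ?X] exI[of _ ?Y]) auto
  qed
  have rect: "(\<Pi>\<^sub>E i\<in>I. X i \<times> Y i) \<in> ?G" if "\<And>i. X i \<in> sets A" "\<And>i. Y i \<in> sets B" for X Y
  proof -
    have "X i \<times> Y i \<subseteq> ?S" for i using sets.sets_into_space[OF that(1)] sets.sets_into_space[OF that(2)] by auto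
    then have "(\<Pi>\<^sub>E i\<in>I. X i \<times> Y i) \<subseteq> (\<Pi>\<^sub>E i\<in>I. ?S)" by (intro PiE_mono)
    then have "(\<Pi>\<^sub>E i\<in>I. X i \<times> Y i) = {f \<in> (\<Pi>\<^sub>E i\<in>I. ?S). \<forall>i\<in>I. f i \<in> X i \<times> Y i}"
      by (intro set_eqI iffI) (simp_all add: PiE_iff subset_eq)
    moreover have "(\<lambda>i. X i \<times> Y i) \<in> Pi I (\<lambda>_. ?E)" using that by (intro Pi_I) blast
    ultimately show ?thesis
      by (intro CollectI exI[of _ "\<lambda>i. X i \<times> Y i"] exI[of _ I] conjI) simp_all
  qed
  show ?thesis
  proof (rule measure_eqI_generator_eq[where \<Omega>="\<Pi>\<^sub>E i\<in>I. ?S" and E="?G" and A="\<lambda>_. \<Pi>\<^sub>E i\<in>I. ?S"])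
    show "Int_stable ?G"
    proof (rule Int_stableI)
      fix Z Z' assume "Z \<in> ?G" "Z' \<in> ?G"
      from G[OF this(1)] G[OF this(2)]
      obtain X Y X' Y' where *: "\<forall>i. X i \<in> sets A" "\<forall>i. Y i \<in> sets B" "Z = (\<Pi>\<^sub>E i\<in>I. X i \<times> Y i)"
        "\<forall>i. X' i \<in> sets A" "\<forall>i. Y' i \<in> sets B" "Z' = (\<Pi>\<^sub>E i\<in>I. X' i \<times> Y' i)"
        by (elim exE conjE) (rule that)
      then have "Z \<inter> Z' = (\<Pi>\<^sub>E i\<in>I. (X i \<inter> X' i) \<times> (Y i \<inter> Y' i))"
        by (simp add: PiE_Int Times_Int_Times)
      also have "\<dots> \<in> ?G" using * by (intro rect) auto
      finally show "Z \<inter> Z' \<in> ?G" .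
    qed
    show "emeasure P Z = emeasure Q Z" if "Z \<in> ?G" for Z
      using G[OF that] eq by auto
    show "range (\<lambda>_. \<Pi>\<^sub>E i\<in>I. ?S) \<subseteq> ?G" using rect[of "\<lambda>_. space A" "\<lambda>_. space B"] by auto
    show "emeasure P (\<Pi>\<^sub>E i\<in>I. ?S) \<noteq> \<infinity>" for i :: nat
      using finite_measure.emeasure_finite[OF assms(2)] by simp
  qed (use P Q gen in auto)
qed

section \<open>The law of a STIT process\<close>

text \<open>\<open>stit_cell\<close> takes closures after every division. Since the half-planes are
  open, it is equivalent to cut open cells and to close once at the end.\<close>

lemma closure_closure_Int_open:
  assumes "open U"
  shows "closure (closure A \<inter> U) = closure (A \<inter> U)"
proof (rule antisym)
  show "closure (closure A \<inter> U) \<subseteq> closure (A \<inter> U)"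
    using open_Int_closure_subset[OF assms, of A] by (intro closure_minimal) (auto simp: Int_commute)
  show "closure (A \<inter> U) \<subseteq> closure (closure A \<inter> U)"
    using closure_subset[of A] by (intro closure_mono) auto
qed

lemma ennreal_mult_divide_cancel: "0 < c \<Longrightarrow> ennreal c * x / ennreal c = x"
  by (subst mult.commute) (simp add: mult_divide_eq_ennreal)

lemma ennreal_mult_divide_cancel':
  assumes "0 < c"
  shows "ennreal c * y * (x / ennreal c) = x * y"
proof -
  have "ennreal c * y * (x / ennreal c) = (ennreal c * (x / ennreal c)) * y" by (simp only: mult_ac)
  then show ?thesis by (simp only: ennreal_times_divide ennreal_mult_divide_cancel[OF assms])
qed

context line_measure begin

lemma W_eq_closure: "W = closure (interior W)"
  using convex_closure_interior[OF convex_W interior_W] compact_imp_closed[OF compact_W] by simp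

lemma interior_W_space: "interior W \<in> space (cell_space W)"
  by (simp add: space_cell_space)

lemma tree_cell_open: "(\<And>u. g u \<in> space line_space) \<Longrightarrow> open (tree_cell (interior W) g v) \<and> tree_cell (interior W) g v \<subseteq> interior W"
  using tree_cell_space[OF interior_W_space, of v g] by (simp add: space_\<mu> space_cell_space)

lemma tree_cell_Cons: "tree_cell C g (b # v) = tree_cell C g v \<inter> half_plane b (g v)"
  unfolding tree_cell.simps by (rule cell_split_def)

lemma tree_cell_convex:
  "(\<And>u. length u < length v \<Longrightarrow> g u \<in> space line_space \<and> 0 \<notin> g u) \<Longrightarrow> convex (tree_cell (interior W) g v)"
proof (induction v)
  case Nil
  show ?case using convex_W by (simp add: convex_interior)
next
  case (Cons b v)
  then have "convex (tree_cell (interior W) g v)" by simp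
  moreover have "convex (half_plane b (g v))" using Cons.prems[of v] by (intro convex_half_plane) auto
  ultimately show ?case unfolding tree_cell_Cons by (rule convex_Int)
qed

lemma stit_cell_eq:
  assumes "\<And>u. g u \<in> space line_space"
  shows "stit_cell W g v = closure (tree_cell (interior W) g v)"
proof (induction v)
  case Nil
  show ?case unfolding stit_cell.simps tree_cell.simps by (rule W_eq_closure)
next
  case (Cons b v)
  then show ?case
    by (simp only: stit_cell.simps tree_cell_Cons closure_closure_Int_open[OF open_half_plane[OF assms]])
qed

text \<open>For a convex cell, lines meeting the closure only at the boundary form a null set.\<close>

lemma emeasure_hitting_closure:
  assumes C: "open C" "convex C" "C \<subseteq> interior W" and D: "D \<in> sets line_space"
  shows "emeasure \<Lambda> (hitting (closure C) \<inter> D) = ennreal rate * emeasure \<mu> ({g \<in> space line_space. cell_hit C g} \<inter> D)"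
proof -
  have bC: "bounded C"
    using C(3) interior_subset compact_imp_bounded[OF compact_W] by (meson bounded_subset)
  have "C \<subseteq> W" using C(3) interior_subset by blast
  let ?H = "{g \<in> space line_space. cell_hit C g}"
  have "emeasure \<Lambda> (hitting (closure C) \<inter> D) = emeasure \<Lambda> (?H \<inter> D)"
  proof (rule emeasure_eq_AE)
    show "AE g in \<Lambda>. g \<in> hitting (closure C) \<inter> D \<longleftrightarrow> g \<in> ?H \<inter> D"
      using AE_\<Lambda>_origin AE_hit_closure[OF sets_\<Lambda> locally_finite_\<Lambda> translation_invariant_\<Lambda> C(2) bC]
    proof eventually_elim
      case (elim g)
      then show ?case
        using cell_hit_iff[of g C] C closure_subset[of C] by (auto simp: hitting_def)
    qed
    show "hitting (closure C) \<inter> D \<in> sets \<Lambda>"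
      using sets_hitting_compact[of "closure C"] bC D by (simp add: sets_\<Lambda> compact_closure)
    show "?H \<inter> D \<in> sets \<Lambda>" using cell_hit_sets[OF C(1)] D by (simp add: sets_\<Lambda>)
  qed
  also have "\<dots> = ennreal rate * emeasure \<mu> (?H \<inter> D)"
    using emeasure_\<mu>_cell_hit[OF C(1) \<open>C \<subseteq> W\<close> D] rate_pos
    by (simp add: ennreal_times_divide ennreal_mult_divide_cancel)
  finally show ?thesis .
qed

lemma measure_hitting_closure:
  assumes "open C" "convex C" "C \<subseteq> interior W"
  shows "measure \<Lambda> (hitting (closure C)) = hit_rate C"
proof -
  have "hitting (closure C) \<inter> space line_space = hitting (closure C)" by (auto simp: hitting_def)
  then have "emeasure \<Lambda> (hitting (closure C)) = ennreal rate * emeasure \<mu> {g \<in> space line_space. cell_hit C g}"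
    using emeasure_hitting_closure[OF assms, of "space line_space"] by (simp add: Int_absorb2)
  then show ?thesis
    using rate_pos by (simp add: measure_def hit_rate_def space_\<mu> enn2real_mult)
qed

text \<open>The factor \<open>hit_rate C\<close> of the exponential density cancels the
  normalization of the line law; \<open>pos\<close> is what permits the division.\<close>

lemma split_kernel:
  assumes C: "open C" "convex C" "C \<subseteq> interior W" and pos: "0 < measure \<Lambda> (hitting (closure C))"
    and B: "B \<in> sets borel" and D: "D \<in> sets line_space"
  shows "emeasure (density lborel (\<lambda>s. ennreal (exponential_density (measure \<Lambda> (hitting (closure C))) s))) B
      * emeasure (uniform_measure \<Lambda> (hitting (closure C))) D =
    (\<integral>\<^sup>+ p. split_density C p * indicator (B \<times> D) p \<partial>(lborel \<Otimes>\<^sub>M \<mu>))"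
proof -
  let ?c = "hit_rate C" and ?H = "{g \<in> space line_space. cell_hit C g}"
  have c: "measure \<Lambda> (hitting (closure C)) = ?c" using C by (rule measure_hitting_closure)
  have c_pos: "0 < ?c" using pos c by simp
  have bC: "bounded C"
    using C(3) interior_subset compact_imp_bounded[OF compact_W] by (meson bounded_subset)
  have h: "hitting (closure C) \<in> sets \<Lambda>"
    using sets_hitting_compact[of "closure C"] bC by (simp add: sets_\<Lambda> compact_closure)
  have em: "emeasure \<Lambda> (hitting (closure C)) = ennreal ?c"
    using pos unfolding c[symmetric] by (intro emeasure_eq_ennreal_measure) (auto simp: measure_def)
  have HD: "?H \<inter> D \<in> sets \<mu>" using cell_hit_sets[OF C(1)] D by (simp add: sets_\<mu>)
  have [measurable]: "C \<in> space (cell_space W)" using C by (simp add: space_cell_space)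
  have [measurable]: "B \<in> sets borel" "D \<in> sets \<mu>" using B D by (simp_all add: sets_\<mu>)
  let ?I = "\<integral>\<^sup>+ r. ennreal (exp (- ?c * r)) * indicator {0..} r * indicator B r \<partial>lborel"
  have "emeasure (density lborel (\<lambda>s. ennreal (exponential_density ?c s))) B =
      (\<integral>\<^sup>+ r. ennreal (exponential_density ?c r) * indicator B r \<partial>lborel)"
    by (rule emeasure_density) auto
  also have "\<dots> = (\<integral>\<^sup>+ r. ennreal ?c * (ennreal (exp (- ?c * r)) * indicator {0..} r * indicator B r) \<partial>lborel)"
    using c_pos by (intro nn_integral_cong) (auto simp: exponential_density_def indicator_def ennreal_mult' mult.commute)
  also have "\<dots> = ennreal ?c * ?I" by (rule nn_integral_cmult) auto
  finally have 1: "emeasure (density lborel (\<lambda>s. ennreal (exponential_density ?c s))) B = ennreal ?c * ?I" .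
  have 2: "emeasure (uniform_measure \<Lambda> (hitting (closure C))) D = ennreal rate * emeasure \<mu> (?H \<inter> D) / ennreal ?c"
    using h D emeasure_hitting_closure[OF C D] by (simp add: sets_\<Lambda> em)
  have "(\<integral>\<^sup>+ p. split_density C p * indicator (B \<times> D) p \<partial>(lborel \<Otimes>\<^sub>M \<mu>)) =
      (\<integral>\<^sup>+ r. \<integral>\<^sup>+ g. split_density C (r, g) * indicator (B \<times> D) (r, g) \<partial>\<mu> \<partial>lborel)"
    by (rule \<mu>.nn_integral_fst[symmetric]) measurable
  also have "\<dots> = (\<integral>\<^sup>+ r. \<integral>\<^sup>+ g. (ennreal rate * (ennreal (exp (- ?c * r)) * indicator {0..} r * indicator B r)) * indicator (?H \<inter> D) g \<partial>\<mu> \<partial>lborel)"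
    using rate_pos by (intro nn_integral_cong) (auto simp: split_density_def indicator_def ennreal_mult' space_\<mu>)
  also have "\<dots> = (\<integral>\<^sup>+ r. (ennreal rate * emeasure \<mu> (?H \<inter> D)) * (ennreal (exp (- ?c * r)) * indicator {0..} r * indicator B r) \<partial>lborel)"
    using HD by (intro nn_integral_cong) (simp add: nn_integral_cmult mult_ac)
  also have "\<dots> = ennreal rate * emeasure \<mu> (?H \<inter> D) * ?I" by (rule nn_integral_cmult) auto
  finally have 3: "(\<integral>\<^sup>+ p. split_density C p * indicator (B \<times> D) p \<partial>(lborel \<Otimes>\<^sub>M \<mu>)) = ennreal rate * emeasure \<mu> (?H \<inter> D) * ?I" .
  show ?thesis
    unfolding 3 c 1 2 by (rule ennreal_mult_divide_cancel'[OF c_pos])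
qed

end

section \<open>Conditional law of a generation given its history\<close>

locale stit_process = line_measure +
  fixes M :: "'a measure" and \<tau> :: "bool list \<Rightarrow> 'a \<Rightarrow> real" and g :: "bool list \<Rightarrow> 'a \<Rightarrow> (real^2) set"
  assumes stit: "stit_model \<Lambda> W M \<tau> g"
begin

sublocale M: prob_space M
  using stit by (simp add: stit_model_def)

lemma measurable_\<tau>[measurable]: "\<tau> v \<in> borel_measurable M"
  and measurable_g[measurable]: "g v \<in> M \<rightarrow>\<^sub>M line_space"
  using stit by (simp_all add: stit_model_def)

lemma measurable_g\<mu>[measurable]: "g v \<in> M \<rightarrow>\<^sub>M \<mu>"
  by (subst measurable_cong_sets[OF refl sets_\<mu>]) (rule measurable_g)

lemma g_space: "\<omega> \<in> space M \<Longrightarrow> g v \<omega> \<in> space line_space"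
  using measurable_g by (rule measurable_space)

definition history :: "nat \<Rightarrow> 'a \<Rightarrow> bool list \<Rightarrow> real \<times> (real^2) set" where
  "history n \<omega> = (\<lambda>v\<in>{v. length v < n}. (\<tau> v \<omega>, g v \<omega>))"

abbreviation (input) history_space :: "nat \<Rightarrow> (bool list \<Rightarrow> real \<times> (real^2) set) measure" where
  "history_space n \<equiv> (\<Pi>\<^sub>M v\<in>{v. length v < n}. borel \<Otimes>\<^sub>M line_space)"

abbreviation (input) cell :: "'a \<Rightarrow> bool list \<Rightarrow> (real^2) set" where
  "cell \<omega> v \<equiv> tree_cell (interior W) (\<lambda>u. g u \<omega>) v"

definition kernel :: "'a \<Rightarrow> bool list \<Rightarrow> real set \<Rightarrow> (real^2) set set \<Rightarrow> ennreal" where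
  "kernel \<omega> v B D = (let C = stit_cell W (\<lambda>u. g u \<omega>) v in
    emeasure (density lborel (\<lambda>s. ennreal (exponential_density (measure \<Lambda> (hitting C)) s))) B
    * emeasure (uniform_measure \<Lambda> (hitting C)) D)"

lemma measurable_history[measurable]: "history n \<in> M \<rightarrow>\<^sub>M history_space n"
  unfolding history_def by (rule measurable_restrict) measurable

lemma stit_history_eq: "stit_history M \<tau> g n = vimage_algebra (space M) (history n) (history_space n)"
  by (simp add: stit_history_def history_def[abs_def])

lemma subalgebra_history: "subalgebra M (stit_history M \<tau> g n)"
proof -
  have "history n \<in> space M \<rightarrow> space (history_space n)"
    by (intro Pi_I measurable_space[OF measurable_history])
  then have "sets (stit_history M \<tau> g n) = {history n -` A \<inter> space M | A. A \<in> sets (history_space n)}"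
    unfolding stit_history_eq by (rule sets_vimage_algebra2)
  then show ?thesis
    using measurable_sets[OF measurable_history] unfolding subalgebra_def stit_history_eq by fastforce
qed

lemma AE_kernel:
  assumes "\<And>v. B v \<in> sets borel" "\<And>v. D v \<in> sets line_space"
  shows "AE \<omega> in M. nn_cond_exp M (stit_history M \<tau> g n)
      (indicator {\<omega> \<in> space M. \<forall>v. length v = n \<longrightarrow> \<tau> v \<omega> \<in> B v \<and> g v \<omega> \<in> D v}) \<omega> =
    (\<Prod>v | length v = n. kernel \<omega> v (B v) (D v))"
proof -
  have "\<forall>n B D. (\<forall>v. B v \<in> sets borel) \<and> (\<forall>v. D v \<in> sets line_space) \<longrightarrow>
      (AE \<omega> in M. nn_cond_exp M (stit_history M \<tau> g n)
        (indicator {\<omega> \<in> space M. \<forall>v. length v = n \<longrightarrow> \<tau> v \<omega> \<in> B v \<and> g v \<omega> \<in> D v}) \<omega> =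
        (\<Prod>v | length v = n. kernel \<omega> v (B v) (D v)))"
    using stit unfolding stit_model_def kernel_def by (elim conjE)
  then show ?thesis using assms by simp
qed

lemma sets_generation:
  assumes "\<And>v. B v \<in> sets borel" "\<And>v. D v \<in> sets line_space"
  shows "{\<omega> \<in> space M. \<forall>v. length v = n \<longrightarrow> \<tau> v \<omega> \<in> B v \<and> g v \<omega> \<in> D v} \<in> sets M"
proof -
  have "{\<omega> \<in> space M. \<forall>v\<in>{v. length v = n}. \<tau> v \<omega> \<in> B v \<and> g v \<omega> \<in> D v} \<in> sets M"
  proof (intro sets.sets_Collect_finite_All finite_length_eq)
    fix v
    note [measurable] = assms(1)[of v] assms(2)[of v]
    show "{\<omega> \<in> space M. \<tau> v \<omega> \<in> B v \<and> g v \<omega> \<in> D v} \<in> sets M" by measurable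
  qed
  then show ?thesis by (simp only: Ball_def mem_Collect_eq)
qed

text \<open>The conditional expectation of the model, tested against an event \<open>E\<close> of
  the past.\<close>

lemma emeasure_generation:
  assumes "\<And>v. B v \<in> sets borel" "\<And>v. D v \<in> sets line_space" "E \<in> sets (history_space n)"
  shows "emeasure M {\<omega> \<in> space M. history n \<omega> \<in> E \<and> (\<forall>v. length v = n \<longrightarrow> \<tau> v \<omega> \<in> B v \<and> g v \<omega> \<in> D v)} =
    (\<integral>\<^sup>+ \<omega>. indicator E (history n \<omega>) * (\<Prod>v | length v = n. kernel \<omega> v (B v) (D v)) \<partial>M)"
proof -
  let ?F = "stit_history M \<tau> g n"
  let ?Z = "{\<omega> \<in> space M. history n \<omega> \<in> E \<and> (\<forall>v. length v = n \<longrightarrow> \<tau> v \<omega> \<in> B v \<and> g v \<omega> \<in> D v)}"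
  let ?A = "{\<omega> \<in> space M. \<forall>v. length v = n \<longrightarrow> \<tau> v \<omega> \<in> B v \<and> g v \<omega> \<in> D v}"
  interpret F: finite_measure_subalgebra M ?F
    by standard (rule subalgebra_history)
  have "history n \<in> ?F \<rightarrow>\<^sub>M history_space n"
    unfolding stit_history_eq
    by (rule measurable_vimage_algebra1) (use measurable_space[OF measurable_history] in auto)
  then have E: "(\<lambda>\<omega>. indicator E (history n \<omega>) :: ennreal) \<in> borel_measurable ?F"
    using assms(3) by measurable
  have "(\<integral>\<^sup>+ \<omega>. indicator E (history n \<omega>) * (\<Prod>v | length v = n. kernel \<omega> v (B v) (D v)) \<partial>M) =
      (\<integral>\<^sup>+ \<omega>. indicator E (history n \<omega>) * nn_cond_exp M ?F (indicator ?A) \<omega> \<partial>M)"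
  proof (rule nn_integral_cong_AE)
    show "AE \<omega> in M. indicator E (history n \<omega>) * (\<Prod>v | length v = n. kernel \<omega> v (B v) (D v)) =
        indicator E (history n \<omega>) * nn_cond_exp M ?F (indicator ?A) \<omega>"
      using AE_kernel[where B=B and D=D and n=n, OF assms(1,2)] by eventually_elim simp
  qed
  also have "\<dots> = (\<integral>\<^sup>+ \<omega>. indicator E (history n \<omega>) * indicator ?A \<omega> \<partial>M)"
    by (rule F.nn_cond_exp_intg[OF E borel_measurable_indicator[OF sets_generation[OF assms(1,2)]]])
  also have "\<dots> = (\<integral>\<^sup>+ \<omega>. indicator ?Z \<omega> \<partial>M)"
    by (intro nn_integral_cong) (auto simp: indicator_def)
  also have "\<dots> = emeasure M ?Z"
  proof (rule nn_integral_indicator)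
    note [measurable] = assms(3)
    have "{\<omega> \<in> space M. history n \<omega> \<in> E} \<inter> ?A \<in> sets M"
      by (rule sets.Int[OF _ sets_generation[OF assms(1,2)]]) measurable
    then show "?Z \<in> sets M"
      by (rule back_subst[of "\<lambda>X. X \<in> sets M"]) blast
  qed
  finally show ?thesis by simp
qed

lemma AE_not_in:
  assumes "B \<in> sets borel" "D \<in> sets line_space" and 0: "\<And>\<omega>. \<omega> \<in> space M \<Longrightarrow> kernel \<omega> v B D = 0"
  shows "AE \<omega> in M. \<not> (\<tau> v \<omega> \<in> B \<and> g v \<omega> \<in> D)"
proof -
  \<comment> \<open>The model speaks of whole generations, so all nodes other than \<open>v\<close>
    receive the full spaces.\<close>
  let ?B = "\<lambda>u. if u = v then B else UNIV" and ?D = "\<lambda>u. if u = v then D else space line_space"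
  let ?n = "length v"
  let ?Z = "{\<omega> \<in> space M. history ?n \<omega> \<in> space (history_space ?n) \<and> (\<forall>u. length u = ?n \<longrightarrow> \<tau> u \<omega> \<in> ?B u \<and> g u \<omega> \<in> ?D u)}"
  have BD: "?B u \<in> sets borel" "?D u \<in> sets line_space" for u using assms by auto
  have prod0: "(\<Prod>u | length u = ?n. kernel \<omega> u (?B u) (?D u)) = 0" if "\<omega> \<in> space M" for \<omega>
  proof (rule prod_zero[OF finite_length_eq])
    show "\<exists>u\<in>{u. length u = ?n}. kernel \<omega> u (?B u) (?D u) = 0"
      using 0[OF that] by (intro bexI[of _ v]) auto
  qed
  have "emeasure M ?Z =
    (\<integral>\<^sup>+ \<omega>. indicator (space (history_space ?n)) (history ?n \<omega>) * (\<Prod>u | length u = ?n. kernel \<omega> u (?B u) (?D u)) \<partial>M)"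
    by (rule emeasure_generation[OF BD sets.top])
  also have "\<dots> = (\<integral>\<^sup>+ \<omega>. 0 \<partial>M)"
    by (intro nn_integral_cong) (simp only: prod0 mult_zero_right)
  finally have "emeasure M ?Z = 0"
    by simp
  also have "?Z =
      {\<omega> \<in> space M. \<tau> v \<omega> \<in> B \<and> g v \<omega> \<in> D}"
    using g_space measurable_space[OF measurable_history] by auto
  finally have 0: "emeasure M {\<omega> \<in> space M. \<tau> v \<omega> \<in> B \<and> g v \<omega> \<in> D} = 0" .
  note [measurable] = assms(1,2)
  have "{\<omega> \<in> space M. \<tau> v \<omega> \<in> B \<and> g v \<omega> \<in> D} \<in> null_sets M"
    using 0 assms(1,2) by (intro null_setsI) measurable
  then show ?thesis by (rule AE_I') auto
qed

lemma AE_\<tau>_nonneg: "AE \<omega> in M. \<forall>v. 0 \<le> \<tau> v \<omega>"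
proof -
  have "AE \<omega> in M. \<not> (\<tau> v \<omega> \<in> {..<0} \<and> g v \<omega> \<in> space line_space)" for v
  proof (rule AE_not_in)
    fix \<omega>
    have "(\<integral>\<^sup>+ s. ennreal (exponential_density c s) * indicator {..<0} s \<partial>lborel) = (\<integral>\<^sup>+ (s :: real). 0 \<partial>lborel)" for c
      by (intro nn_integral_cong) (simp add: exponential_density_def indicator_def)
    then have "emeasure (density lborel (\<lambda>s. ennreal (exponential_density c s))) {..<0} = 0" for c
      by (subst emeasure_density) auto
    then show "kernel \<omega> v {..<0} (space line_space) = 0" by (simp add: kernel_def)
  qed auto
  then have "AE \<omega> in M. \<not> (\<tau> v \<omega> \<in> {..<0} \<and> g v \<omega> \<in> space line_space) \<and> \<omega> \<in> space M" for v
    using AE_space by (rule AE_conjI)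
  from this have "AE \<omega> in M. 0 \<le> \<tau> v \<omega>" for v
    by (rule AE_mp[where P="\<lambda>\<omega>. \<not> (\<tau> v \<omega> \<in> {..<0} \<and> g v \<omega> \<in> space line_space) \<and> \<omega> \<in> space M"]) (auto intro!: AE_I2 simp: g_space)
  then show ?thesis by (simp add: AE_all_countable)
qed

lemma AE_g_origin: "AE \<omega> in M. \<forall>v. 0 \<notin> g v \<omega>"
proof -
  let ?O = "{g \<in> space line_space. 0 \<in> g}"
  have "{line_of \<phi> 0 | \<phi>. \<phi> \<in> {0..<pi} \<and> True} \<in> sets line_space"
    by (rule graph_in_sets) auto
  moreover have "{line_of \<phi> 0 | \<phi>. \<phi> \<in> {0..<pi} \<and> True} = ?O"
    by (auto simp: line_of_space mem_line_of elim!: line_space_cases)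
  ultimately have O: "?O \<in> sets line_space" by simp
  have O0: "emeasure \<Lambda> ?O = 0"
  proof -
    have "?O = {g \<in> space \<Lambda>. \<not> 0 \<notin> g}" by (simp add: space_\<Lambda>)
    then show ?thesis using AE_\<Lambda>_origin O sets_\<Lambda> by (simp add: AE_iff_measurable[OF _ refl])
  qed
  have "AE \<omega> in M. \<not> (\<tau> v \<omega> \<in> UNIV \<and> g v \<omega> \<in> ?O)" for v
  proof (rule AE_not_in)
    fix \<omega> assume \<omega>: "\<omega> \<in> space M"
    let ?A = "hitting (closure (cell \<omega> v))"
    have "bounded (cell \<omega> v)"
      using tree_cell_open[of "\<lambda>u. g u \<omega>" v] g_space[OF \<omega>] compact_imp_bounded[OF compact_W] interior_subset
      by (meson bounded_subset)
    then have A: "?A \<in> sets \<Lambda>" using sets_hitting_compact by (simp add: sets_\<Lambda> compact_closure)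
    have "emeasure \<Lambda> (?A \<inter> ?O) = 0"
      using O0 O emeasure_mono[of "?A \<inter> ?O" ?O \<Lambda>] by (simp add: sets_\<Lambda>)
    then have "emeasure (uniform_measure \<Lambda> ?A) ?O = 0"
      using A O by (simp add: sets_\<Lambda>)
    then show "kernel \<omega> v UNIV ?O = 0"
      using g_space[OF \<omega>] by (simp add: kernel_def stit_cell_eq)
  qed (use O in auto)
  then have "AE \<omega> in M. \<not> (\<tau> v \<omega> \<in> UNIV \<and> g v \<omega> \<in> ?O) \<and> \<omega> \<in> space M" for v
    using AE_space by (rule AE_conjI)
  from this have "AE \<omega> in M. 0 \<notin> g v \<omega>" for v
    by (rule AE_mp[where P="\<lambda>\<omega>. \<not> (\<tau> v \<omega> \<in> UNIV \<and> g v \<omega> \<in> ?O) \<and> \<omega> \<in> space M"]) (auto intro!: AE_I2 simp: g_space)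
  then show ?thesis by (simp add: AE_all_countable)
qed

text \<open>Taken over the full spaces, the kernels of a generation multiply to the conditional
  probability of the sure event, which is 1, so none of them is 0. This excludes cells of hitting
  measure 0, for which the exponential density would vanish identically.\<close>

lemma AE_kernel_pos: "AE \<omega> in M. \<forall>v. kernel \<omega> v UNIV (space line_space) \<noteq> 0"
proof -
  have "AE \<omega> in M. \<forall>v. length v = n \<longrightarrow> kernel \<omega> v UNIV (space line_space) \<noteq> 0" for n
  proof -
    let ?F = "stit_history M \<tau> g n"
    interpret F: finite_measure_subalgebra M ?F
      by standard (rule subalgebra_history)
    have "{\<omega> \<in> space M. \<forall>v. length v = n \<longrightarrow> \<tau> v \<omega> \<in> UNIV \<and> g v \<omega> \<in> space line_space} = space M"
      using g_space by auto
    then have "AE \<omega> in M. nn_cond_exp M ?F (indicator (space M)) \<omega> = (\<Prod>v | length v = n. kernel \<omega> v UNIV (space line_space))"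
      using AE_kernel[of "\<lambda>_. UNIV" "\<lambda>_. space line_space" n] by simp
    moreover have "AE \<omega> in M. (indicator (space M) \<omega> :: ennreal) = nn_cond_exp M ?F (indicator (space M)) \<omega>"
    proof (rule F.nn_cond_exp_F_meas)
      have "space M = space ?F" by (simp add: stit_history_eq)
      then show "(indicator (space M) :: 'a \<Rightarrow> ennreal) \<in> borel_measurable ?F" by simp
    qed
    ultimately show ?thesis
      using AE_space
    proof eventually_elim
      case (elim \<omega>)
      then have "(\<Prod>v | length v = n. kernel \<omega> v UNIV (space line_space)) = 1" by simp
      then show ?case by (metis (mono_tags, lifting) finite_length_eq mem_Collect_eq prod_zero zero_neq_one)
    qed
  qed
  then have "AE \<omega> in M. \<forall>n v. length v = n \<longrightarrow> kernel \<omega> v UNIV (space line_space) \<noteq> 0"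
    by (simp add: AE_all_countable)
  then show ?thesis by eventually_elim blast
qed

lemma AE_kernel_eq:
  "AE \<omega> in M. \<forall>v B D. B \<in> sets borel \<longrightarrow> D \<in> sets line_space \<longrightarrow>
    kernel \<omega> v B D = (\<integral>\<^sup>+ p. split_density (cell \<omega> v) p * indicator (B \<times> D) p \<partial>(lborel \<Otimes>\<^sub>M \<mu>))"
  using AE_kernel_pos AE_g_origin AE_space
proof eventually_elim
  case (elim \<omega>)
  show ?case
  proof (intro allI impI)
    fix v :: "bool list" and B :: "real set" and D :: "(real^2) set set"
    assume BD: "B \<in> sets borel" "D \<in> sets line_space"
    let ?C = "cell \<omega> v"
    have C: "open ?C" "convex ?C" "?C \<subseteq> interior W"
      using tree_cell_open[of "\<lambda>u. g u \<omega>" v] tree_cell_convex[of v "\<lambda>u. g u \<omega>"] elim g_space by auto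
    have st: "stit_cell W (\<lambda>u. g u \<omega>) v = closure ?C" using elim g_space by (intro stit_cell_eq)
    have "measure \<Lambda> (hitting (closure ?C)) \<noteq> 0"
    proof
      assume 0: "measure \<Lambda> (hitting (closure ?C)) = 0"
      have "exponential_density 0 s = 0" for s by (simp add: exponential_density_def)
      then have "emeasure (density lborel (\<lambda>s. ennreal (exponential_density 0 s))) UNIV = 0"
        by (subst emeasure_density) auto
      then have "kernel \<omega> v UNIV (space line_space) = 0" by (simp add: kernel_def st 0)
      with elim show False by blast
    qed
    then show "kernel \<omega> v B D = (\<integral>\<^sup>+ p. split_density ?C p * indicator (B \<times> D) p \<partial>(lborel \<Otimes>\<^sub>M \<mu>))"
      using split_kernel[OF C _ BD] by (simp add: kernel_def st zero_less_measure_iff)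
  qed
qed

end

section \<open>Joint density of finitely many generations\<close>

lemma prod_indicator:
  "finite J \<Longrightarrow> (\<Prod>v\<in>J. indicator (A v) (y v) :: ennreal) = (if \<forall>v\<in>J. y v \<in> A v then 1 else 0)"
  by (induction J rule: finite_induct) (auto simp: indicator_def)

context stit_process begin

abbreviation (input) reference :: "nat \<Rightarrow> (bool list \<Rightarrow> real \<times> (real^2) set) measure" where
  "reference n \<equiv> (\<Pi>\<^sub>M v\<in>{v. length v < n}. lborel \<Otimes>\<^sub>M \<mu>)"

abbreviation (input) node_cell :: "(bool list \<Rightarrow> real \<times> (real^2) set) \<Rightarrow> bool list \<Rightarrow> (real^2) set" where
  "node_cell x \<equiv> tree_cell (interior W) (\<lambda>u. snd (x u))"

lemma sets_reference: "sets (reference n) = sets (history_space n)"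
  by (intro sets_PiM_cong sets_pair_measure_cong refl) (simp_all add: sets_\<mu>)

lemma measurable_history_reference[measurable]: "history n \<in> M \<rightarrow>\<^sub>M reference n"
  by (subst measurable_cong_sets[OF refl sets_reference]) (rule measurable_history)

lemma measurable_node_cell:
  assumes "length v \<le> n"
  shows "(\<lambda>x. node_cell x v) \<in> reference n \<rightarrow>\<^sub>M cell_space W"
proof (rule measurable_tree_cell[OF interior_W_space])
  fix u :: "bool list" assume "length u < length v"
  then have "(\<lambda>x. x u) \<in> reference n \<rightarrow>\<^sub>M lborel \<Otimes>\<^sub>M \<mu>"
    using assms by (intro measurable_component_singleton) simp
  then show "(\<lambda>x. snd (x u)) \<in> reference n \<rightarrow>\<^sub>M \<mu>" by (rule measurable_compose) measurable
qed

lemma node_cell_history: "length v \<le> n \<Longrightarrow> node_cell (history n \<omega>) v = cell \<omega> v"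
  by (rule tree_cell_cong) (simp add: history_def)

lemma measurable_tree_density:
  "(\<lambda>x. \<Prod>v | length v < n. split_density (node_cell x v) (x v)) \<in> borel_measurable (reference n)"
proof (rule borel_measurable_prod_ennreal)
  fix v :: "bool list" assume v: "v \<in> {v. length v < n}"
  have eq: "sets (lborel \<Otimes>\<^sub>M \<mu>) = sets (borel \<Otimes>\<^sub>M \<mu>)" by (intro sets_pair_measure_cong) auto
  have "(\<lambda>x. x v) \<in> reference n \<rightarrow>\<^sub>M borel \<Otimes>\<^sub>M \<mu>"
    using measurable_component_singleton[OF v, of "\<lambda>_. lborel \<Otimes>\<^sub>M \<mu>"]
    by (simp only: measurable_cong_sets[OF refl eq])
  with measurable_node_cell[of v n]
  show "(\<lambda>x. split_density (node_cell x v) (x v)) \<in> borel_measurable (reference n)"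
    using v by (intro measurable_split_density) auto
qed

text \<open>The cells of generation \<open>n\<close> are functions of the earlier generations, so
  each new generation multiplies the density by one \<open>split_density\<close> per node. With a
  density relative to a product measure, the generations can be integrated out one after
  another.\<close>

lemma distr_history:
  "distr M (reference n) (history n) =
    density (reference n) (\<lambda>x. \<Prod>v | length v < n. split_density (node_cell x v) (x v))"
proof (induction n)
  case 0
  show ?case
  proof (rule measure_eqI_PiM_pair[where I="{}" and A=borel and B=line_space])
    show "finite_measure (distr M (reference 0) (history 0))"
      by (rule prob_space.axioms(1)[OF M.prob_space_distr[OF measurable_history_reference]])
    fix X :: "bool list \<Rightarrow> real set" and Y :: "bool list \<Rightarrow> (real^2) set set"
    have "emeasure (distr M (reference 0) (history 0)) {\<lambda>_. undefined} = emeasure M (history 0 -` {\<lambda>_. undefined} \<inter> space M)"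
      by (rule emeasure_distr[OF measurable_history_reference]) (simp add: PiM_empty)
    also have "history 0 -` {\<lambda>_. undefined} \<inter> space M = space M"
      by (auto simp: history_def)
    finally show "emeasure (distr M (reference 0) (history 0)) (\<Pi>\<^sub>E i\<in>{}. X i \<times> Y i) =
      emeasure (density (reference 0) (\<lambda>x. \<Prod>v | length v < 0. split_density (node_cell x v) (x v))) (\<Pi>\<^sub>E i\<in>{}. X i \<times> Y i)"
      by (simp add: M.emeasure_space_1 emeasure_density PiM_empty nn_integral_count_space_finite)
  qed (simp_all add: sets_PiM_empty)
next
  case (Suc n)
  let ?L = "distr M (reference (Suc n)) (history (Suc n))"
  let ?R = "lborel \<Otimes>\<^sub>M \<mu>"
  let ?I = "{v :: bool list. length v < n}" and ?J = "{v :: bool list. length v = n}"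
  let ?d = "\<lambda>n x. \<Prod>v | length v < n. split_density (node_cell x v) (x v)"
  interpret R: pair_sigma_finite lborel \<mu> by standard
  interpret P: product_sigma_finite "\<lambda>_ :: bool list. ?R" by standard
  show ?case
  proof (rule measure_eqI_PiM_pair[where I="{v. length v < Suc n}" and A=borel and B=line_space])
    show "finite {v :: bool list. length v < Suc n}" by (rule finite_length_less)
    show "finite_measure (?L)"
      by (rule prob_space.axioms(1)[OF M.prob_space_distr[OF measurable_history_reference]])
    show "sets (?L) = sets (history_space (Suc n))"
      unfolding sets_distr by (rule sets_reference)
    show "sets (density (reference (Suc n)) (?d (Suc n))) = sets (history_space (Suc n))"
      unfolding sets_density by (rule sets_reference)
    fix X :: "bool list \<Rightarrow> real set" and Y :: "bool list \<Rightarrow> (real^2) set set"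
    assume X: "\<And>i. X i \<in> sets borel" and Y: "\<And>i. Y i \<in> sets line_space"
    let ?E = "\<lambda>I. \<Pi>\<^sub>E v\<in>I. X v \<times> Y v"
    have XY: "X v \<times> Y v \<in> sets ?R" for v
      using X[of v] Y[of v] by (simp add: sets_\<mu>)
    have E: "?E {v. length v < m} \<in> sets (reference m)" for m
      using XY by (intro sets_PiM_I_finite finite_length_less)
    have E': "?E ?I \<in> sets (history_space n)" using E[of n] by (simp only: sets_reference)
    define K where "K C v = (\<integral>\<^sup>+ p. split_density C p * indicator (X v \<times> Y v) p \<partial>?R)" for C v
    have K_meas: "(\<lambda>C. K C v) \<in> borel_measurable (cell_space W)" for v
    proof -
      note [measurable] = XY[of v]
      show ?thesis unfolding K_def by measurable
    qed
    have h: "(\<lambda>x. indicator (?E ?I) x * (\<Prod>v\<in>?J. K (node_cell x v) v)) \<in> borel_measurable (reference n)"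
      by (intro borel_measurable_times_ennreal borel_measurable_indicator E borel_measurable_prod_ennreal
          measurable_compose[OF measurable_node_cell K_meas]) simp
    have d: "?d n \<in> borel_measurable (reference n)" by (rule measurable_tree_density)
    have "emeasure (?L) (?E {v. length v < Suc n}) =
        emeasure M (history (Suc n) -` ?E {v. length v < Suc n} \<inter> space M)"
      by (rule emeasure_distr[OF measurable_history_reference E])
    also have "history (Suc n) -` ?E {v. length v < Suc n} \<inter> space M =
        {\<omega> \<in> space M. history n \<omega> \<in> ?E ?I \<and> (\<forall>v. length v = n \<longrightarrow> \<tau> v \<omega> \<in> X v \<and> g v \<omega> \<in> Y v)}"
      by (auto simp: history_def PiE_iff less_Suc_eq)
    also have "emeasure M \<dots> = (\<integral>\<^sup>+ \<omega>. indicator (?E ?I) (history n \<omega>) * (\<Prod>v\<in>?J. kernel \<omega> v (X v) (Y v)) \<partial>M)"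
      using X Y E' by (rule emeasure_generation)
    \<comment> \<open>Off a null set the kernels are functions of the history alone. The integral
      can then be carried over to the law of the history, to which the induction hypothesis
      applies.\<close>
    also have "\<dots> = (\<integral>\<^sup>+ \<omega>. indicator (?E ?I) (history n \<omega>) * (\<Prod>v\<in>?J. K (node_cell (history n \<omega>) v) v) \<partial>M)"
    proof (rule nn_integral_cong_AE)
      show "AE \<omega> in M. indicator (?E ?I) (history n \<omega>) * (\<Prod>v\<in>?J. kernel \<omega> v (X v) (Y v)) =
          indicator (?E ?I) (history n \<omega>) * (\<Prod>v\<in>?J. K (node_cell (history n \<omega>) v) v)"
        using AE_kernel_eq
      proof eventually_elim
        case (elim \<omega>)
        then have "kernel \<omega> v (X v) (Y v) = K (cell \<omega> v) v" for v
          using X[of v] Y[of v] unfolding K_def by blast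
        then show ?case by (simp add: node_cell_history)
      qed
    qed
    also have "\<dots> = (\<integral>\<^sup>+ x. indicator (?E ?I) x * (\<Prod>v\<in>?J. K (node_cell x v) v) \<partial>distr M (reference n) (history n))"
      by (rule nn_integral_distr[symmetric, OF measurable_history_reference]) (simp only: measurable_distr_eq1 h)
    also have "\<dots> = (\<integral>\<^sup>+ x. ?d n x * (indicator (?E ?I) x * (\<Prod>v\<in>?J. K (node_cell x v) v)) \<partial>reference n)"
      unfolding Suc.IH by (rule nn_integral_density[OF d h])
    also have "\<dots> = (\<integral>\<^sup>+ x. \<integral>\<^sup>+ y. ?d (Suc n) (merge ?I ?J (x, y)) * indicator (?E (?I \<union> ?J)) (merge ?I ?J (x, y))
        \<partial>(\<Pi>\<^sub>M v\<in>?J. ?R) \<partial>(\<Pi>\<^sub>M v\<in>?I. ?R))"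
    proof (intro nn_integral_cong)
      fix x :: "bool list \<Rightarrow> real \<times> (real^2) set" assume x: "x \<in> space (reference n)"
      let ?z = "\<lambda>y. merge ?I ?J (x, y)"
      let ?\<psi> = "\<lambda>v p. split_density (node_cell x v) p * indicator (X v \<times> Y v) p"
      have cs: "node_cell x v \<in> space (cell_space W)" if "length v \<le> n" for v
        using measurable_space[OF measurable_node_cell[OF that] x] .
      have xext: "x \<in> extensional ?I" using x by (simp add: space_PiM PiE_def)
      have "?d (Suc n) (?z y) * indicator (?E (?I \<union> ?J)) (?z y) =
          ?d n x * indicator (?E ?I) x * (\<Prod>v\<in>?J. ?\<psi> v (y v))" for y
      proof -
        have z: "node_cell (?z y) v = node_cell x v" if "length v \<le> n" for v
          using that by (intro tree_cell_cong) (simp add: merge_def)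
        have z_lt: "?z y v = x v" if "length v < n" for v using that by (simp add: merge_def)
        have z_eq: "?z y v = y v" if "length v = n" for v using that by (simp add: merge_def)
        have "?d (Suc n) (?z y) = ?d n x * (\<Prod>v\<in>?J. split_density (node_cell x v) (y v))"
          unfolding prod_length_less_Suc by (intro arg_cong2[of _ _ _ _ times] prod.cong) (simp_all add: z z_lt z_eq)
        moreover have "?z y \<in> ?E (?I \<union> ?J) \<longleftrightarrow> x \<in> ?E ?I \<and> (\<forall>v\<in>?J. y v \<in> X v \<times> Y v)"
          using xext unfolding PiE_iff Ball_def Un_iff mem_Collect_eq
          by (auto simp: z_lt z_eq)
        then have "(indicator (?E (?I \<union> ?J)) (?z y) :: ennreal) = indicator (?E ?I) x * (\<Prod>v\<in>?J. indicator (X v \<times> Y v) (y v))"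
          using prod_indicator[OF finite_length_eq, where A="\<lambda>v. X v \<times> Y v"]
          by (simp add: indicator_def)
        ultimately show ?thesis by (simp add: prod.distrib mult_ac)
      qed
      then have "(\<integral>\<^sup>+ y. ?d (Suc n) (?z y) * indicator (?E (?I \<union> ?J)) (?z y) \<partial>(\<Pi>\<^sub>M v\<in>?J. ?R)) =
          (\<integral>\<^sup>+ y. ?d n x * indicator (?E ?I) x * (\<Prod>v\<in>?J. ?\<psi> v (y v)) \<partial>(\<Pi>\<^sub>M v\<in>?J. ?R))"
        by simp
      also have "\<dots> = ?d n x * indicator (?E ?I) x *
          (\<integral>\<^sup>+ y. (\<Prod>v\<in>?J. ?\<psi> v (y v)) \<partial>(\<Pi>\<^sub>M v\<in>?J. ?R))"
      proof (intro nn_integral_cmult borel_measurable_prod_ennreal)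
        fix v assume v: "v \<in> ?J"
        have [measurable]: "node_cell x v \<in> space (cell_space W)" using v cs by simp
        note [measurable] = XY[of v]
        have "(\<lambda>p. ?\<psi> v p) \<in> borel_measurable ?R" by measurable
        from measurable_compose[OF measurable_component_singleton[OF v, of "\<lambda>_. ?R"] this]
        show "(\<lambda>y. ?\<psi> v (y v)) \<in> borel_measurable (\<Pi>\<^sub>M v\<in>?J. ?R)" .
      qed
      also have "(\<integral>\<^sup>+ y. (\<Prod>v\<in>?J. ?\<psi> v (y v)) \<partial>(\<Pi>\<^sub>M v\<in>?J. ?R)) =
          (\<Prod>v\<in>?J. K (node_cell x v) v)"
        unfolding K_def
      proof (rule P.product_nn_integral_prod[OF finite_length_eq])
        fix v assume v: "v \<in> ?J"
        have [measurable]: "node_cell x v \<in> space (cell_space W)" using v cs by simp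
        note [measurable] = XY[of v]
        show "(\<lambda>p. ?\<psi> v p) \<in> borel_measurable ?R" by measurable
      qed
      finally show "?d n x * (indicator (?E ?I) x * (\<Prod>v\<in>?J. K (node_cell x v) v)) =
          (\<integral>\<^sup>+ y. ?d (Suc n) (?z y) * indicator (?E (?I \<union> ?J)) (?z y) \<partial>(\<Pi>\<^sub>M v\<in>?J. ?R))"
        by (simp add: mult.assoc)
    qed
    also have "\<dots> = (\<integral>\<^sup>+ z. ?d (Suc n) z * indicator (?E (?I \<union> ?J)) z \<partial>(\<Pi>\<^sub>M v\<in>?I \<union> ?J. ?R))"
    proof (rule P.product_nn_integral_fold[symmetric])
      show "(\<lambda>z. ?d (Suc n) z * indicator (?E (?I \<union> ?J)) z) \<in> borel_measurable (\<Pi>\<^sub>M v\<in>?I \<union> ?J. ?R)"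
        using measurable_tree_density[of "Suc n"] E[of "Suc n"] unfolding length_less_Suc[of n]
        by (intro borel_measurable_times_ennreal borel_measurable_indicator)
    qed (auto intro: finite_length_less finite_length_eq)
    also have "\<dots> = emeasure (density (reference (Suc n)) (?d (Suc n))) (?E {v. length v < Suc n})"
      unfolding length_less_Suc[of n, symmetric]
      by (rule emeasure_density[symmetric, OF measurable_tree_density E])
    finally show "emeasure (?L) (?E {v. length v < Suc n}) =
        emeasure (density (reference (Suc n)) (?d (Suc n))) (?E {v. length v < Suc n})" .
  qed
qed

end

section \<open>Avoidance probabilities of the STIT tessellation\<close>

lemma stit_birth_mono:
  assumes "\<And>u. 0 \<le> \<tau> u"
  shows "stit_birth \<tau> v \<le> stit_birth \<tau> (w @ v)"
proof (induction w)
  case (Cons b w)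
  then show ?case using assms[of "w @ v"] by simp
qed simp

lemma prod_if_one_zero:
  "finite J \<Longrightarrow> (\<Prod>v\<in>J. if P v then 1 else 0 :: ennreal) = (if \<forall>v\<in>J. P v then 1 else 0)"
  by (induction J rule: finite_induct) auto

context stit_process begin

abbreviation (input) birth :: "'a \<Rightarrow> bool list \<Rightarrow> real" where
  "birth \<omega> \<equiv> stit_birth (\<lambda>u. \<tau> u \<omega>)"

definition alive :: "real \<Rightarrow> 'a \<Rightarrow> bool list \<Rightarrow> bool" where
  "alive t \<omega> v \<longleftrightarrow> birth \<omega> v \<le> t \<and> t < birth \<omega> v + \<tau> v \<omega>"

definition avoiding :: "(real^2) set \<Rightarrow> 'a \<Rightarrow> bool list \<Rightarrow> bool" where
  "avoiding U \<omega> v \<longleftrightarrow> frontier (stit_cell W (\<lambda>u. g u \<omega>) v) \<inter> U = {}"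

lemma measurable_birth[measurable]: "(\<lambda>\<omega>. birth \<omega> v) \<in> borel_measurable M"
  by (rule measurable_stit_birth) simp

lemma pred_alive[measurable]: "Measurable.pred M (\<lambda>\<omega>. alive t \<omega> v)"
  unfolding alive_def by measurable

lemma pred_avoiding:
  assumes "open U"
  shows "Measurable.pred M (\<lambda>\<omega>. avoiding U \<omega> v)"
proof -
  have [measurable]: "(\<lambda>\<omega>. cell \<omega> v) \<in> M \<rightarrow>\<^sub>M cell_space W"
    by (intro measurable_tree_cell interior_W_space) simp
  note [measurable] = measurable_avoids[OF assms, of W]
  have "Measurable.pred M (\<lambda>\<omega>. avoids U (cell \<omega> v) = 1)" by measurable
  moreover have "avoiding U \<omega> v \<longleftrightarrow> avoids U (cell \<omega> v) = 1" if "\<omega> \<in> space M" for \<omega>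
    using stit_cell_eq[of "\<lambda>u. g u \<omega>" v] g_space[OF that] by (simp add: avoiding_def avoids_def)
  ultimately show ?thesis
    using measurable_cong[of M "\<lambda>\<omega>. avoiding U \<omega> v" "\<lambda>\<omega>. avoids U (cell \<omega> v) = 1"] by blast
qed

text \<open>The value \<open>generation_value 0\<close> at the cut is the indicator that the node is
  still unborn at time \<open>t\<close>, so \<open>nn_integral_tree\<close> with
  \<open>k = 0\<close> computes the probability of precisely this event.\<close>

lemma emeasure_generation_avoiding:
  assumes U: "open U" and t: "0 \<le> t"
  shows "emeasure M {\<omega> \<in> space M. (\<forall>v. length v < n \<longrightarrow> alive t \<omega> v \<longrightarrow> avoiding U \<omega> v) \<and> (\<forall>v. length v = n \<longrightarrow> t < birth \<omega> v)} =
    cell_functional.generation_value \<mu> cell_split cell_hit rate (avoids U) n t (interior W)"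
    (is "emeasure M ?A = _")
proof -
  interpret A: cell_functional "cell_space W" \<mu> cell_split cell_hit "{}" rate "avoids U"
    using U by (rule cell_functional_avoids)
  let ?birth = "\<lambda>x. stit_birth (\<lambda>u. fst (x u))"
  let ?al = "\<lambda>x. A.alive_value (interior W) t (\<lambda>u. fst (x u)) (\<lambda>u. snd (x u))"
  let ?gv = "\<lambda>x v. A.generation_value 0 (t - ?birth x v) (node_cell x v)"
  let ?F = "\<lambda>x. (\<Prod>v | length v < n. ?al x v) * (\<Prod>v | length v = n. ?gv x v)"
  let ?d = "\<lambda>x. \<Prod>v | length v < n. split_density (node_cell x v) (x v)"
  have comp: "(\<lambda>x. fst (x v)) \<in> borel_measurable (reference n)" if "length v < n" for v :: "bool list"
  proof -
    have "(\<lambda>x. x v) \<in> reference n \<rightarrow>\<^sub>M lborel \<Otimes>\<^sub>M \<mu>"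
      using that by (intro measurable_component_singleton) simp
    then show ?thesis by (rule measurable_compose) measurable
  qed
  have birth: "(\<lambda>x. ?birth x v) \<in> borel_measurable (reference n)" if "length v \<le> n" for v
    using that by (intro measurable_stit_birth comp) simp
  have F: "?F \<in> borel_measurable (reference n)"
  proof (intro borel_measurable_times_ennreal borel_measurable_prod_ennreal)
    fix v :: "bool list" assume "v \<in> {v. length v < n}"
    then have [measurable]: "(\<lambda>x. node_cell x v) \<in> reference n \<rightarrow>\<^sub>M cell_space W"
        "(\<lambda>x. ?birth x v) \<in> borel_measurable (reference n)" "(\<lambda>x. fst (x v)) \<in> borel_measurable (reference n)"
      by (simp_all add: measurable_node_cell birth comp)
    show "(\<lambda>x. ?al x v) \<in> borel_measurable (reference n)" unfolding A.alive_value_def by measurable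
  next
    fix v :: "bool list" assume "v \<in> {v. length v = n}"
    then have [measurable]: "(\<lambda>x. node_cell x v) \<in> reference n \<rightarrow>\<^sub>M cell_space W"
        "(\<lambda>x. ?birth x v) \<in> borel_measurable (reference n)"
      by (simp_all add: measurable_node_cell birth)
    show "(\<lambda>x. ?gv x v) \<in> borel_measurable (reference n)" by measurable
  qed
  have eq: "?F (history n \<omega>) = indicator ?A \<omega>" if \<omega>: "\<omega> \<in> space M" for \<omega>
  proof -
    have b: "?birth (history n \<omega>) v = birth \<omega> v" if "length v \<le> n" for v
      using that by (intro stit_birth_cong) (simp add: history_def)
    have "?al (history n \<omega>) v = (if alive t \<omega> v \<longrightarrow> avoiding U \<omega> v then 1 else 0)" if "length v < n" for v
    proof -
      have st: "stit_cell W (\<lambda>u. g u \<omega>) v = closure (cell \<omega> v)"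
        using g_space[OF \<omega>] by (rule stit_cell_eq)
      have "fst (history n \<omega> v) = \<tau> v \<omega>" using that by (simp add: history_def)
      then show ?thesis
        using that b[of v] node_cell_history[of v n \<omega>]
        by (simp add: A.alive_value_def alive_def avoiding_def avoids_def st)
    qed
    then have "(\<Prod>v | length v < n. ?al (history n \<omega>) v) = (\<Prod>v | length v < n. if alive t \<omega> v \<longrightarrow> avoiding U \<omega> v then 1 else 0)"
      by (intro prod.cong) auto
    moreover have "(\<Prod>v | length v = n. ?gv (history n \<omega>) v) = (\<Prod>v | length v = n. if t < birth \<omega> v then 1 else 0)"
      by (intro prod.cong) (auto simp: b)
    ultimately show ?thesis
      using \<omega> by (simp add: prod_if_one_zero finite_length_less finite_length_eq indicator_def)
  qed
  have "emeasure M ?A = (\<integral>\<^sup>+ \<omega>. indicator ?A \<omega> \<partial>M)"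
  proof (rule nn_integral_indicator[symmetric])
    note [measurable] = pred_avoiding[OF U]
    show "?A \<in> sets M" by measurable
  qed
  also have "\<dots> = (\<integral>\<^sup>+ \<omega>. ?F (history n \<omega>) \<partial>M)"
    by (intro nn_integral_cong eq[symmetric])
  also have "\<dots> = (\<integral>\<^sup>+ x. ?F x \<partial>distr M (reference n) (history n))"
    by (rule nn_integral_distr[symmetric, OF measurable_history_reference]) (simp only: measurable_distr_eq1 F)
  also have "\<dots> = (\<integral>\<^sup>+ x. ?d x * ?F x \<partial>reference n)"
    unfolding distr_history by (rule nn_integral_density[OF measurable_tree_density F])
  also have "\<dots> = A.generation_value (n + 0) t (interior W)"
    using interior_W_space interior_W by (rule A.nn_integral_tree)
  finally show ?thesis by simp
qed

text \<open>If generation \<open>n\<close> is unborn at time \<open>t\<close>, all living cells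
  belong to earlier generations; so \<open>En n\<close> is almost surely contained in the event,
  which in turn exceeds it by at most the probability that some node of generation \<open>n\<close>
  is already born. That probability must be shown to vanish as \<open>n\<close> grows.\<close>

lemma emeasure_avoiding:
  assumes U: "open U" and t: "0 \<le> t"
  shows "emeasure M {\<omega> \<in> space M. \<forall>v. alive t \<omega> v \<longrightarrow> avoiding U \<omega> v} =
    cell_functional.yule_value \<mu> cell_split rate (avoids U) t (interior W)"
    (is "emeasure M ?E = _")
proof -
  interpret A: cell_functional "cell_space W" \<mu> cell_split cell_hit "{}" rate "avoids U"
    using U by (rule cell_functional_avoids)
  \<comment> \<open>Absence of explosion: the empty set is avoided by every cell, so for it only the
    condition that generation \<open>n\<close> is unborn remains, and the limit is 1 by
    \<open>yule_value_one\<close>.\<close>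
  interpret O: cell_functional "cell_space W" \<mu> cell_split cell_hit "{}" rate "avoids {}"
    by (rule cell_functional_avoids) simp
  note [measurable] = pred_avoiding[OF U]
  define En where "En n = {\<omega> \<in> space M. (\<forall>v. length v < n \<longrightarrow> alive t \<omega> v \<longrightarrow> avoiding U \<omega> v) \<and> (\<forall>v. length v = n \<longrightarrow> t < birth \<omega> v)}" for n
  define Fn where "Fn n = {\<omega> \<in> space M. \<forall>v. length v = n \<longrightarrow> t < birth \<omega> v}" for n
  have sets: "En n \<in> sets M" "Fn n \<in> sets M" "?E \<in> sets M" for n
    unfolding En_def Fn_def by measurable
  have En: "(\<lambda>n. emeasure M (En n)) \<longlonglongrightarrow> A.yule_value t (interior W)"
    unfolding En_def emeasure_generation_avoiding[OF U t]
    using interior_W_space t by (rule A.generation_value_tendsto)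
  have "(\<lambda>n. emeasure M (Fn n)) \<longlonglongrightarrow> O.yule_value t (interior W)"
  proof -
    have "Fn n = {\<omega> \<in> space M. (\<forall>v. length v < n \<longrightarrow> alive t \<omega> v \<longrightarrow> avoiding {} \<omega> v) \<and> (\<forall>v. length v = n \<longrightarrow> t < birth \<omega> v)}" for n
      by (simp add: Fn_def avoiding_def)
    then have "emeasure M (Fn n) = O.generation_value n t (interior W)" for n
      using emeasure_generation_avoiding[of "{}" t n] t by simp
    then show ?thesis
      using O.generation_value_tendsto[OF interior_W_space t] by simp
  qed
  also have "O.yule_value t (interior W) = 1"
    using interior_W_space t by (intro O.yule_value_one) (auto simp: avoids_def)
  finally have "(\<lambda>n. ennreal (measure M (Fn n))) \<longlonglongrightarrow> ennreal 1"
    by (simp add: M.emeasure_eq_measure)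
  then have "(\<lambda>n. measure M (Fn n)) \<longlonglongrightarrow> 1" by (subst (asm) tendsto_ennreal_iff) auto
  then have "(\<lambda>n. 1 - measure M (Fn n)) \<longlonglongrightarrow> 1 - 1" by (intro tendsto_intros)
  then have "(\<lambda>n. measure M (space M - Fn n)) \<longlonglongrightarrow> 0" using sets by (simp add: M.prob_compl)
  then have "(\<lambda>n. ennreal (measure M (space M - Fn n))) \<longlonglongrightarrow> ennreal 0" by (rule tendsto_ennrealI)
  then have Fn: "(\<lambda>n. emeasure M (space M - Fn n)) \<longlonglongrightarrow> 0" by (simp add: M.emeasure_eq_measure)
  have "emeasure M (En n) \<le> emeasure M ?E" for n
  proof (rule emeasure_mono_AE)
    show "AE \<omega> in M. \<omega> \<in> En n \<longrightarrow> \<omega> \<in> ?E"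
      using AE_\<tau>_nonneg
    proof eventually_elim
      case (elim \<omega>)
      show ?case
      proof
        assume \<omega>: "\<omega> \<in> En n"
        have "\<not> alive t \<omega> v" if "n \<le> length v" for v
        proof -
          let ?w = "take (length v - n) v" and ?u = "drop (length v - n) v"
          have "length ?u = n" using that by simp
          then have "t < birth \<omega> ?u" using \<omega> unfolding En_def by blast
          also have "\<dots> \<le> birth \<omega> (?w @ ?u)" using elim by (intro stit_birth_mono) simp
          finally show ?thesis by (simp add: alive_def)
        qed
        then have "avoiding U \<omega> v" if "alive t \<omega> v" for v
          using \<omega> that unfolding En_def by (cases "length v < n") auto
        then show "\<omega> \<in> ?E" using \<omega> unfolding En_def by simp
      qed
    qed
  qed (rule sets)
  then have 1: "A.yule_value t (interior W) \<le> emeasure M ?E"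
    by (intro LIMSEQ_le_const2[OF En]) auto
  have "emeasure M ?E \<le> emeasure M (En n) + emeasure M (space M - Fn n)" for n
  proof -
    have "?E \<subseteq> En n \<union> (space M - Fn n)" unfolding En_def Fn_def by auto
    then have "emeasure M ?E \<le> emeasure M (En n \<union> (space M - Fn n))" using sets by (intro emeasure_mono) auto
    also have "\<dots> \<le> emeasure M (En n) + emeasure M (space M - Fn n)" using sets by (intro emeasure_subadditive) auto
    finally show ?thesis .
  qed
  then have "emeasure M ?E \<le> A.yule_value t (interior W) + 0"
    by (intro LIMSEQ_le_const[OF tendsto_add[OF En Fn]]) auto
  with 1 show ?thesis by simp
qed

end

section \<open>The law of the Mecke process\<close>

lemma distr_pair_indep_rv:
  assumes N: "prob_space N" and indep: "indep_rv N A X B Y"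
  shows "distr N (A \<Otimes>\<^sub>M B) (\<lambda>\<omega>. (X \<omega>, Y \<omega>)) = distr N A X \<Otimes>\<^sub>M distr N B Y"
proof -
  interpret N: prob_space N by (rule N)
  have X[measurable]: "X \<in> N \<rightarrow>\<^sub>M A" and Y[measurable]: "Y \<in> N \<rightarrow>\<^sub>M B"
    and i: "N.indep_set {X -` S \<inter> space N | S. S \<in> sets A} {Y -` S \<inter> space N | S. S \<in> sets B}"
    using indep by (auto simp: indep_rv_def)
  show ?thesis
  proof (rule pair_measure_eqI[symmetric])
    show "sigma_finite_measure (distr N A X)" "sigma_finite_measure (distr N B Y)"
      by (intro prob_space_imp_sigma_finite N.prob_space_distr X Y)+
    fix S T assume "S \<in> sets (distr N A X)" "T \<in> sets (distr N B Y)"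
    then have ST[measurable]: "S \<in> sets A" "T \<in> sets B" by auto
    have "N.prob ((X -` S \<inter> space N) \<inter> (Y -` T \<inter> space N)) = N.prob (X -` S \<inter> space N) * N.prob (Y -` T \<inter> space N)"
      by (rule N.indep_setD[OF i]) (use ST in blast)+
    moreover have "(\<lambda>\<omega>. (X \<omega>, Y \<omega>)) -` (S \<times> T) \<inter> space N = (X -` S \<inter> space N) \<inter> (Y -` T \<inter> space N)"
      by auto
    ultimately show "emeasure (distr N A X) S * emeasure (distr N B Y) T =
        emeasure (distr N (A \<Otimes>\<^sub>M B) (\<lambda>\<omega>. (X \<omega>, Y \<omega>))) (S \<times> T)"
      by (simp add: emeasure_distr N.emeasure_eq_measure ennreal_mult')
  qed simp
qed

lemma frontier_Int_cong:
  assumes "open U" "A \<inter> U = B \<inter> U"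
  shows "frontier A \<inter> U = frontier B \<inter> U"
proof -
  have sub: "frontier A \<inter> U \<subseteq> frontier B" if AB: "A \<inter> U = B \<inter> U" for A B
  proof
    fix x assume x: "x \<in> frontier A \<inter> U"
    have "x \<in> closure (A \<inter> U)"
      using x open_Int_closure_subset[OF assms(1), of A] by (auto simp: frontier_def Int_commute)
    then have "x \<in> closure B" unfolding AB using closure_mono[of "B \<inter> U" B] by auto
    moreover have "x \<notin> interior B"
    proof
      assume "x \<in> interior B"
      then have "x \<in> interior (A \<inter> U)" unfolding AB interior_Int using x assms(1) by (simp add: interior_open)
      then show False using x by (simp add: frontier_def interior_Int)
    qed
    ultimately show "x \<in> frontier B" by (simp add: frontier_def)
  qed
  show ?thesis using sub[OF assms(2)] sub[OF assms(2)[symmetric]] by blast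
qed

lemma quasi_cell_subset: "quasi_cell V x a n j \<subseteq> V"
  by (induction V x a n j rule: quasi_cell.induct) (auto simp: Let_def)

text \<open>The choice of half-planes does not depend on the window, so shrinking the window just
  intersects every quasi-cell with it.\<close>

lemma quasi_cell_Int: "V \<subseteq> V' \<Longrightarrow> quasi_cell V' x a n j \<inter> V = quasi_cell V x a n j"
proof (induction V' x a n j rule: quasi_cell.induct)
  case (3 W \<gamma> \<alpha> m j)
  have "quasi_cell W \<gamma> \<alpha> (Suc m) i \<inter> H \<inter> V = quasi_cell W \<gamma> \<alpha> (Suc m) i \<inter> V \<inter> H" for i H by blast
  then show ?case using 3 by (simp add: Let_def)
qed auto

lemma open_quasi_cell:
  assumes "open V" "\<And>i. 1 \<le> i \<Longrightarrow> x i \<in> space line_space"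
  shows "open (quasi_cell V x a n j)"
  using assms
  by (induction V x a n j rule: quasi_cell.induct) (auto simp: Let_def intro: open_Int_half_plane)

lemma convex_quasi_cell:
  assumes "convex V" "\<And>i. 1 \<le> i \<Longrightarrow> x i \<in> space line_space \<and> 0 \<notin> x i"
  shows "convex (quasi_cell V x a n j)"
  using assms
  by (induction V x a n j rule: quasi_cell.induct) (simp_all add: Let_def convex_Int convex_half_plane)

context line_measure begin

lemma urn_cell_eq: "urn_cell C x a n j = quasi_cell C x a n j"
proof (induction n arbitrary: j)
  case 0
  show ?case unfolding urn_cell.simps quasi_cell.simps ..
next
  case (Suc n)
  show ?case
  proof (cases n)
    case 0
    show ?thesis unfolding 0 urn_cell.simps quasi_cell.simps unfolding cell_split_def ..
  next
    case (Suc m)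
    have "urn_cell C x a (Suc n) j = (let k = Suc n in
        if j = k + 1 then cell_split True (quasi_cell C x a n (a k)) (x k)
        else if j = a k then cell_split False (quasi_cell C x a n (a k)) (x k)
        else quasi_cell C x a n j)"
      unfolding Suc urn_cell.simps unfolding Suc[symmetric] Suc.IH Let_def by (simp only: Suc_eq_plus1)
    also have "\<dots> = quasi_cell C x a (Suc n) j"
      unfolding Suc quasi_cell.simps cell_split_def ..
    finally show ?thesis .
  qed
qed

text \<open>\<open>U\<close> misses the boundary of \<open>W\<close>, so inside \<open>U\<close> the
  quasi-cells started from \<open>W\<close> and from its interior coincide. An open convex cell has
  the same frontier as its closure; convexity is why lines through the origin are excluded.\<close>

lemma urn_cell_eq_interior:
  assumes "\<And>i. 1 \<le> i \<Longrightarrow> x i \<in> space line_space" "open U" "U \<inter> frontier W = {}"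
    and "\<And>i. 1 \<le> i \<Longrightarrow> 0 \<notin> x i"
  shows "frontier (quasi_cell W x a n j) \<inter> U = {} \<longleftrightarrow> avoids U (urn_cell (interior W) x a n j) = 1"
proof -
  let ?Q = "quasi_cell W x a n j" and ?C = "quasi_cell (interior W) x a n j"
  have "W \<inter> U \<subseteq> interior W"
    using assms(3) compact_imp_closed[OF compact_W] by (auto simp: frontier_def)
  then have "?Q \<inter> U = ?C \<inter> U"
    using quasi_cell_Int[OF interior_subset, of W x a n j] quasi_cell_subset[of W x a n j] quasi_cell_subset[of "interior W" x a n j]
    by blast
  then have "frontier ?Q \<inter> U = frontier ?C \<inter> U" using assms(2) by (intro frontier_Int_cong)
  also have "frontier ?C = frontier (closure ?C)"
  proof -
    have "convex ?C" using assms(1,4) convex_W by (intro convex_quasi_cell convex_interior) auto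
    then show ?thesis by (simp add: frontier_def convex_interior_closure)
  qed
  finally show ?thesis by (simp add: avoids_def urn_cell_eq)
qed

end

section \<open>Joint law of lines and choices\<close>

locale mecke_process = line_measure +
  fixes N :: "'b measure" and \<gamma> :: "nat \<Rightarrow> 'b \<Rightarrow> (real^2) set" and \<alpha> :: "nat \<Rightarrow> 'b \<Rightarrow> nat"
  assumes mecke: "mecke_model \<Lambda> W N \<gamma> \<alpha>"
begin

sublocale N: prob_space N
  using mecke by (simp add: mecke_model_def)

lemma indep_\<gamma>: "N.indep_vars (\<lambda>_. line_space) \<gamma> {1..}"
  and distr_\<gamma>: "1 \<le> j \<Longrightarrow> distr N line_space (\<gamma> j) = \<mu>"
  and indep_\<alpha>: "N.indep_vars (\<lambda>_. count_space UNIV) \<alpha> {1..}"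
  and distr_\<alpha>: "1 \<le> j \<Longrightarrow> distr N (count_space UNIV) (\<alpha> j) = measure_pmf (pmf_of_set {1..j})"
  and indep_\<gamma>_\<alpha>: "indep_rv N (\<Pi>\<^sub>M j\<in>{1..}. line_space) (\<lambda>\<omega>. \<lambda>j\<in>{1..}. \<gamma> j \<omega>)
       (\<Pi>\<^sub>M j\<in>{1..}. count_space UNIV) (\<lambda>\<omega>. \<lambda>j\<in>{1..}. \<alpha> j \<omega>)"
  using mecke unfolding mecke_model_def \<mu>_def by auto

lemma measurable_\<gamma>: "1 \<le> j \<Longrightarrow> \<gamma> j \<in> N \<rightarrow>\<^sub>M line_space"
  using indep_\<gamma> by (auto simp: N.indep_vars_def)

lemma measurable_\<alpha>: "1 \<le> j \<Longrightarrow> \<alpha> j \<in> N \<rightarrow>\<^sub>M count_space UNIV"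
  using indep_\<alpha> by (auto simp: N.indep_vars_def)

lemma \<gamma>_space: "\<omega> \<in> space N \<Longrightarrow> 1 \<le> j \<Longrightarrow> \<gamma> j \<omega> \<in> space line_space"
  using measurable_\<gamma> by (rule measurable_space)

abbreviation (input) line_seqs :: "(nat \<Rightarrow> (real^2) set) measure" where
  "line_seqs \<equiv> (\<Pi>\<^sub>M j\<in>{1..}. line_space)"

abbreviation (input) choice_seqs :: "(nat \<Rightarrow> nat) measure" where
  "choice_seqs \<equiv> (\<Pi>\<^sub>M j\<in>{1..}. count_space UNIV)"

definition inputs :: "'b \<Rightarrow> (nat \<Rightarrow> (real^2) set) \<times> (nat \<Rightarrow> nat)" where
  "inputs \<omega> = (\<lambda>j\<in>{1..}. \<gamma> j \<omega>, \<lambda>j\<in>{1..}. \<alpha> j \<omega>)"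

lemma distr_inputs:
  "distr N (line_seqs \<Otimes>\<^sub>M choice_seqs) inputs =
    (\<Pi>\<^sub>M j\<in>{1..}. \<mu>) \<Otimes>\<^sub>M (\<Pi>\<^sub>M j\<in>{1..}. measure_pmf (pmf_of_set {1..j}))"
proof -
  have "distr N (line_seqs \<Otimes>\<^sub>M choice_seqs) inputs =
      distr N line_seqs (\<lambda>\<omega>. \<lambda>j\<in>{1..}. \<gamma> j \<omega>) \<Otimes>\<^sub>M distr N choice_seqs (\<lambda>\<omega>. \<lambda>j\<in>{1..}. \<alpha> j \<omega>)"
    unfolding inputs_def[abs_def] by (rule distr_pair_indep_rv[OF N.prob_space_axioms indep_\<gamma>_\<alpha>])
  also have "distr N line_seqs (\<lambda>\<omega>. \<lambda>j\<in>{1..}. \<gamma> j \<omega>) = (\<Pi>\<^sub>M j\<in>{1..}. distr N line_space (\<gamma> j))"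
    using indep_\<gamma> measurable_\<gamma> by (subst (asm) N.indep_vars_iff_distr_eq_PiM') auto
  also have "\<dots> = (\<Pi>\<^sub>M j\<in>{1..}. \<mu>)"
    by (intro PiM_cong refl distr_\<gamma>) simp
  also have "distr N choice_seqs (\<lambda>\<omega>. \<lambda>j\<in>{1..}. \<alpha> j \<omega>) = (\<Pi>\<^sub>M j\<in>{1..}. distr N (count_space UNIV) (\<alpha> j))"
    using indep_\<alpha> measurable_\<alpha> by (subst (asm) N.indep_vars_iff_distr_eq_PiM') auto
  also have "\<dots> = (\<Pi>\<^sub>M j\<in>{1..}. measure_pmf (pmf_of_set {1..j}))"
    by (intro PiM_cong refl distr_\<alpha>) simp
  finally show ?thesis .
qed

lemma measurable_inputs[measurable]: "inputs \<in> N \<rightarrow>\<^sub>M line_seqs \<Otimes>\<^sub>M choice_seqs"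
  using indep_\<gamma>_\<alpha> unfolding inputs_def[abs_def] indep_rv_def by (intro measurable_Pair) auto

lemma measurable_urn_cell_inputs:
  "(\<lambda>p. urn_cell (interior W) (fst p) (snd p) n j) \<in> line_seqs \<Otimes>\<^sub>M choice_seqs \<rightarrow>\<^sub>M cell_space W"
proof (rule measurable_urn_cell[OF interior_W_space])
  fix i assume "i \<in> {1..n}"
  then have i: "i \<in> {1..}" by simp
  show "(\<lambda>p. fst p i) \<in> line_seqs \<Otimes>\<^sub>M choice_seqs \<rightarrow>\<^sub>M \<mu>"
    using measurable_compose[OF measurable_fst measurable_component_singleton[OF i]]
    by (subst measurable_cong_sets[OF refl sets_\<mu>])
  show "(\<lambda>p. snd p i) \<in> line_seqs \<Otimes>\<^sub>M choice_seqs \<rightarrow>\<^sub>M count_space UNIV"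
    using measurable_compose[OF measurable_snd measurable_component_singleton[OF i]] .
qed

lemma nn_integral_inputs:
  assumes U: "open U"
  shows "(\<integral>\<^sup>+ \<omega>. (\<Prod>j\<in>{1..Suc n}. avoids U (urn_cell (interior W) (fst (inputs \<omega>)) (snd (inputs \<omega>)) n j)) \<partial>N) =
    cell_functional.urn_value \<mu> cell_split (avoids U) n (interior W)"
proof -
  interpret A: cell_functional "cell_space W" \<mu> cell_split cell_hit "{}" rate "avoids U"
    using U by (rule cell_functional_avoids)
  let ?F = "\<lambda>x a. \<Prod>j\<in>{1..Suc n}. avoids U (urn_cell (interior W) x a n j)"
  let ?U = "\<lambda>j. measure_pmf (pmf_of_set {1..j :: nat})"
  let ?Pn = "\<Pi>\<^sub>M j\<in>{1..n}. \<mu>" and ?Qn = "\<Pi>\<^sub>M j\<in>{1..n}. ?U j"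
  let ?P = "\<Pi>\<^sub>M j\<in>{1..}. \<mu>" and ?Q = "\<Pi>\<^sub>M j\<in>{1..}. ?U j"
  interpret P: product_prob_space "\<lambda>_ :: nat. \<mu>" "{1..}" by standard
  interpret Q: product_prob_space ?U "{1..}" by standard
  interpret PP: prob_space ?P by (rule prob_space_PiM) (rule \<mu>.prob_space_axioms)
  interpret QQ: prob_space ?Q by (rule prob_space_PiM) (rule measure_pmf.prob_space_axioms)
  interpret PQ: pair_prob_space ?P ?Q ..
  have meas: "(\<lambda>p. ?F (fst p) (snd p)) \<in> borel_measurable (line_seqs \<Otimes>\<^sub>M choice_seqs)"
    by (intro borel_measurable_prod_ennreal measurable_compose[OF measurable_urn_cell_inputs measurable_avoids[OF U]])
  have sets_eq: "sets (?P \<Otimes>\<^sub>M ?Q) = sets (line_seqs \<Otimes>\<^sub>M choice_seqs)"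
    by (intro sets_pair_measure_cong sets_PiM_cong refl) (simp_all add: sets_\<mu>)
  have meas': "(\<lambda>(x, a). ?F x a) \<in> borel_measurable (?P \<Otimes>\<^sub>M ?Q)"
    using meas unfolding split_beta' by (simp only: measurable_cong_sets[OF sets_eq refl])
  \<comment> \<open>Only the first \<open>n\<close> lines and choices matter after \<open>n\<close>
    decisions, so the infinite products can be projected to finite ones.\<close>
  have local: "?F (restrict x {1..n}) (restrict a {1..n}) = ?F x a" for x a
    by (intro prod.cong refl arg_cong[where f="avoids U"] urn_cell_cong) auto
  have cell': "(\<lambda>x. urn_cell (interior W) (x :: nat \<Rightarrow> (real^2) set) a n j) \<in> ?Pn \<rightarrow>\<^sub>M cell_space W" for a j
    by (intro measurable_urn_cell[OF interior_W_space]) simp_all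
  have F': "(\<lambda>x. ?F x a) \<in> borel_measurable ?Pn" for a
    by (intro borel_measurable_prod_ennreal measurable_compose[OF cell' measurable_avoids[OF U]])
  have "(\<integral>\<^sup>+ \<omega>. ?F (fst (inputs \<omega>)) (snd (inputs \<omega>)) \<partial>N) = (\<integral>\<^sup>+ p. ?F (fst p) (snd p) \<partial>distr N (line_seqs \<Otimes>\<^sub>M choice_seqs) inputs)"
    by (rule nn_integral_distr[symmetric, OF measurable_inputs]) (simp only: measurable_distr_eq1 meas)
  also have "\<dots> = (\<integral>\<^sup>+ a. \<integral>\<^sup>+ x. ?F x a \<partial>?P \<partial>?Q)"
    unfolding distr_inputs using PQ.nn_integral_snd[OF meas'] by (simp add: split_beta')
  also have "\<dots> = (\<integral>\<^sup>+ a. \<integral>\<^sup>+ x. ?F x a \<partial>?Pn \<partial>?Q)"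
  proof (intro nn_integral_cong)
    fix a
    have "(\<integral>\<^sup>+ x. ?F x a \<partial>?Pn) = (\<integral>\<^sup>+ x. ?F x a \<partial>distr ?P ?Pn (\<lambda>x. restrict x {1..n}))"
      by (subst P.distr_PiM_restrict_finite) auto
    also have "\<dots> = (\<integral>\<^sup>+ x. ?F (restrict x {1..n}) a \<partial>?P)"
      by (rule nn_integral_distr, rule measurable_restrict_subset) (simp, simp only: measurable_distr_eq1 F')
    also have "\<dots> = (\<integral>\<^sup>+ x. ?F x a \<partial>?P)"
    proof (intro nn_integral_cong)
      fix x show "?F (restrict x {1..n}) a = ?F x a"
        using local[of x a] local[of "restrict x {1..n}" a] by simp
    qed
    finally show "(\<integral>\<^sup>+ x. ?F x a \<partial>?P) = (\<integral>\<^sup>+ x. ?F x a \<partial>?Pn)" by simp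
  qed
  also have "\<dots> = (\<integral>\<^sup>+ a. \<integral>\<^sup>+ x. ?F x a \<partial>?Pn \<partial>?Qn)"
  proof -
    interpret PI: finite_product_sigma_finite "\<lambda>_ :: nat. \<mu>" "{1..n}" by standard simp
    let ?G = "\<lambda>a. \<integral>\<^sup>+ x. ?F x a \<partial>?Pn"
    have "(\<lambda>p. urn_cell (interior W) (snd p) (fst p) n j) \<in> ?Qn \<Otimes>\<^sub>M ?Pn \<rightarrow>\<^sub>M cell_space W" for j
    proof (rule measurable_urn_cell[OF interior_W_space])
      fix i assume i: "i \<in> {1..n}"
      show "(\<lambda>p. snd p i) \<in> ?Qn \<Otimes>\<^sub>M ?Pn \<rightarrow>\<^sub>M \<mu>"
        using measurable_compose[OF measurable_snd measurable_component_singleton[OF i]] .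
      show "(\<lambda>p. fst p i) \<in> ?Qn \<Otimes>\<^sub>M ?Pn \<rightarrow>\<^sub>M count_space UNIV"
        using measurable_compose[OF measurable_fst measurable_component_singleton[OF i, of ?U]] by simp
    qed
    then have "(\<lambda>(a, x). ?F x a) \<in> borel_measurable (?Qn \<Otimes>\<^sub>M ?Pn)"
      unfolding split_beta' by (intro borel_measurable_prod_ennreal measurable_compose[OF _ measurable_avoids[OF U]])
    then have G: "?G \<in> borel_measurable ?Qn"
      by (rule PI.borel_measurable_nn_integral)
    have "(\<integral>\<^sup>+ a. ?G a \<partial>?Qn) = (\<integral>\<^sup>+ a. ?G a \<partial>distr ?Q ?Qn (\<lambda>a. restrict a {1..n}))"
      by (subst Q.distr_PiM_restrict_finite) auto
    also have "\<dots> = (\<integral>\<^sup>+ a. ?G (restrict a {1..n}) \<partial>?Q)"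
      by (rule nn_integral_distr, rule measurable_restrict_subset) (simp, simp only: measurable_distr_eq1 G)
    also have "\<dots> = (\<integral>\<^sup>+ a. ?G a \<partial>?Q)"
    proof (intro nn_integral_cong)
      fix x a show "?F x (restrict a {1..n}) = ?F x a"
        using local[of x a] local[of x "restrict a {1..n}"] by simp
    qed
    finally show ?thesis by simp
  qed
  also have "\<dots> = A.urn_value n (interior W)"
    using interior_W_space by (rule A.nn_integral_urn_cells)
  finally show ?thesis .
qed

end

section \<open>Measurability of events about quasi-cells\<close>

lemma ball_subset_half_plane:
  assumes "g \<in> space line_space" "0 < r"
  shows "ball q r \<subseteq> half_plane b g \<longleftrightarrow> q \<in> half_plane b g \<and> g \<notin> hitting (ball q r)"
proof
  assume sub: "ball q r \<subseteq> half_plane b g"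
  have "q \<in> ball q r" using assms(2) by simp
  with sub have "q \<in> half_plane b g" by blast
  moreover have "half_plane b g \<inter> g = {}" by (auto simp: half_plane_def)
  with sub have "g \<notin> hitting (ball q r)" unfolding hitting_def by blast
  ultimately show "q \<in> half_plane b g \<and> g \<notin> hitting (ball q r)" ..
next
  assume *: "q \<in> half_plane b g \<and> g \<notin> hitting (ball q r)"
  then have sub: "ball q r \<subseteq> half_plane True g \<union> half_plane False g"
    using assms(1) unfolding hitting_def half_plane_Un by blast
  have "half_plane True g \<inter> half_plane False g \<inter> ball q r = {}" using half_plane_disjoint[of g] by blast
  then have "half_plane True g \<inter> ball q r = {} \<or> half_plane False g \<inter> ball q r = {}"
    using connectedD[OF connected_ball open_half_plane[OF assms(1)] open_half_plane[OF assms(1)] _ sub] by blast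
  moreover have "half_plane b g \<inter> ball q r \<noteq> {}" 
  proof -
    have "q \<in> half_plane b g \<inter> ball q r" using assms(2) * by simp
    then show ?thesis by blast
  qed
  ultimately have disj: "half_plane (\<not> b) g \<inter> ball q r = {}" by (cases b) auto
  show "ball q r \<subseteq> half_plane b g"
  proof
    fix x assume x: "x \<in> ball q r"
    then have "x \<in> half_plane b g \<or> x \<in> half_plane (\<not> b) g" using sub by (cases b) auto
    with x disj show "x \<in> half_plane b g" by (auto simp del: mem_ball)
  qed
qed

context mecke_process begin

abbreviation (input) quasi :: "(real^2) set \<Rightarrow> 'b \<Rightarrow> nat \<Rightarrow> nat \<Rightarrow> (real^2) set" where
  "quasi V \<omega> n j \<equiv> quasi_cell V (\<lambda>i. \<gamma> i \<omega>) (\<lambda>i. \<alpha> i \<omega>) n j"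

text \<open>Every quasi-cell is empty or the window cut by half-planes, so a property that splits
  over intersections is measurable once it is so for half-planes. Membership of a point and
  inclusion of a ball are of this kind.\<close>

lemma pred_quasi:
  assumes P: "\<And>A B. P (A \<inter> B) \<longleftrightarrow> P A \<and> P B"
    and half: "\<And>b. Measurable.pred line_space (\<lambda>g. P (half_plane b g))"
  shows "Measurable.pred N (\<lambda>\<omega>. P (quasi V \<omega> n j))"
proof (induction n arbitrary: j)
  case 0
  show ?case by simp
next
  case (Suc n)
  have \<gamma>[measurable]: "Measurable.pred N (\<lambda>\<omega>. P (half_plane b (\<gamma> i \<omega>)))" if "1 \<le> i" for b i
    using measurable_compose[OF measurable_\<gamma>[OF that] half] .
  have [measurable]: "\<alpha> (Suc n) \<in> N \<rightarrow>\<^sub>M count_space UNIV"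
    by (rule measurable_\<alpha>) simp
  have [measurable]: "Measurable.pred N (\<lambda>\<omega>. P (quasi V \<omega> n (\<alpha> (Suc n) \<omega>)))"
    by (rule measurable_compose_countable[where f="\<lambda>j \<omega>. P (quasi V \<omega> n j)", OF Suc.IH]) measurable
  have if_P: "P (if c then A else B) \<longleftrightarrow> (if c then P A else P B)" for c A B by simp
  show ?case
  proof (cases n)
    case 0
    have [measurable]: "Measurable.pred N (\<lambda>\<omega>. P (half_plane b (\<gamma> 1 \<omega>)))" for b
      by (rule \<gamma>) simp
    show ?thesis
      unfolding 0 quasi_cell.simps if_P P by measurable
  next
    case (Suc m)
    have [measurable]: "Measurable.pred N (\<lambda>\<omega>. P (quasi V \<omega> (Suc m) j))"
      "Measurable.pred N (\<lambda>\<omega>. P (quasi V \<omega> (Suc m) (\<alpha> (Suc (Suc m)) \<omega>)))"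
      "Measurable.pred N (\<lambda>\<omega>. P (half_plane b (\<gamma> (Suc (Suc m)) \<omega>)))"
      "\<alpha> (Suc (Suc m)) \<in> N \<rightarrow>\<^sub>M count_space UNIV" for b
      using Suc.IH[of j] \<open>Measurable.pred N (\<lambda>\<omega>. P (quasi V \<omega> n (\<alpha> (Suc n) \<omega>)))\<close> \<gamma>[of "Suc (Suc m)" b]
        \<open>\<alpha> (Suc n) \<in> N \<rightarrow>\<^sub>M count_space UNIV\<close>
      unfolding Suc by simp_all
    show ?thesis
      unfolding Suc quasi_cell.simps Let_def if_P P by measurable
  qed
qed

lemma pred_mem_quasi: "Measurable.pred N (\<lambda>\<omega>. x \<in> quasi V \<omega> n j)"
  by (rule pred_quasi) auto

lemma pred_ball_subset_quasi:
  assumes "0 < r"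
  shows "Measurable.pred N (\<lambda>\<omega>. ball q r \<subseteq> quasi V \<omega> n j)"
proof (rule pred_quasi)
  fix b
  have "Measurable.pred line_space (\<lambda>g. q \<in> half_plane b g \<and> g \<notin> hitting (ball q r))" by measurable
  then show "Measurable.pred line_space (\<lambda>g. ball q r \<subseteq> half_plane b g)"
    using measurable_cong[of line_space "\<lambda>g. ball q r \<subseteq> half_plane b g"
        "\<lambda>g. q \<in> half_plane b g \<and> g \<notin> hitting (ball q r)"] ball_subset_half_plane[OF _ assms] by blast
qed blast

text \<open>Meeting a ball does not split over intersections. But the half-planes and the ball are
  open, and an open set meets \<open>W\<close> iff it meets the interior, \<open>W\<close> being the
  closure of its interior; for the open quasi-cells, countably many points decide.\<close>

lemma pred_quasi_meets_ball: "Measurable.pred N (\<lambda>\<omega>. quasi W \<omega> n j \<inter> ball q r \<noteq> {})"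
proof -
  have "Measurable.pred N (\<lambda>\<omega>. quasi (interior W) \<omega> n j \<inter> ball q r \<noteq> {})"
  proof (rule pred_nonempty)
    show "open (quasi (interior W) \<omega> n j \<inter> ball q r)" if "\<omega> \<in> space N" for \<omega>
      using \<gamma>_space[OF that] by (intro open_Int open_quasi_cell) auto
    show "Measurable.pred N (\<lambda>\<omega>. x \<in> quasi (interior W) \<omega> n j \<inter> ball q r)" for x
      using pred_mem_quasi[of x "interior W" n j] unfolding Int_iff by measurable
  qed
  moreover have "quasi (interior W) \<omega> n j \<inter> ball q r \<noteq> {} \<longleftrightarrow> quasi W \<omega> n j \<inter> ball q r \<noteq> {}"
    if "\<omega> \<in> space N" for \<omega>
  proof -
    let ?O = "quasi UNIV \<omega> n j \<inter> ball q r"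
    have "open ?O" using \<gamma>_space[OF that] by (intro open_Int open_quasi_cell) auto
    then have "?O \<inter> W = {} \<longleftrightarrow> ?O \<inter> interior W = {}"
      using open_Int_closure_eq_empty[of ?O "interior W"] W_eq_closure by simp
    moreover have eq: "quasi V \<omega> n j \<inter> ball q r = ?O \<inter> V" for V
      using quasi_cell_Int[of V UNIV "\<lambda>i. \<gamma> i \<omega>" "\<lambda>i. \<alpha> i \<omega>" n j] by blast
    ultimately show ?thesis unfolding eq[of W] eq[of "interior W"] by blast
  qed
  ultimately show ?thesis
    using measurable_cong[of N "\<lambda>\<omega>. quasi W \<omega> n j \<inter> ball q r \<noteq> {}" "\<lambda>\<omega>. quasi (interior W) \<omega> n j \<inter> ball q r \<noteq> {}"]
    by blast
qed

text \<open>Measurability must hold on \<open>N\<close> itself, which need not be complete. It is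
  therefore proved directly for quasi-cells, for all outcomes, and not through the almost sure
  description in \<open>AE_avoiding_iff\<close>.\<close>

lemma pred_quasi_avoiding:
  assumes U: "open U"
  shows "Measurable.pred N (\<lambda>\<omega>. frontier (quasi W \<omega> n j) \<inter> U = {})"
proof -
  obtain D :: "(real^2) set" where D: "countable D" "\<And>X. open X \<Longrightarrow> X \<noteq> {} \<Longrightarrow> \<exists>d\<in>D. d \<in> X"
    using countable_dense_plane by blast
  have *: "frontier A \<inter> U = {} \<longleftrightarrow> \<not> (\<exists>q\<in>D. \<exists>n. ball q (1 / real (Suc n)) \<subseteq> U \<and>
      A \<inter> ball q (1 / real (Suc n)) \<noteq> {} \<and> \<not> ball q (1 / real (Suc n)) \<subseteq> A)" for A
    using frontier_Int_open_iff[OF D(1) _ U, of A] D(2) by blast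
  note [measurable] = D(1) pred_quasi_meets_ball
  have [measurable]: "Measurable.pred N (\<lambda>\<omega>. ball q (1 / real (Suc k)) \<subseteq> quasi W \<omega> n j)" for q k
    by (rule pred_ball_subset_quasi) simp
  show ?thesis unfolding * by measurable
qed

lemma AE_\<gamma>_origin: "AE \<omega> in N. \<forall>i\<in>{1..}. 0 \<notin> \<gamma> i \<omega>"
proof -
  have "AE \<omega> in N. 0 \<notin> \<gamma> i \<omega>" if i: "1 \<le> i" for i
  proof -
    have "AE g in distr N line_space (\<gamma> i). 0 \<notin> g"
      unfolding distr_\<gamma>[OF i] using AE_\<mu>I[OF AE_\<Lambda>_origin] .
    then show ?thesis by (rule AE_distrD[OF measurable_\<gamma>[OF i]])
  qed
  then show ?thesis by (subst AE_ball_countable) auto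
qed

lemma AE_avoiding_iff:
  assumes "open U" "U \<inter> frontier W = {}"
  shows "AE \<omega> in N. \<forall>n. (\<forall>j\<in>{1..n + 1}. frontier (quasi W \<omega> n j) \<inter> U = {}) \<longleftrightarrow>
    (\<Prod>j\<in>{1..Suc n}. avoids U (urn_cell (interior W) (fst (inputs \<omega>)) (snd (inputs \<omega>)) n j)) = 1"
  using AE_\<gamma>_origin AE_space
proof eventually_elim
  case (elim \<omega>)
  show ?case
  proof
    fix n
    have "urn_cell (interior W) (fst (inputs \<omega>)) (snd (inputs \<omega>)) n j = urn_cell (interior W) (\<lambda>i. \<gamma> i \<omega>) (\<lambda>i. \<alpha> i \<omega>) n j" for j
      by (rule urn_cell_cong) (simp add: inputs_def)
    moreover have "frontier (quasi W \<omega> n j) \<inter> U = {} \<longleftrightarrow> avoids U (urn_cell (interior W) (\<lambda>i. \<gamma> i \<omega>) (\<lambda>i. \<alpha> i \<omega>) n j) = 1" for j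
      using \<gamma>_space[OF elim(2)] elim(1) assms by (intro urn_cell_eq_interior) auto
    moreover have "(\<Prod>j\<in>{1..Suc n}. avoids U (h j)) = 1 \<longleftrightarrow> (\<forall>j\<in>{1..Suc n}. avoids U (h j) = 1)" for h
      using prod_if_one_zero[of "{1..Suc n}" "\<lambda>j. frontier (closure (h j)) \<inter> U = {}"] by (auto simp: avoids_def split: if_splits)
    ultimately show "(\<forall>j\<in>{1..n + 1}. frontier (quasi W \<omega> n j) \<inter> U = {}) \<longleftrightarrow>
      (\<Prod>j\<in>{1..Suc n}. avoids U (urn_cell (interior W) (fst (inputs \<omega>)) (snd (inputs \<omega>)) n j)) = 1"
      by simp
  qed
qed

text \<open>Conditioning on the independent number of decisions produces the geometric weights of
  \<open>yule_value\<close>, with the urn expectations as coefficients.\<close>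

lemma emeasure_mecke_avoiding:
  assumes U: "open U" "U \<inter> frontier W = {}" and \<nu>: "mecke_time \<Lambda> W N \<gamma> \<alpha> t \<nu>" and t: "0 \<le> t"
  shows "emeasure N {\<omega> \<in> space N. \<forall>j\<in>{1..\<nu> \<omega> + 1}. frontier (quasi W \<omega> (\<nu> \<omega>) j) \<inter> U = {}} =
    cell_functional.yule_value \<mu> cell_split rate (avoids U) t (interior W)"
proof -
  interpret A: cell_functional "cell_space W" \<mu> cell_split cell_hit "{}" rate "avoids U"
    using U(1) by (rule cell_functional_avoids)
  have indep: "indep_rv N (count_space UNIV) \<nu> (line_seqs \<Otimes>\<^sub>M choice_seqs) inputs"
    and prob_\<nu>: "measure N {\<omega> \<in> space N. \<nu> \<omega> = k} = exp (- rate * t) * (1 - exp (- rate * t)) ^ k" for k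
    using \<nu> unfolding mecke_time_def inputs_def[abs_def] rate_def by auto
  have \<nu>_meas[measurable]: "\<nu> \<in> N \<rightarrow>\<^sub>M count_space UNIV" using indep by (simp add: indep_rv_def)
  note [measurable] = pred_quasi_avoiding[OF U(1)]
  let ?F = "\<lambda>k p. \<Prod>j\<in>{1..Suc k}. avoids U (urn_cell (interior W) (fst p) (snd p) k j)"
  let ?S = "\<lambda>k. {p \<in> space (line_seqs \<Otimes>\<^sub>M choice_seqs). ?F k p = 1}"
  let ?V = "\<lambda>k. {\<omega> \<in> space N. \<nu> \<omega> = k \<and> (\<forall>j\<in>{1..k + 1}. frontier (quasi W \<omega> k j) \<inter> U = {})}"
  let ?I = "\<lambda>k. inputs -` ?S k \<inter> space N" and ?T = "\<lambda>k. \<nu> -` {k} \<inter> space N"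
  have F[measurable]: "?F k \<in> borel_measurable (line_seqs \<Otimes>\<^sub>M choice_seqs)" for k
    by (intro borel_measurable_prod_ennreal measurable_compose[OF measurable_urn_cell_inputs measurable_avoids[OF U(1)]])
  have S: "?S k \<in> sets (line_seqs \<Otimes>\<^sub>M choice_seqs)" for k by measurable
  have B: "emeasure N ((?I k)) = A.urn_value k (interior W)" for k
  proof -
    have "emeasure N ((?I k)) = (\<integral>\<^sup>+ \<omega>. indicator ((?I k)) \<omega> \<partial>N)"
      by (rule nn_integral_indicator[symmetric]) (rule measurable_sets[OF measurable_inputs S])
    also have "\<dots> = (\<integral>\<^sup>+ \<omega>. ?F k (inputs \<omega>) \<partial>N)"
    proof (intro nn_integral_cong)
      fix \<omega> assume \<omega>: "\<omega> \<in> space N"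
      have "?F k (inputs \<omega>) = 0 \<or> ?F k (inputs \<omega>) = 1"
        using prod_if_one_zero[of "{1..Suc k}" "\<lambda>j. frontier (closure (urn_cell (interior W) (fst (inputs \<omega>)) (snd (inputs \<omega>)) k j)) \<inter> U = {}"]
        unfolding avoids_def by (metis finite_atLeastAtMost)
      then show "indicator ((?I k)) \<omega> = ?F k (inputs \<omega>)"
        using \<omega> measurable_space[OF measurable_inputs \<omega>] by (auto simp: indicator_def)
    qed
    finally show ?thesis unfolding nn_integral_inputs[OF U(1)] .
  qed
  have E: "(?V k) \<in> sets N" for k
    by measurable
  have summand: "emeasure N (?V k) =
      ennreal (exp (- rate * t) * (1 - exp (- rate * t)) ^ k) * A.urn_value k (interior W)" for k
  proof -
    have "emeasure N (?V k) =
        emeasure N (((?T k)) \<inter> ((?I k)))"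
    proof (rule emeasure_eq_AE)
      show "AE \<omega> in N. \<omega> \<in> (?V k) \<longleftrightarrow>
          \<omega> \<in> ((?T k)) \<inter> ((?I k))"
        using AE_avoiding_iff[OF U]
      proof eventually_elim
        case (elim \<omega>)
        then show ?case using measurable_space[OF measurable_inputs, of \<omega>] by blast
      qed
      show "((?T k)) \<inter> ((?I k)) \<in> sets N"
        by (intro sets.Int measurable_sets[OF \<nu>_meas] measurable_sets[OF measurable_inputs S]) simp
    qed (rule E)
    also have "\<dots> = ennreal (N.prob ((?T k)) * N.prob ((?I k)))"
    proof -
      have "N.prob (((?T k)) \<inter> ((?I k))) =
          N.prob ((?T k)) * N.prob ((?I k))"
      proof (rule N.indep_setD)
        show "N.indep_set {\<nu> -` T \<inter> space N | T. T \<in> sets (count_space UNIV)}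
            {inputs -` T \<inter> space N | T. T \<in> sets (line_seqs \<Otimes>\<^sub>M choice_seqs)}"
          using indep unfolding indep_rv_def by blast
        show "(?T k) \<in> {\<nu> -` T \<inter> space N | T. T \<in> sets (count_space UNIV)}"
          by (rule CollectI, rule exI[of _ "{k}"]) simp
        show "(?I k) \<in> {inputs -` T \<inter> space N | T. T \<in> sets (line_seqs \<Otimes>\<^sub>M choice_seqs)}"
          by (rule CollectI, rule exI[of _ "?S k"], rule conjI[OF refl S])
      qed
      then show ?thesis by (simp add: N.emeasure_eq_measure)
    qed
    also have "(?T k) = {\<omega> \<in> space N. \<nu> \<omega> = k}" by auto
    finally show ?thesis
      unfolding prob_\<nu> B[symmetric] N.emeasure_eq_measure by (simp add: ennreal_mult'')
  qed
  have "{\<omega> \<in> space N. \<forall>j\<in>{1..\<nu> \<omega> + 1}. frontier (quasi W \<omega> (\<nu> \<omega>) j) \<inter> U = {}} =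
      (\<Union>k. (?V k))"
    by auto
  also have "emeasure N \<dots> = (\<Sum>k. emeasure N (?V k))"
    using E by (intro suminf_emeasure[symmetric]) (auto simp: disjoint_family_on_def)
  also have "\<dots> = (\<Sum>k. ennreal (exp (- rate * t)) * (ennreal ((1 - exp (- rate * t)) ^ k) * A.urn_value k (interior W)))"
    unfolding summand by (simp add: ennreal_mult' mult.assoc)
  also have "\<dots> = A.yule_value t (interior W)"
    by (simp add: A.yule_value_def A.urn_series_def)
  finally show ?thesis .
qed

end

section \<open>Equality in distribution\<close>

text \<open>A closed set disjoint from \<open>K\<close> keeps a positive distance from it. This
  replaces a closure by a countable union of conditions on open neighbourhoods of
  \<open>K\<close>.\<close>

lemma closure_Int_compact_empty_iff:
  fixes A :: "'a :: heine_borel set"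
  assumes "compact K"
  shows "closure A \<inter> K = {} \<longleftrightarrow> (\<exists>n. A \<inter> (\<Union>x\<in>K. ball x (1 / real (Suc n))) = {})"
proof
  assume "closure A \<inter> K = {}"
  then obtain d where d: "0 < d" "\<And>x y. x \<in> K \<Longrightarrow> y \<in> closure A \<Longrightarrow> d \<le> dist x y"
    using separate_compact_closed[OF assms closed_closure[of A]] by (auto simp: Int_commute)
  obtain n where n: "1 / real (Suc n) < d" using nat_approx_posE[OF d(1)] .
  have "A \<inter> (\<Union>x\<in>K. ball x (1 / real (Suc n))) = {}"
    using d(2) n closure_subset[of A] by (fastforce simp: not_less[symmetric])
  then show "\<exists>n. A \<inter> (\<Union>x\<in>K. ball x (1 / real (Suc n))) = {}" ..
next
  assume "\<exists>n. A \<inter> (\<Union>x\<in>K. ball x (1 / real (Suc n))) = {}"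
  then obtain n where n: "A \<inter> (\<Union>x\<in>K. ball x (1 / real (Suc n))) = {}" ..
  have "closure A \<inter> (\<Union>x\<in>K. ball x (1 / real (Suc n))) = {}"
    using n open_Int_closure_eq_empty[of "\<Union>x\<in>K. ball x (1 / real (Suc n))" A] by (simp add: Int_commute open_UN)
  moreover have "K \<subseteq> (\<Union>x\<in>K. ball x (1 / real (Suc n)))" by force
  ultimately show "closure A \<inter> K = {}" by blast
qed

text \<open>Removing the boundary of \<open>W\<close> from the neighbourhood absorbs the difference
  \<open>- frontier W\<close> in both tessellations, so that avoidance becomes a condition on each
  cell separately.\<close>

definition test_set :: "(real^2) set \<Rightarrow> (real^2) set \<Rightarrow> nat \<Rightarrow> (real^2) set" where
  "test_set W K n = (\<Union>x\<in>K. ball x (1 / real (Suc n))) - frontier W"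

lemma open_test_set: "open (test_set W K n)"
  unfolding test_set_def by (intro open_Diff open_UN) auto

lemma test_set_frontier: "test_set W K n \<inter> frontier W = {}"
  by (auto simp: test_set_def)

lemma test_set_antimono: "m \<le> n \<Longrightarrow> test_set W K n \<subseteq> test_set W K m"
proof -
  assume "m \<le> n"
  then have "1 / real (Suc n) \<le> 1 / real (Suc m)" by (simp add: frac_le)
  then show ?thesis unfolding test_set_def by (fastforce intro: order_less_le_trans)
qed

lemma closure_Union_Int_compact_empty_iff:
  assumes "compact K"
  shows "closure ((\<Union>v\<in>V. A v) - frontier W) \<inter> K = {} \<longleftrightarrow> (\<exists>n. \<forall>v\<in>V. A v \<inter> test_set W K n = {})"
  unfolding closure_Int_compact_empty_iff[OF assms] test_set_def by blast

lemma space_closed_set_space: "space closed_set_space = {F. closed F}"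
  unfolding closed_set_space_def by (rule space_measure_of) auto

text \<open>Complements are used as generators because missing \<open>K\<close> and missing
  \<open>L\<close> together means missing the compact union, whereas hitting events are not stable
  under intersection.\<close>

lemma sets_closed_set_space:
  "sets closed_set_space = sigma_sets {F. closed F} {{F. closed F \<and> F \<inter> K = {}} | K. compact K}"
proof -
  have "sets closed_set_space = sigma_sets {F. closed F} {{F. closed F \<and> F \<inter> K \<noteq> {}} | K. compact K}"
    unfolding closed_set_space_def by (rule sets_measure_of) auto
  also have "\<dots> = sigma_sets {F. closed F} {{F. closed F \<and> F \<inter> K = {}} | K. compact K}"
  proof (rule sigma_sets_eqI)
    fix A :: "(real^2) set set" assume "A \<in> {{F. closed F \<and> F \<inter> K \<noteq> {}} | K. compact K}"
    then obtain K where K: "compact K" "A = {F. closed F} - {F. closed F \<and> F \<inter> K = {}}" by blast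
    show "A \<in> sigma_sets {F. closed F} {{F. closed F \<and> F \<inter> K = {}} | K. compact K}"
      unfolding K(2) by (rule sigma_sets.Compl, rule sigma_sets.Basic) (use K(1) in blast)
  next
    fix A :: "(real^2) set set" assume "A \<in> {{F. closed F \<and> F \<inter> K = {}} | K. compact K}"
    then obtain K where K: "compact K" "A = {F. closed F} - {F. closed F \<and> F \<inter> K \<noteq> {}}" by blast
    show "A \<in> sigma_sets {F. closed F} {{F. closed F \<and> F \<inter> K \<noteq> {}} | K. compact K}"
      unfolding K(2) by (rule sigma_sets.Compl, rule sigma_sets.Basic) (use K(1) in blast)
  qed
  finally show ?thesis .
qed

lemma measurable_closed_set_space:
  assumes "\<And>\<omega>. \<omega> \<in> space M \<Longrightarrow> closed (Y \<omega>)"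
    and "\<And>K. compact K \<Longrightarrow> {\<omega> \<in> space M. Y \<omega> \<inter> K = {}} \<in> sets M"
  shows "Y \<in> M \<rightarrow>\<^sub>M closed_set_space"
  unfolding closed_set_space_def
proof (rule measurable_measure_of)
  fix A :: "(real^2) set set" assume "A \<in> {{F. closed F \<and> F \<inter> K \<noteq> {}} | K. compact K}"
  then obtain K where K: "compact K" "A = {F. closed F \<and> F \<inter> K \<noteq> {}}" by blast
  have "Y -` A \<inter> space M = space M - {\<omega> \<in> space M. Y \<omega> \<inter> K = {}}"
    using assms(1) unfolding K(2) by blast
  then show "Y -` A \<inter> space M \<in> sets M" using assms(2)[OF K(1)] by auto
qed (use assms(1) in auto)

text \<open>The uniqueness part of Choquet's theorem: the law of a random closed set is determined
  by its avoidance probabilities on compact sets.\<close>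

lemma distr_closed_set_space_eqI:
  assumes M: "prob_space M" and Y: "Y \<in> M \<rightarrow>\<^sub>M closed_set_space" and Z: "Z \<in> N \<rightarrow>\<^sub>M closed_set_space"
    and eq: "\<And>K. compact K \<Longrightarrow>
      emeasure M {\<omega> \<in> space M. Y \<omega> \<inter> K = {}} = emeasure N {\<omega> \<in> space N. Z \<omega> \<inter> K = {}}"
  shows "distr M closed_set_space Y = distr N closed_set_space Z"
proof (rule measure_eqI_generator_eq)
  let ?E = "{{F :: (real^2) set. closed F \<and> F \<inter> K = {}} | K. compact K}"
  show "Int_stable ?E"
  proof (rule Int_stableI)
    fix A B :: "(real^2) set set" assume "A \<in> ?E" "B \<in> ?E"
    then obtain K L where KL: "compact K" "compact L" "A = {F. closed F \<and> F \<inter> K = {}}" "B = {F. closed F \<and> F \<inter> L = {}}"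
      by blast
    then have "A \<inter> B = {F. closed F \<and> F \<inter> (K \<union> L) = {}}" by blast
    then show "A \<inter> B \<in> ?E" using compact_Un[OF KL(1,2)] by blast
  qed
  show "?E \<subseteq> Pow {F. closed F}" by blast
  show "sets (distr M closed_set_space Y) = sigma_sets {F. closed F} ?E"
    "sets (distr N closed_set_space Z) = sigma_sets {F. closed F} ?E"
    by (simp_all add: sets_closed_set_space)
  show "range (\<lambda>i :: nat. {F :: (real^2) set. closed F}) \<subseteq> ?E"
    by (auto intro!: exI[of _ "{}"])
  show "(\<Union>i :: nat. {F :: (real^2) set. closed F}) = {F. closed F}" by simp
  show "emeasure (distr M closed_set_space Y) {F. closed F} \<noteq> \<infinity>"
    using prob_space.emeasure_space_1[OF prob_space.prob_space_distr[OF M Y]] by (simp add: space_closed_set_space)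
  fix A :: "(real^2) set set" assume "A \<in> ?E"
  then obtain K where K: "compact K" "A = {F. closed F \<and> F \<inter> K = {}}" by blast
  have A: "A \<in> sets closed_set_space"
    unfolding sets_closed_set_space K(2) by (rule sigma_sets.Basic) (use K(1) in blast)
  have "Y -` A \<inter> space M = {\<omega> \<in> space M. Y \<omega> \<inter> K = {}}" "Z -` A \<inter> space N = {\<omega> \<in> space N. Z \<omega> \<inter> K = {}}"
    using measurable_space[OF Y] measurable_space[OF Z] unfolding K(2) space_closed_set_space by blast+
  then show "emeasure (distr M closed_set_space Y) A = emeasure (distr N closed_set_space Z) A"
    using eq[OF K(1)] A Y Z by (simp add: emeasure_distr)
qed

theorem theorem1:
  fixes W :: "(real^2) set" and \<Lambda> :: "(real^2) set measure" and t :: real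
    and M :: "'a measure" and \<tau> :: "bool list \<Rightarrow> 'a \<Rightarrow> real" and g :: "bool list \<Rightarrow> 'a \<Rightarrow> (real^2) set"
    and N :: "'b measure" and \<gamma> :: "nat \<Rightarrow> 'b \<Rightarrow> (real^2) set" and \<alpha> :: "nat \<Rightarrow> 'b \<Rightarrow> nat"
    and \<nu> :: "'b \<Rightarrow> nat"
  defines "Y_STIT \<equiv> \<lambda>\<omega>. stit_set W (\<lambda>v. \<tau> v \<omega>) (\<lambda>v. g v \<omega>) t"
    and "Y_Mecke \<equiv> \<lambda>\<omega>. mecke_set W (\<lambda>j. \<gamma> j \<omega>) (\<lambda>j. \<alpha> j \<omega>) (\<nu> \<omega>)"
  assumes "polytope W" and "interior W \<noteq> {}"
    and "sets \<Lambda> = sets line_space"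
    and "emeasure \<Lambda> (space \<Lambda>) \<noteq> 0"
    and "locally_finite \<Lambda>"
    and "translation_invariant \<Lambda>"
    and "\<not> concentrated_on_one_direction \<Lambda>"
    and "0 \<le> t"
    and "stit_model \<Lambda> W M \<tau> g"
    and "mecke_model \<Lambda> W N \<gamma> \<alpha>"
    and "mecke_time \<Lambda> W N \<gamma> \<alpha> t \<nu>"
  shows "Y_STIT \<in> measurable M closed_set_space \<and>
         Y_Mecke \<in> measurable N closed_set_space \<and>
         distr N closed_set_space Y_Mecke = distr M closed_set_space Y_STIT"
proof -
  interpret line_measure W \<Lambda>
    using assms(3-8) by unfold_locales (auto intro: polytope_imp_convex polytope_imp_compact)
  interpret S: stit_process W \<Lambda> M \<tau> g
    by unfold_locales fact
  interpret Me: mecke_process W \<Lambda> N \<gamma> \<alpha>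
    by unfold_locales fact
  define S where "S K n = {\<omega> \<in> space M. \<forall>v. S.alive t \<omega> v \<longrightarrow> S.avoiding (test_set W K n) \<omega> v}" for K n
  define Q where "Q K n = {\<omega> \<in> space N. \<forall>j\<in>{1..\<nu> \<omega> + 1}.
    frontier (quasi_cell W (\<lambda>i. \<gamma> i \<omega>) (\<lambda>i. \<alpha> i \<omega>) (\<nu> \<omega>) j) \<inter> test_set W K n = {}}" for K n
  have S_eq: "{\<omega> \<in> space M. Y_STIT \<omega> \<inter> K = {}} = (\<Union>n. S K n)" if "compact K" for K
    unfolding Y_STIT_def stit_set_def closure_Union_Int_compact_empty_iff[OF that] S_def S.alive_def S.avoiding_def
    by auto
  have Q_eq: "{\<omega> \<in> space N. Y_Mecke \<omega> \<inter> K = {}} = (\<Union>n. Q K n)" if "compact K" for K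
    unfolding Y_Mecke_def mecke_set_def closure_Union_Int_compact_empty_iff[OF that] Q_def
    by auto
  have S_sets: "S K n \<in> sets M" for K n
  proof -
    note [measurable] = S.pred_avoiding[OF open_test_set]
    show ?thesis unfolding S_def by measurable
  qed
  have Q_sets: "Q K n \<in> sets N" for K n
  proof -
    note [measurable] = Me.pred_quasi_avoiding[OF open_test_set]
    have [measurable]: "\<nu> \<in> N \<rightarrow>\<^sub>M count_space UNIV"
      using assms(13) by (simp add: mecke_time_def indep_rv_def)
    have "Measurable.pred N (\<lambda>\<omega>. \<forall>j\<in>{1..\<nu> \<omega> + 1}.
        frontier (quasi_cell W (\<lambda>i. \<gamma> i \<omega>) (\<lambda>i. \<alpha> i \<omega>) (\<nu> \<omega>) j) \<inter> test_set W K n = {})"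
      by (rule measurable_compose_countable[where f="\<lambda>k \<omega>. \<forall>j\<in>{1..k + 1}.
        frontier (quasi_cell W (\<lambda>i. \<gamma> i \<omega>) (\<lambda>i. \<alpha> i \<omega>) k j) \<inter> test_set W K n = {}"]) measurable
    then show ?thesis unfolding Q_def by measurable
  qed
  have Y_STIT: "Y_STIT \<in> M \<rightarrow>\<^sub>M closed_set_space"
  proof (rule measurable_closed_set_space)
    show "closed (Y_STIT \<omega>)" for \<omega> by (simp add: Y_STIT_def stit_set_def)
    show "{\<omega> \<in> space M. Y_STIT \<omega> \<inter> K = {}} \<in> sets M" if "compact K" for K
      unfolding S_eq[OF that] using S_sets by blast
  qed
  have Y_Mecke: "Y_Mecke \<in> N \<rightarrow>\<^sub>M closed_set_space"
  proof (rule measurable_closed_set_space)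
    show "closed (Y_Mecke \<omega>)" for \<omega> by (simp add: Y_Mecke_def mecke_set_def)
    show "{\<omega> \<in> space N. Y_Mecke \<omega> \<inter> K = {}} \<in> sets N" if "compact K" for K
      unfolding Q_eq[OF that] using Q_sets by blast
  qed
  have "distr N closed_set_space Y_Mecke = distr M closed_set_space Y_STIT"
  proof (rule distr_closed_set_space_eqI[OF Me.N.prob_space_axioms Y_Mecke Y_STIT])
    fix K :: "(real^2) set" assume K: "compact K"
    have eq: "emeasure N (Q K n) = emeasure M (S K n)" for n
      unfolding Q_def S_def
      using Me.emeasure_mecke_avoiding[OF open_test_set test_set_frontier assms(13,10)]
        S.emeasure_avoiding[OF open_test_set assms(10)] by simp
    have incS: "incseq (S K)"
      using test_set_antimono[of _ _ W K] unfolding S_def S.avoiding_def by (intro monoI) blast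
    have incQ: "incseq (Q K)"
      using test_set_antimono[of _ _ W K] unfolding Q_def by (intro monoI) blast
    \<comment> \<open>The test sets shrink to \<open>K\<close> minus the boundary of
      \<open>W\<close>, so the avoidance events increase and equality passes to their unions by
      continuity from below.\<close>
    have "emeasure N (\<Union>n. Q K n) = (SUP n. emeasure N (Q K n))"
      using incQ Q_sets by (intro SUP_emeasure_incseq[symmetric]) auto
    also have "\<dots> = (SUP n. emeasure M (S K n))" by (simp only: eq)
    also have "\<dots> = emeasure M (\<Union>n. S K n)"
      using incS S_sets by (intro SUP_emeasure_incseq) auto
    finally show "emeasure N {\<omega> \<in> space N. Y_Mecke \<omega> \<inter> K = {}} = emeasure M {\<omega> \<in> space M. Y_STIT \<omega> \<inter> K = {}}"
      by (simp only: S_eq[OF K] Q_eq[OF K])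
  qed
  with Y_STIT Y_Mecke show ?thesis by blast
qed

end
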